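(* Given $\epsilon>0$, for any real $R>1$, any real $M>0$ with $2M\le R^{5/8}$, and any $U$ with $u_{j_0}\le U\le R^{5/4}M^{-2}$ we have $$S(U,2U,M)\ll UM^2R^{3/8+\epsilon},$$ where the implied constant does not depend on $R,M,U$.
   Context: Let $r_\infty>0$ and let $f_1,f_2$ be real functions on $[0,r_\infty]$ with $f_2\le f_1$ such that $\mathbb{E}=\{(x,y,z)\in\mathbb{R}^3: f_2(r)\le z\le f_1(r),\ 0\le r\le r_\infty\}$, $r=\sqrt{x^2+y^2}$, is a smooth convex body (compact, convex, non-empty interior, boundary a smooth surface with everywhere positive Gaussian curvature), with $f_1,f_2$ real analytic on $[0,r_\infty)$. Write $f=f_1$. Let $0=r_0<r_1<\dots<r_{j_0-1}$ be the (finitely many) zeros of $f'''$ in $[0,r_\infty)$, fix any $r_{j_0}$ with $r_{j_0-1}<r_{j_0}<r_\infty$, and set $u_{j_0}=(f'(r_{j_0}))^2$. Let $g(\vec v)=\sup\{\vec x\cdot\vec v:\vec x\in\mathbb{E}\}$ be the support function of $\mathbb{E}$ and $h(n,m)=g(\sqrt n,0,m)$ for $n,m>0$. Let $e(t)=e^{2\pi i t}$ and let $r_2(n)$ be the number of pairs $(a,b)\in\mathbb{Z}^2$ with $a^2+b^2=n$. For real $U_1<U_2$, $M>0$, $R>1$ define $$S(U_1,U_2,M)=\sum_{\substack{U_1\le n/m^2<U_2\\ M\le m<2M}} r_2(n)\,e(Rh(n,m)),$$ the sum running over positive integers $n,m$. The notation $A\ll B$ means $|A|\le C|B|$ with a constant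 $C$ that may depend on $\mathbb{E}$, the choice of $r_{j_0}$ and $\epsilon$ only. *)

theory Defs
  imports "HOL-Analysis.Analysis"
begin

text \<open>
  On an open set, the following is \<open>C\<^sup>k\<close>-regularity in terms of iterated directional
  derivatives.
\<close>

primrec Ck_on :: "nat \<Rightarrow> 'a::real_normed_vector set \<Rightarrow> ('a \<Rightarrow> 'b::real_normed_vector) \<Rightarrow> bool" where
  "Ck_on 0 S F \<longleftrightarrow> continuous_on S F"
| "Ck_on (Suc k) S F \<longleftrightarrow>
     (\<forall>x\<in>S. F differentiable (at x)) \<and>
     (\<forall>v. Ck_on k S (\<lambda>x. frechet_derivative F (at x) v))"

definition smooth_on :: "'a::real_normed_vector set \<Rightarrow> ('a \<Rightarrow> 'b::real_normed_vector) \<Rightarrow> bool" where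
  "smooth_on S F \<longleftrightarrow> (\<forall>k. Ck_on k S F)"

definition du :: "(real \<times> real \<Rightarrow> real^3) \<Rightarrow> real \<times> real \<Rightarrow> real^3" where
  "du X q = frechet_derivative X (at q) (1, 0)"

definition dv :: "(real \<times> real \<Rightarrow> real^3) \<Rightarrow> real \<times> real \<Rightarrow> real^3" where
  "dv X q = frechet_derivative X (at q) (0, 1)"

definition regular_parametrization ::
    "(real^3) set \<Rightarrow> (real \<times> real) set \<Rightarrow> (real \<times> real \<Rightarrow> real^3) \<Rightarrow> bool" where
  "regular_parametrization \<Sigma> V X \<longleftrightarrow>
     open V \<and> smooth_on V X \<and>
     (\<exists>W Y. open W \<and> homeomorphism V (\<Sigma> \<inter> W) X Y) \<and>
     (\<forall>q\<in>V. cross3 (du X q) (dv X q) \<noteq> 0)"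

definition smooth_surface :: "(real^3) set \<Rightarrow> bool" where
  "smooth_surface \<Sigma> \<longleftrightarrow> (\<forall>p\<in>\<Sigma>. \<exists>V X. regular_parametrization \<Sigma> V X \<and> p \<in> X ` V)"

definition unit_normal :: "(real \<times> real \<Rightarrow> real^3) \<Rightarrow> real \<times> real \<Rightarrow> real^3" where
  "unit_normal X q = (1 / norm (cross3 (du X q) (dv X q))) *\<^sub>R cross3 (du X q) (dv X q)"

text \<open>The quotient of the determinants of the second and the first fundamental form.\<close>

definition param_curvature :: "(real \<times> real \<Rightarrow> real^3) \<Rightarrow> real \<times> real \<Rightarrow> real" where
  "param_curvature X q =
     ((du (du X) q \<bullet> unit_normal X q) * (dv (dv X) q \<bullet> unit_normal X q)
        - (dv (du X) q \<bullet> unit_normal X q)\<^sup>2)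
     / ((du X q \<bullet> du X q) * (dv X q \<bullet> dv X q) - (du X q \<bullet> dv X q)\<^sup>2)"

text \<open>
  The curvature does not depend on the parametrization, so at each point of a smooth surface
  the following relation holds for exactly one value of \<open>\<kappa>\<close>.
\<close>

definition has_gaussian_curvature :: "(real^3) set \<Rightarrow> real^3 \<Rightarrow> real \<Rightarrow> bool" where
  "has_gaussian_curvature \<Sigma> p \<kappa> \<longleftrightarrow>
     (\<exists>V X q. regular_parametrization \<Sigma> V X \<and> q \<in> V \<and> X q = p \<and> param_curvature X q = \<kappa>)"

definition smooth_convex_body :: "(real^3) set \<Rightarrow> bool" where
  "smooth_convex_body K \<longleftrightarrow>
     compact K \<and> convex K \<and> interior K \<noteq> {} \<and> smooth_surface (frontier K) \<and>
     (\<forall>p\<in>frontier K. \<exists>\<kappa>>0. has_gaussian_curvature (frontier K) p \<kappa>)"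

text \<open>
  Analyticity relative to \<open>S\<close>: at an end point of an interval belonging to \<open>S\<close>, only the
  values of the function on \<open>S\<close> matter.
\<close>

definition real_analytic_on :: "real set \<Rightarrow> (real \<Rightarrow> real) \<Rightarrow> bool" where
  "real_analytic_on S F \<longleftrightarrow>
     (\<forall>a\<in>S. \<exists>\<delta>>0. \<exists>c. \<forall>x\<in>S. \<bar>x - a\<bar> < \<delta> \<longrightarrow> (\<lambda>k. c k * (x - a) ^ k) sums F x)"

text \<open>Likewise a one-sided derivative at an end point of an interval.\<close>

definition deriv_within :: "real set \<Rightarrow> (real \<Rightarrow> real) \<Rightarrow> real \<Rightarrow> real" where
  "deriv_within S F x = vector_derivative F (at x within S)"

definition rotational_body :: "(real \<Rightarrow> real) \<Rightarrow> (real \<Rightarrow> real) \<Rightarrow> real \<Rightarrow> (real^3) set" where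
  "rotational_body f1 f2 r_inf =
     {p. let r = sqrt ((p$1)\<^sup>2 + (p$2)\<^sup>2) in f2 r \<le> p$3 \<and> p$3 \<le> f1 r \<and> 0 \<le> r \<and> r \<le> r_inf}"

definition support_function :: "(real^3) set \<Rightarrow> real^3 \<Rightarrow> real" where
  "support_function K v = (SUP x\<in>K. x \<bullet> v)"

definition h_fun :: "(real^3) set \<Rightarrow> real \<Rightarrow> real \<Rightarrow> real" where
  "h_fun K n m = support_function K (vector [sqrt n, 0, m])"

definition e_fun :: "real \<Rightarrow> complex" where
  "e_fun t = exp (2 * of_real pi * \<i> * of_real t)"

definition r2 :: "nat \<Rightarrow> nat" where
  "r2 n = card {(a::int, b::int). a\<^sup>2 + b\<^sup>2 = int n}"

definition exp_sum :: "(real^3) set \<Rightarrow> real \<Rightarrow> real \<Rightarrow> real \<Rightarrow> real \<Rightarrow> complex" where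
  "exp_sum K R U1 U2 M =
     (\<Sum>(n, m)\<in>{(n::nat, m::nat). 0 < n \<and> 0 < m \<and>
          U1 \<le> real n / (real m)\<^sup>2 \<and> real n / (real m)\<^sup>2 < U2 \<and> M \<le> real m \<and> real m < 2 * M}.
        of_nat (r2 n) * e_fun (R * h_fun K (real n) (real m)))"

end

(*
  The sum is elementary to bound once the phase is understood. By Cauchy's inequality in n, together
  with the bound X (log X)^2 for the sum of r_2(n)^2 over n <= X, it suffices to bound the mean square
  over n of the inner sum over m. Weyl differencing in m, with shifts up to L = M^2 R^(-3/4), reduces
  this to sums over n of e(R h(n, m) - R h(n, m')), to which van der Corput's second derivative test
  applies. For M <= R^(3/8) the trivial bound is enough.

  If G(s) = sup (f(r) + r s), then h(n, m) = m G(sqrt n / m), and the second derivative of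
  h(n, m) - h(n, m') in n is governed by G'''(s) = - f''' / f''^3 at the point r with f'(r) = -s. This
  does not vanish for r > r_{j0-1}, and it has the exact order s^(-4) as r tends to the equator: there
  the surface is smooth with positive curvature, so the generatrix, parametrized along a line in a
  chart, is a smooth curve with nondegenerate maximal distance from the axis.
*)

theory Submission
  imports Defs
begin

section \<open>Exponential sums over an interval\<close>

text \<open>Differencing is done in m because r_2(n) has no smoothness in n: Cauchy's inequality
  strips it off and leaves n free. The numbers 5/8 and 5/4 come from balancing the mean square,
  which is of order M^2 (U M^2 / L + U M^2 sqrt d1 + 1 / sqrt d2), where d1 = R L / (U^(5/2) M^4)
  and d2 = R / (U^(5/2) M^4) are the second differences at the largest and the smallest shift. The
  target U M^2 R^(3/4) for the first term forces L. The second term then needs M R^(1/8) U^(-5/4) <<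
  R^(3/4), which holds for M <= R^(5/8) with U bounded below; the third needs U^(1/4) M^2 <=
  R^(5/4), which follows from U M^2 <= R^(5/4) and M <= R^(5/8). The obstacle is uniformity in U: it
  has no fixed upper bound, so the points r run up to the equator, where f has a vertical tangent
  and f', f'', f''' are all unbounded. The geometry therefore aims at the single combination f'''
  f'^4 / f''^3, which has a nonzero limit there. \<open>phase_condition\<close> is the interface
  between the two halves.\<close>

lemma norm_e_fun [simp]: "cmod (e_fun t) = 1"
  unfolding e_fun_def by (simp add: norm_exp_eq_Re)

lemma e_fun_add: "e_fun (s + t) = e_fun s * e_fun t"
  unfolding e_fun_def by (simp add: exp_add algebra_simps)

lemma e_fun_minus: "e_fun (- t) = cnj (e_fun t)"
  unfolding e_fun_def by (simp add: exp_cnj)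

lemma e_fun_conv_cis: "e_fun t = cis (2 * pi * t)"
  unfolding e_fun_def cis_conv_exp by (simp add: mult_ac)

lemma e_fun_int [simp]: "e_fun (real_of_int k) = 1"
  unfolding e_fun_conv_cis by (simp add: complex_eq_iff sin_int_2pin cos_int_2pin)

text \<open>The reciprocal of 1 - e(d) has constant real part 1/2 and imaginary part cot (pi d) / 2,
  which is monotone between consecutive integers. This makes the total variation in the summation by
  parts telescope.\<close>

lemma inverse_one_minus_e_fun:
  assumes "sin (pi * d) \<noteq> 0"
  shows "(1 - e_fun d) * Complex (1/2) (cot (pi * d) / 2) = 1"
proof -
  have c: "cos (2 * pi * d) = 1 - 2 * (sin (pi * d))\<^sup>2"
    using cos_double_sin[of "pi * d"] by (simp add: mult.assoc)
  have s: "sin (2 * pi * d) = 2 * sin (pi * d) * cos (pi * d)"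
    using sin_double[of "pi * d"] by (simp add: mult.assoc)
  have t: "(sin (pi * d))\<^sup>2 + (cos (pi * d))\<^sup>2 = 1" by simp
  define S C where "S = sin (pi * d)" and "C = cos (pi * d)"
  have S: "S \<noteq> 0" "S * S + C * C = 1"
    using assms t unfolding S_def C_def by (simp_all add: power2_eq_square)
  have e: "1 - e_fun d = Complex (2 * S * S) (- (2 * S * C))"
    unfolding e_fun_conv_cis complex_eq_iff using c s
    by (simp add: S_def C_def power2_eq_square)
  have "cot (pi * d) = C / S" unfolding cot_def S_def C_def ..
  then show ?thesis unfolding e using S by (simp add: complex_eq_iff field_simps)
qed

text \<open>Jordan's inequality with half its constant, sin (pi d) >= min (d, 1 - d): the mean value
  theorem with cos >= 1/2 up to d = 1/3, then monotonicity from sin (pi/6) = 1/2 up to d = 1/2, then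
  reflection.\<close>

lemma sin_pi_ge:
  assumes "0 < \<theta>" "\<theta> \<le> d" "d \<le> 1 - \<theta>"
  shows "sin (pi * d) \<ge> \<theta>"
proof -
  have half: "sin (pi * d) \<ge> d" if "0 < d" "d \<le> 1/2" for d
  proof (cases "d \<le> 1/3")
    case True
    have "0 < pi * d" using that by simp
    from MVT2[OF this, of sin cos] obtain \<xi> where
      x: "0 < \<xi>" "\<xi> < pi * d" "sin (pi * d) - sin 0 = (pi * d - 0) * cos \<xi>"
      using DERIV_sin by blast
    have "pi * d \<le> pi * (1/3)" using True by (intro mult_left_mono) auto
    then have "\<xi> \<le> pi / 3" using x(2) by linarith
    then have "cos (pi / 3) \<le> cos \<xi>" using x by (intro cos_monotone_0_pi_le) auto
    then have "1/2 \<le> cos \<xi>" by (simp add: cos_60)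
    then have "(pi * d) * (1/2) \<le> sin (pi * d)" using x that by (auto intro!: mult_left_mono)
    moreover have "d * 2 \<le> d * pi" using pi_ge_two that by (intro mult_left_mono) auto
    ultimately show ?thesis by (simp add: mult.commute)
  next
    case False
    have "sin (pi / 6) \<le> sin (pi * d)"
      using False that mult_left_mono[of d "1/2" pi] mult_left_mono[of "1/6" d pi]
      by (intro sin_monotone_2pi_le) auto
    then show ?thesis using that by (simp add: sin_30)
  qed
  show ?thesis
  proof (cases "d \<le> 1/2")
    case True then show ?thesis using half[of d] assms by auto
  next
    case False
    have "sin (pi * (1 - d)) = sin (pi * d)" by (simp add: right_diff_distrib sin_diff)
    then show ?thesis using half[of "1 - d"] assms False by auto
  qed
qed

lemma convex_nat_set_eq_interval:
  fixes T :: "nat set"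
  assumes "finite T" "T \<noteq> {}" "\<And>x y z. x \<in> T \<Longrightarrow> z \<in> T \<Longrightarrow> x \<le> y \<Longrightarrow> y \<le> z \<Longrightarrow> y \<in> T"
  shows "T = {Min T..<Suc (Max T)}"
proof (intro equalityI subsetI)
  fix y assume "y \<in> {Min T..<Suc (Max T)}"
  then show "y \<in> T" using assms(3)[OF Min_in[OF assms(1,2)] Max_in[OF assms(1,2)]] by simp
qed (use assms(1) in \<open>simp add: less_Suc_eq_le\<close>)

section \<open>Summation by parts and the Kusmin-Landau inequality\<close>

lemma sum_by_parts_telescope:
  fixes E c :: "nat \<Rightarrow> complex"
  assumes "p < q"
  shows "(\<Sum>n=p..<q. (E n - E (Suc n)) * c n)
    = E p * c p - E q * c (q - 1) + (\<Sum>n=Suc p..<q. E n * (c n - c (n - 1)))"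
  using assms
proof (induction q)
  case (Suc q)
  show ?case
  proof (cases "p = q")
    case False
    then have "p < q" using Suc.prems by simp
    then show ?thesis using Suc.IH
      by (simp add: sum.atLeastLessThan_Suc algebra_simps)
  qed (simp add: algebra_simps)
qed simp

text \<open>From cot x - cot y = sin (y - x) / (sin x sin y).\<close>

lemma cot_antimono:
  assumes "0 < x" "x \<le> y" "y < pi"
  shows "cot y \<le> cot x"
proof -
  have "0 \<le> sin (y - x)" using assms by (intro sin_ge_zero) auto
  moreover have "sin x > 0" "sin y > 0" using assms by (auto intro!: sin_gt_zero)
  ultimately show ?thesis by (simp add: cot_def field_simps sin_diff)
qed

text \<open>Each summand equals (e(F n) - e(F (n + 1))) c n, with c n the reciprocal of 1 - e(d n),
  and is summed by parts. The two boundary terms cost 1 / (2 \<theta>) each, the monotone cotangents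
  1 / \<theta> in total. The range hypothesis at n = q - 1 involves F q, which is not a
  summand.\<close>

lemma kusmin_landau:
  fixes F :: "nat \<Rightarrow> real"
  assumes th: "0 < \<theta>" and pq: "p \<le> q"
    and mono: "\<And>n. p \<le> n \<Longrightarrow> Suc n < q \<Longrightarrow> F (Suc n) - F n \<le> F (Suc (Suc n)) - F (Suc n)"
    and rng: "\<And>n. p \<le> n \<Longrightarrow> n < q \<Longrightarrow>
      of_int k + \<theta> \<le> F (Suc n) - F n \<and> F (Suc n) - F n \<le> of_int k + 1 - \<theta>"
  shows "cmod (\<Sum>n=p..<q. e_fun (F n)) \<le> 2 / \<theta>"
proof (cases "p = q")
  case True then show ?thesis using th by simp
next
  case False
  with pq have pq: "p < q" by simp
  define d where "d n = F (Suc n) - F n - of_int k" for n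
  define c where "c n = Complex (1/2) (cot (pi * d n) / 2)" for n
  define E where "E n = e_fun (F n)" for n
  have d: "\<theta> \<le> d n" "d n \<le> 1 - \<theta>" if "p \<le> n" "n < q" for n
    using rng[OF that] unfolding d_def by auto
  have s: "sin (pi * d n) \<ge> \<theta>" if "p \<le> n" "n < q" for n
    using sin_pi_ge[OF th d[OF that]] .
  have E: "E n = (E n - E (Suc n)) * c n" if "p \<le> n" "n < q" for n
  proof -
    have "F (Suc n) = F n + (d n + of_int k)" unfolding d_def by simp
    then have "E (Suc n) = E n * e_fun (d n)" unfolding E_def by (simp add: e_fun_add)
    then have "(E n - E (Suc n)) * c n = E n * ((1 - e_fun (d n)) * c n)"
      by (simp add: algebra_simps)
    moreover have "(1 - e_fun (d n)) * c n = 1"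
      unfolding c_def using s[OF that] th by (intro inverse_one_minus_e_fun) auto
    ultimately show ?thesis by simp
  qed
  have cb: "cmod (c n) \<le> 1 / (2 * \<theta>) \<and> \<bar>cot (pi * d n)\<bar> \<le> 1 / \<theta>" if "p \<le> n" "n < q" for n
  proof -
    define y where "y = pi * d n"
    have sy: "sin y \<ge> \<theta>" unfolding y_def using s[OF that] .
    have y: "sin y * sin y + cos y * cos y = 1"
      using sin_cos_squared_add[of y] by (simp add: power2_eq_square)
    have "(cmod (c n))\<^sup>2 = (sin y * sin y + cos y * cos y) / (2 * sin y)\<^sup>2"
      unfolding c_def cmod_power2 y_def[symmetric] using sy th
      by (simp add: cot_def field_simps power2_eq_square)
    then have "(cmod (c n))\<^sup>2 = (1 / (2 * sin y))\<^sup>2"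
      unfolding y by (simp add: power_divide)
    moreover have "0 \<le> 1 / (2 * sin y)" using sy th by simp
    ultimately have "cmod (c n) = 1 / (2 * sin y)"
      by (rule power2_eq_imp_eq[OF _ norm_ge_zero])
    also have "\<dots> \<le> 1 / (2 * \<theta>)" using sy th by (intro divide_left_mono) auto
    finally have 1: "cmod (c n) \<le> 1 / (2 * \<theta>)" .
    have "\<bar>cot y\<bar> = \<bar>cos y\<bar> / sin y" using sy th by (simp add: cot_def)
    also have "\<dots> \<le> 1 / sin y" using sy th by (intro divide_right_mono) auto
    also have "\<dots> \<le> 1 / \<theta>" using sy th by (intro divide_left_mono) auto
    finally show ?thesis using 1 unfolding y_def by blast
  qed
  \<comment> \<open>The real parts of \<open>c\<close> are equal, so the difference is purely
    imaginary; since d increases, its modulus is a signed difference of cotangents, and these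
    telescope.\<close>
  have diff: "cmod (c n - c (n - 1)) = (cot (pi * d (n - 1)) - cot (pi * d n)) / 2"
    if "Suc p \<le> n" "n < q" for n
  proof -
    define n' where "n' = n - 1"
    have n': "n = Suc n'" "p \<le> n'" using that unfolding n'_def by auto
    have "d n' \<le> d n" using mono[of n'] that n' unfolding d_def by auto
    moreover have "0 < d n'" using d(1)[of n'] that n' th by simp
    moreover have "d n < 1" using d(2)[of n] that th by simp
    ultimately have "cot (pi * d n) \<le> cot (pi * d n')"
      by (intro cot_antimono) (auto simp: mult_less_cancel_left)
    moreover have "c n - c n' = Complex 0 ((cot (pi * d n) - cot (pi * d n')) / 2)"
      unfolding c_def by (simp add: complex_eq_iff diff_divide_distrib)
    ultimately show ?thesis using n' by (simp add: cmod_def)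
  qed
  have tel: "(\<Sum>n=Suc p..<q. (cot (pi * d (n - 1)) - cot (pi * d n)))
      = cot (pi * d p) - cot (pi * d (q - 1))"
    using pq
  proof (induction q)
    case (Suc q)
    then show ?case by (cases "p = q") (auto simp: sum.atLeastLessThan_Suc)
  qed simp
  have "(\<Sum>n=p..<q. e_fun (F n)) = (\<Sum>n=p..<q. (E n - E (Suc n)) * c n)"
    using E by (intro sum.cong) (auto simp: E_def[symmetric])
  also have "\<dots> = E p * c p - E q * c (q - 1) + (\<Sum>n=Suc p..<q. E n * (c n - c (n - 1)))"
    using pq by (rule sum_by_parts_telescope)
  also have "cmod \<dots> \<le> cmod (E p * c p) + cmod (E q * c (q - 1)) + (\<Sum>n=Suc p..<q. cmod (E n * (c n - c (n - 1))))"
    by (intro order_trans[OF norm_triangle_ineq] add_mono norm_triangle_ineq4 norm_sum)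
  also have "\<dots> = cmod (c p) + cmod (c (q - 1)) + (\<Sum>n=Suc p..<q. (cot (pi * d (n - 1)) - cot (pi * d n)) / 2)"
    using diff by (intro arg_cong2[where f = "(+)"] sum.cong) (auto simp: norm_mult E_def)
  also have "\<dots> = cmod (c p) + cmod (c (q - 1)) + (cot (pi * d p) - cot (pi * d (q - 1))) / 2"
    unfolding tel[symmetric] by (simp add: sum_divide_distrib[symmetric])
  also have "\<dots> \<le> 1 / (2 * \<theta>) + 1 / (2 * \<theta>) + (1 / \<theta> + 1 / \<theta>) / 2"
  proof -
    have "p \<le> q - 1" "q - 1 < q" using pq by auto
    from cb[OF this] cb[OF order_refl pq] show ?thesis
      by (intro add_mono divide_right_mono) (auto simp del: One_nat_def)
  qed
  also have "\<dots> = 2 / \<theta>" by simp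
  finally show ?thesis .
qed

text \<open>The first differences increase by \<delta> to \<alpha> \<delta> per step. With \<theta>
  = sqrt \<delta>, at most 2 / \<theta> + 1 indices have a difference within \<theta> of a given
  integer, and these are estimated trivially; between two such windows the Kusmin-Landau inequality
  gives 2 / \<theta>. The number of integers passed is at most N \<alpha> \<delta> + 2.\<close>

lemma van_der_corput_second_difference:
  fixes F :: "nat \<Rightarrow> real"
  assumes lam: "0 < \<delta>" and al: "1 \<le> \<alpha>" and AB: "A \<le> B"
    and F: "\<And>n. A \<le> n \<Longrightarrow> n + 2 < B \<Longrightarrow>
      \<delta> \<le> F (n + 2) - 2 * F (n + 1) + F n \<and> F (n + 2) - 2 * F (n + 1) + F n \<le> \<alpha> * \<delta>"
  shows "cmod (\<Sum>n=A..<B. e_fun (F n)) \<le> 20 * (\<alpha> * real (B - A) * sqrt \<delta> + 1 / sqrt \<delta>)"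
proof -
  define \<theta> where "\<theta> = sqrt \<delta>"
  have th: "0 < \<theta>" "\<delta> = \<theta> * \<theta>" unfolding \<theta>_def using lam by auto
  define N where "N = real (B - A)"
  have N: "N \<ge> 0" unfolding N_def by simp
  have triv: "cmod (\<Sum>n=A..<B. e_fun (F n)) \<le> N"
    using norm_sum[of "\<lambda>n. e_fun (F n)" "{A..<B}"] unfolding N_def by simp
  have "cmod (\<Sum>n=A..<B. e_fun (F n)) \<le> 20 * (\<alpha> * N * \<theta> + 1 / \<theta>)"
  \<comment> \<open>The trivial bound N is enough here: N <= 4 \<alpha> N \<theta> if \<theta> >=
    1/4, and N <= 1 <= 1 / \<theta> otherwise.\<close>
  proof (cases "\<theta> \<ge> 1/4 \<or> B < A + 2")
    case True
    have "N \<le> 20 * (\<alpha> * N * \<theta> + 1 / \<theta>)"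
    proof (cases "\<theta> \<ge> 1/4")
      case True
      have "1 * 1 \<le> \<alpha> * (4 * \<theta>)" using True al by (intro mult_mono) auto
      then have "N * 1 \<le> N * (\<alpha> * (4 * \<theta>))" using N by (intro mult_left_mono) auto
      moreover have "0 \<le> \<alpha> * N * \<theta>" "0 \<le> 1 / \<theta>" using al N th by auto
      moreover have "N * (\<alpha> * (4 * \<theta>)) = 4 * (\<alpha> * N * \<theta>)" by simp
      moreover have "x \<le> 20 * (p + t)" if "x * 1 \<le> y" "0 \<le> p" "0 \<le> t" "y = 4 * p" for x y p t :: real
        using that by simp
      ultimately show ?thesis by blast
    next
      case False
      then have "N \<le> 1" using True unfolding N_def by simp
      moreover have "1 \<le> 1 / \<theta>" using False th by simp
      moreover have "0 \<le> \<alpha> * N * \<theta>" using al N th by auto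
      ultimately show ?thesis by simp
    qed
    then show ?thesis using triv by simp
  next
    case False
    then have th4: "\<theta> < 1/4" and AB2: "A + 2 \<le> B" by auto
    define d where "d n = F (Suc n) - F n" for n
    \<comment> \<open>The index B - 1 is left out because its first difference would involve F B;
      its summand is put back at the end at a cost of 1.\<close>
    define S where "S = {A..<B - 1}"
    have dS: "\<delta> \<le> d (Suc n) - d n \<and> d (Suc n) - d n \<le> \<alpha> * \<delta>" if "n \<in> S" "Suc n \<in> S" for n
    proof -
      have "A \<le> n" "n + 2 < B" using that unfolding S_def by auto
      then show ?thesis using F[of n] unfolding d_def by simp
    qed
    have dd: "real (j - i) * \<delta> \<le> d j - d i \<and> d j - d i \<le> real (j - i) * (\<alpha> * \<delta>)"
      if "i \<le> j" "i \<in> S" "j \<in> S" for i j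
      using that
    proof (induction j rule: dec_induct)
      case (step n)
      have "n \<in> S" using step unfolding S_def by auto
      then have "\<delta> \<le> d (Suc n) - d n \<and> d (Suc n) - d n \<le> \<alpha> * \<delta>"
        "real (n - i) * \<delta> \<le> d n - d i \<and> d n - d i \<le> real (n - i) * (\<alpha> * \<delta>)"
        using dS step by auto
      moreover have "real (Suc n - i) = real (n - i) + 1" using step by auto
      ultimately show ?case by (simp add: algebra_simps)
    qed simp
    have dmono: "d i \<le> d j" if "i \<le> j" "i \<in> S" "j \<in> S" for i j
      using dd[OF that] lam by (smt (verit) mult_nonneg_nonneg of_nat_0_le_iff)
    \<comment> \<open>The shift by \<theta> puts the window around k at the bottom of its block:
      \<open>\<kappa> n = k\<close> means k - \<theta> <= d n < k + 1 - \<theta>. So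
      \<open>X\<close> below collects the differences close to k, and \<open>Y\<close> meets the
      range condition of Kusmin-Landau.\<close>
    define \<kappa> where "\<kappa> n = \<lfloor>d n + \<theta>\<rfloor>" for n
    have kmono: "\<kappa> i \<le> \<kappa> j" if "i \<le> j" "i \<in> S" "j \<in> S" for i j
      unfolding \<kappa>_def using dmono[OF that] by (intro floor_mono) auto
    have finS: "finite S" unfolding S_def by simp
    have Sconv: "y \<in> S" if "x \<in> S" "z \<in> S" "x \<le> y" "y \<le> z" for x y z
      using that unfolding S_def by auto
    have block: "cmod (\<Sum>n\<in>{n\<in>S. \<kappa> n = k}. e_fun (F n)) \<le> 5 / \<theta>" for k
    proof -
      define X where "X = {n\<in>S. \<kappa> n = k \<and> d n < of_int k + \<theta>}"
      define Y where "Y = {n\<in>S. \<kappa> n = k \<and> of_int k + \<theta> \<le> d n}"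
      have XY: "{n\<in>S. \<kappa> n = k} = X \<union> Y" "X \<inter> Y = {}" "finite X" "finite Y"
        unfolding X_def Y_def using finS by auto
      have Xc: "y \<in> X" if "x \<in> X" "z \<in> X" "x \<le> y" "y \<le> z" for x y z
      proof -
        have "y \<in> S" using that Sconv[of x z y] unfolding X_def by auto
        then show ?thesis
          using that kmono[of x y] kmono[of y z] dmono[of y z] unfolding X_def by auto
      qed
      have Yc: "y \<in> Y" if "x \<in> Y" "z \<in> Y" "x \<le> y" "y \<le> z" for x y z
      proof -
        have "y \<in> S" using that Sconv[of x z y] unfolding Y_def by auto
        then show ?thesis
          using that kmono[of x y] kmono[of y z] dmono[of x y] unfolding Y_def by auto
      qed
      have "real (card X) \<le> 2 / \<theta> + 1"
      proof (cases "X = {}")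
        case False
        define p q where "p = Min X" and "q = Max X"
        have pq: "p \<in> X" "q \<in> X" "p \<le> q" unfolding p_def q_def using XY False by auto
        have "X = {p..<Suc q}" unfolding p_def q_def
          using convex_nat_set_eq_interval[OF XY(3) False] Xc by blast
        then have c: "real (card X) = real (q - p) + 1" using pq by simp
        have "of_int k \<le> d p + \<theta>" "d q < of_int k + \<theta>"
          using pq unfolding X_def \<kappa>_def by auto
        then have "real (q - p) * \<delta> \<le> 2 * \<theta>"
          using dd[of p q] pq unfolding X_def by auto
        then have "real (q - p) \<le> 2 / \<theta>" using th by (simp add: field_simps)
        then show ?thesis using c by simp
      qed (use th in simp)
      then have 1: "cmod (\<Sum>n\<in>X. e_fun (F n)) \<le> 2 / \<theta> + 1"
        using norm_sum[of "\<lambda>n. e_fun (F n)" X] by simp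
      have 2: "cmod (\<Sum>n\<in>Y. e_fun (F n)) \<le> 2 / \<theta>"
      proof (cases "Y = {}")
        case False
        define p q where "p = Min Y" and "q = Max Y"
        have pq: "p \<in> Y" "q \<in> Y" "p \<le> q" unfolding p_def q_def using XY False by auto
        have Yeq: "Y = {p..<Suc q}" unfolding p_def q_def
          using convex_nat_set_eq_interval[OF XY(4) False] Yc by blast
        show ?thesis unfolding Yeq
        proof (rule kusmin_landau[OF th(1)])
          fix n assume n: "p \<le> n" "n < Suc q"
          then have "n \<in> Y" unfolding Yeq by simp
          then show "of_int k + \<theta> \<le> F (Suc n) - F n \<and> F (Suc n) - F n \<le> of_int k + 1 - \<theta>"
            unfolding Y_def \<kappa>_def d_def by (auto simp: floor_eq_iff)
        next
          fix n assume "p \<le> n" "Suc n < Suc q"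
          then have "n \<in> Y" "Suc n \<in> Y" unfolding Yeq by auto
          then show "F (Suc n) - F n \<le> F (Suc (Suc n)) - F (Suc n)"
            using dmono[of n "Suc n"] unfolding Y_def d_def by auto
        qed (use pq in simp)
      qed (use th in simp)
      have "1 \<le> 1 / \<theta>" using th th4 by simp
      then have "cmod (\<Sum>n\<in>X. e_fun (F n)) + cmod (\<Sum>n\<in>Y. e_fun (F n)) \<le> 5 / \<theta>"
        using 1 2 by (simp add: field_simps)
      then show ?thesis unfolding XY(1) sum.union_disjoint[OF XY(3,4,2)]
        using norm_triangle_ineq order_trans by blast
    qed
    have AS: "A \<in> S" "B - 2 \<in> S" "A \<le> B - 2" using AB2 unfolding S_def by auto
    have "\<kappa> ` S \<subseteq> {\<kappa> A..\<kappa> (B - 2)}"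
    proof safe
      fix n assume n: "n \<in> S"
      then have "A \<le> n" "n \<le> B - 2" unfolding S_def by auto
      then show "\<kappa> n \<in> {\<kappa> A..\<kappa> (B - 2)}" using kmono n AS by auto
    qed
    then have "card (\<kappa> ` S) \<le> card {\<kappa> A..\<kappa> (B - 2)}" by (intro card_mono) auto
    then have "int (card (\<kappa> ` S)) \<le> \<kappa> (B - 2) - \<kappa> A + 1"
      using kmono[OF AS(3,1,2)] by simp
    then have "real (card (\<kappa> ` S)) \<le> of_int (\<kappa> (B - 2)) - of_int (\<kappa> A) + 1"
      by linarith
    also have "\<dots> \<le> d (B - 2) - d A + 2" unfolding \<kappa>_def by linarith
    also have "\<dots> \<le> real (B - 2 - A) * (\<alpha> * \<delta>) + 2" using dd[OF AS(3,1,2)] by simp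
    also have "\<dots> \<le> N * (\<alpha> * \<delta>) + 2"
      unfolding N_def using al lam by (intro add_mono mult_right_mono) auto
    finally have cardk: "real (card (\<kappa> ` S)) \<le> N * (\<alpha> * \<delta>) + 2" .
    have "cmod (\<Sum>n\<in>S. e_fun (F n)) = cmod (\<Sum>k\<in>\<kappa> ` S. \<Sum>n\<in>{n\<in>S. \<kappa> n = k}. e_fun (F n))"
      by (simp only: sum.image_gen[OF finS, of "\<lambda>n. e_fun (F n)" \<kappa>, symmetric])
    also have "\<dots> \<le> (\<Sum>k\<in>\<kappa> ` S. 5 / \<theta>)" using block by (intro sum_norm_le) auto
    also have "\<dots> \<le> (N * (\<alpha> * \<delta>) + 2) * (5 / \<theta>)"
      using cardk th by (simp add: divide_right_mono)
    also have "\<dots> = 5 * (\<alpha> * N * \<theta>) + 10 / \<theta>" using th by (simp add: field_simps)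
    finally have 1: "cmod (\<Sum>n\<in>S. e_fun (F n)) \<le> 5 * (\<alpha> * N * \<theta>) + 10 / \<theta>" .
    have "{A..<B} = insert (B - 1) S" "B - 1 \<notin> S" using AB2 unfolding S_def by auto
    then have "(\<Sum>n=A..<B. e_fun (F n)) = e_fun (F (B - 1)) + (\<Sum>n\<in>S. e_fun (F n))"
      using finS by simp
    then have "cmod (\<Sum>n=A..<B. e_fun (F n)) \<le> 1 + cmod (\<Sum>n\<in>S. e_fun (F n))"
      by (metis norm_e_fun norm_triangle_ineq)
    moreover have "1 \<le> 1 / \<theta>" using th th4 by simp
    moreover have "0 \<le> \<alpha> * N * \<theta>" using al N th by auto
    ultimately show ?thesis using 1 by (simp add: field_simps)
  qed
  then show ?thesis unfolding N_def \<theta>_def .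
qed

section \<open>The mean square of the number of representations as a sum of two squares\<close>

definition sq_reps :: "nat \<Rightarrow> (int \<times> int) set" where
  "sq_reps n = {(a, b). a\<^sup>2 + b\<^sup>2 = int n}"

lemma r2_eq_card: "r2 n = card (sq_reps n)"
  unfolding r2_def sq_reps_def ..

lemma abs_le_if_square_le:
  fixes a :: int
  assumes "a\<^sup>2 \<le> int n" "n < (k + 1)\<^sup>2"
  shows "a \<in> {- int k..int k}"
proof -
  have "int n < int ((k + 1)\<^sup>2)" using assms(2) by (simp only: of_nat_less_iff)
  then have "int n < (int k + 1)\<^sup>2" by (simp add: algebra_simps)
  then have "\<bar>a\<bar>\<^sup>2 < (int k + 1)\<^sup>2" using assms(1) by simp
  then have "\<bar>a\<bar> < int k + 1" by (rule power2_less_imp_less) simp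
  then show ?thesis by auto
qed

lemma sq_reps_subset:
  assumes "n \<le> X" "X < (k + 1)\<^sup>2"
  shows "sq_reps n \<subseteq> {- int k..int k} \<times> {- int k..int k}"
proof -
  have "a \<in> {- int k..int k} \<and> b \<in> {- int k..int k}" if "a\<^sup>2 + b\<^sup>2 = int n" for a b
  proof -
    have "a\<^sup>2 \<le> int X" "b\<^sup>2 \<le> int X"
      using that assms zero_le_power2[of a] zero_le_power2[of b] by linarith+
    then show ?thesis using abs_le_if_square_le[OF _ assms(2)] by blast
  qed
  then show ?thesis unfolding sq_reps_def by auto
qed

lemma finite_sq_reps [simp]: "finite (sq_reps n)"
proof -
  have "n < (n + 1)\<^sup>2" by (simp add: power2_eq_square)
  from sq_reps_subset[OF order_refl this] show ?thesis by (rule finite_subset) simp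
qed

lemma sq_reps_disjoint: "m \<noteq> n \<Longrightarrow> sq_reps m \<inter> sq_reps n = {}"
  unfolding sq_reps_def by auto

lemma nat_sqrt_ex: "\<exists>k::nat. k\<^sup>2 \<le> n \<and> n < (k + 1)\<^sup>2"
proof (induction n)
  case (Suc n)
  then obtain k where k: "k\<^sup>2 \<le> n" "n < (k + 1)\<^sup>2" by auto
  show ?case
  proof (cases "Suc n < (k + 1)\<^sup>2")
    case True then show ?thesis using k by (intro exI[of _ k]) auto
  next
    case False
    then have "Suc n = (k + 1)\<^sup>2" using k by simp
    then show ?thesis by (intro exI[of _ "k + 1"]) (auto simp: power2_eq_square)
  qed
qed (auto intro!: exI[of _ 0])

text \<open>The pairs counted are distinct lattice points of a square with 2 k + 1 points per side,
  k the integer square root of X, and (2 k + 1)^2 <= 9 k^2 <= 9 X.\<close>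

lemma sum_r2_le:
  assumes "X \<ge> 1"
  shows "(\<Sum>n=1..X. r2 n) \<le> 9 * X"
proof -
  obtain k where k: "k\<^sup>2 \<le> X" "X < (k + 1)\<^sup>2" using nat_sqrt_ex by blast
  have "1 \<le> k" using k assms by (cases k) auto
  have "(\<Sum>n=1..X. r2 n) = card (\<Union>n\<in>{1..X}. sq_reps n)"
    unfolding r2_eq_card
    by (rule card_UN_disjoint[symmetric]) (use sq_reps_disjoint in auto)
  also have "\<dots> \<le> card ({- int k..int k} \<times> {- int k..int k})"
    using sq_reps_subset[OF _ k(2)] by (intro card_mono) fastforce+
  also have "\<dots> = (2 * k + 1) * (2 * k + 1)" by (simp add: card_cartesian_product nat_add_distrib nat_mult_distrib)
  also have "\<dots> \<le> (3 * k) * (3 * k)" using \<open>1 \<le> k\<close> by (intro mult_mono) auto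
  also have "\<dots> \<le> 9 * X" using k by (simp add: power2_eq_square)
  finally show ?thesis .
qed

text \<open>Every solution of x y = z w has the form x = g a, z = g b, y = b t, w = a t with a, b
  coprime. For fixed a, b both g and t are at most B / max (a, b), which leaves at most B^2 / (a b)
  solutions, and the sum over all a, b factors into harmonic numbers. Extra logarithms are harmless
  because of the factor R^\<epsilon>.\<close>

lemma card_equal_products_le:
  "real (card {((x, y), (z, w)). x \<in> {1..B} \<and> y \<in> {1..B} \<and> z \<in> {1..B} \<and> w \<in> {1..B} \<and> x * y = z * (w::nat)})
    \<le> (real B)\<^sup>2 * (harm B)\<^sup>2" (is "real (card ?P) \<le> _")
proof -
  define G where "G ab = (\<lambda>(g, t). ((g * fst ab, snd ab * t), (g * snd ab, fst ab * t))) `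
    ({1..B div max (fst ab) (snd ab)} \<times> {1..B div max (fst ab) (snd ab)})" for ab :: "nat \<times> nat"
  have "?P \<subseteq> (\<Union>ab\<in>{1..B}\<times>{1..B}. G ab)"
  proof (clarify)
    fix x y z w :: nat
    assume b: "x \<in> {1..B}" "y \<in> {1..B}" "z \<in> {1..B}" "w \<in> {1..B}" "x * y = z * w"
    define g where "g = gcd x z"
    have "g \<noteq> 0" unfolding g_def using b by auto
    obtain a b' where ab: "x = a * g" "z = b' * g" "coprime a b'"
      using gcd_coprime_exists[of x z] \<open>g \<noteq> 0\<close> unfolding g_def by blast
    have "a * y = b' * w" using b(5) ab \<open>g \<noteq> 0\<close> by (simp add: mult_ac)
    then have "b' dvd y" using ab(3) by (metis coprime_commute coprime_dvd_mult_right_iff dvd_triv_left)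
    then obtain t where t: "y = b' * t" by blast
    have pos: "0 < a" "0 < b'" "0 < t" "0 < g" using ab b t by (auto intro!: Nat.gr0I)
    have w: "w = a * t" using \<open>a * y = b' * w\<close> pos unfolding t by simp
    have "a * g \<le> B" "b' * g \<le> B" "a * t \<le> B" "b' * t \<le> B" using b ab t w by auto
    then have "g * max a b' \<le> B" "t * max a b' \<le> B" by (auto simp: max_def mult.commute)
    then have gt: "g \<le> B div max a b'" "t \<le> B div max a b'"
      using pos by (auto simp: less_eq_div_iff_mult_less_eq max_def)
    have "a \<le> B" "b' \<le> B"
      using \<open>a * g \<le> B\<close> \<open>b' * g \<le> B\<close> pos
      by (metis One_nat_def Suc_leI le_trans mult.right_neutral mult_le_mono2)+
    moreover have "((x, y), (z, w)) \<in> G (a, b')"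
      unfolding G_def using gt pos ab t w by (auto simp: mult_ac intro!: image_eqI[of _ _ "(g, t)"])
    ultimately show "((x, y), (z, w)) \<in> (\<Union>ab\<in>{1..B}\<times>{1..B}. G ab)" using pos by force
  qed
  then have "card ?P \<le> card (\<Union>ab\<in>{1..B}\<times>{1..B}. G ab)"
    by (intro card_mono) (auto simp: G_def)
  also have "\<dots> \<le> (\<Sum>ab\<in>{1..B}\<times>{1..B}. card (G ab))" by (intro card_UN_le) auto
  finally have "real (card ?P) \<le> real (\<Sum>ab\<in>{1..B}\<times>{1..B}. card (G ab))" by (rule of_nat_mono)
  then have "real (card ?P) \<le> (\<Sum>ab\<in>{1..B}\<times>{1..B}. real (card (G ab)))"
    by (simp only: of_nat_sum)
  also have "\<dots> \<le> (\<Sum>ab\<in>{1..B}\<times>{1..B}. (real B)\<^sup>2 * (inverse (real (fst ab)) * inverse (real (snd ab))))"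
  proof (intro sum_mono)
    fix ab assume "ab \<in> {1..B} \<times> {1..B}"
    then obtain a b where ab: "ab = (a, b)" "1 \<le> a" "1 \<le> b" by auto
    have "card (G ab) \<le> card ({1..B div max a b} \<times> {1..B div max a b})"
      unfolding G_def ab fst_conv snd_conv by (rule card_image_le) simp
    then have "real (card (G ab)) \<le> real (B div max a b) * real (B div max a b)"
      by (simp add: card_cartesian_product flip: of_nat_mult)
    also have "\<dots> \<le> (real B / real a) * (real B / real b)"
    proof (intro mult_mono)
      have "real (B div max a b) \<le> real B / real (max a b)" by (rule of_nat_div_le_of_nat)
      also have "\<dots> \<le> real B / real a" using ab by (intro divide_left_mono) auto
      finally show "real (B div max a b) \<le> real B / real a" .
      have "real (B div max a b) \<le> real B / real (max a b)" by (rule of_nat_div_le_of_nat)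
      also have "\<dots> \<le> real B / real b" using ab by (intro divide_left_mono) auto
      finally show "real (B div max a b) \<le> real B / real b" .
    qed auto
    finally show "real (card (G ab)) \<le> (real B)\<^sup>2 * (inverse (real (fst ab)) * inverse (real (snd ab)))"
      using ab by (simp add: field_simps power2_eq_square)
  qed
  also have "\<dots> = (real B)\<^sup>2 * (harm B)\<^sup>2"
  proof -
    have "(harm B)\<^sup>2 = (\<Sum>ab\<in>{1..B}\<times>{1..B}. inverse (real (fst ab)) * inverse (real (snd ab)))"
      unfolding harm_def power2_eq_square sum_product sum.cartesian_product
      by (simp add: case_prod_unfold)
    then show ?thesis by (simp only: sum_distrib_left)
  qed
  finally show ?thesis .
qed

text \<open>If the common product is 0, both pairs have a zero entry, which allows at most (2 (2 B +
  1))^2 cases. Otherwise the absolute values solve the positive problem, with 2^4 choices of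
  signs.\<close>

lemma card_equal_int_products_le:
  "real (card {((x, y), (z, w)). x \<in> {-int B..int B} \<and> y \<in> {-int B..int B} \<and> z \<in> {-int B..int B}
      \<and> w \<in> {-int B..int B} \<and> x * y = z * w})
    \<le> 16 * ((real B)\<^sup>2 * (harm B)\<^sup>2) + 4 * (2 * real B + 1)\<^sup>2" (is "real (card ?T) \<le> _")
proof -
  define P where "P = {((x, y), (z, w)). x \<in> {1..B} \<and> y \<in> {1..B} \<and> z \<in> {1..B} \<and> w \<in> {1..B} \<and> x * y = z * (w::nat)}"
  define W where "W = ({0} \<times> {-int B..int B}) \<union> ({-int B..int B} \<times> {0})"
  define \<Sigma> where "\<Sigma> = {-1, 1::int} \<times> {-1, 1::int}"
  define f where "f = (\<lambda>((s, s'), ((x, y), (z, w))). ((fst s * int x, snd s * int y), (fst s' * int z, snd s' * int w)))"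
  have "P \<subseteq> ({1..B} \<times> {1..B}) \<times> ({1..B} \<times> {1..B})" unfolding P_def by auto
  then have fP: "finite P" by (rule finite_subset) auto
  have W: "card W \<le> 2 * (2 * B + 1)"
  proof -
    have "card W \<le> card ({0::int} \<times> {-int B..int B}) + card ({-int B..int B} \<times> {0::int})"
      unfolding W_def by (rule card_Un_le)
    then show ?thesis by (simp add: card_cartesian_product nat_add_distrib nat_mult_distrib)
  qed
  have "?T \<subseteq> (W \<times> W) \<union> f ` ((\<Sigma> \<times> \<Sigma>) \<times> P)"
  proof
    fix q assume "q \<in> ?T"
    moreover obtain x y z w where q: "q = ((x, y), (z, w))" by (metis prod.collapse)
    ultimately have b: "x \<in> {-int B..int B}" "y \<in> {-int B..int B}" "z \<in> {-int B..int B}"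
      "w \<in> {-int B..int B}" "x * y = z * w" by auto
    show "q \<in> (W \<times> W) \<union> f ` ((\<Sigma> \<times> \<Sigma>) \<times> P)"
    proof (cases "x * y = 0")
      case True then show ?thesis using b unfolding W_def q by auto
    next
      case False
      then have nz: "x \<noteq> 0" "y \<noteq> 0" "z \<noteq> 0" "w \<noteq> 0" using b(5) by auto
      have pos: "nat \<bar>v\<bar> \<in> {1..B}" if "v \<noteq> 0" "v \<in> {-int B..int B}" for v
      proof -
        have "1 \<le> \<bar>v\<bar>" "\<bar>v\<bar> \<le> int B" using that by auto
        then show ?thesis by (simp add: nat_le_iff le_nat_iff)
      qed
      have "nat \<bar>x\<bar> * nat \<bar>y\<bar> = nat \<bar>z\<bar> * nat \<bar>w\<bar>"
        using b(5) by (metis abs_mult abs_ge_zero nat_mult_distrib)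
      then have P: "((nat \<bar>x\<bar>, nat \<bar>y\<bar>), (nat \<bar>z\<bar>, nat \<bar>w\<bar>)) \<in> P"
        unfolding P_def using pos[OF nz(1) b(1)] pos[OF nz(2) b(2)] pos[OF nz(3) b(3)] pos[OF nz(4) b(4)]
        by (simp only: mem_Collect_eq prod.case)
      have S: "((sgn x, sgn y), (sgn z, sgn w)) \<in> \<Sigma> \<times> \<Sigma>"
        unfolding \<Sigma>_def using nz by (auto simp: sgn_if)
      have "f (((sgn x, sgn y), (sgn z, sgn w)), ((nat \<bar>x\<bar>, nat \<bar>y\<bar>), (nat \<bar>z\<bar>, nat \<bar>w\<bar>)))
          = ((x, y), (z, w))"
        unfolding f_def by (simp add: sgn_mult_abs)
      with imageI[OF SigmaI[OF S P], of f] have "((x, y), (z, w)) \<in> f ` ((\<Sigma> \<times> \<Sigma>) \<times> P)"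
        by (simp only:)
      then show ?thesis unfolding q by (rule UnI2)
    qed
  qed
  then have "card ?T \<le> card ((W \<times> W) \<union> f ` ((\<Sigma> \<times> \<Sigma>) \<times> P))"
    by (rule card_mono[rotated]) (simp add: W_def \<Sigma>_def fP)
  also have "\<dots> \<le> card (W \<times> W) + card (f ` ((\<Sigma> \<times> \<Sigma>) \<times> P))" by (rule card_Un_le)
  also have "\<dots> \<le> card W * card W + card ((\<Sigma> \<times> \<Sigma>) \<times> P)"
    by (intro add_mono card_image_le) (auto simp: card_cartesian_product \<Sigma>_def fP)
  also have "card ((\<Sigma> \<times> \<Sigma>) \<times> P) = 16 * card P"
    by (simp add: card_cartesian_product \<Sigma>_def)
  also have "card W * card W \<le> (2 * (2 * B + 1)) * (2 * (2 * B + 1))" using W by (intro mult_mono) auto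
  finally have "card ?T \<le> (2 * (2 * B + 1)) * (2 * (2 * B + 1)) + 16 * card P" by simp
  then have "real (card ?T) \<le> real ((2 * (2 * B + 1)) * (2 * (2 * B + 1)) + 16 * card P)"
    by (rule of_nat_mono)
  also have "\<dots> = 16 * real (card P) + 4 * (2 * real B + 1)\<^sup>2"
    by (simp add: power2_eq_square algebra_simps)
  also have "\<dots> \<le> 16 * ((real B)\<^sup>2 * (harm B)\<^sup>2) + 4 * (2 * real B + 1)\<^sup>2"
    using card_equal_products_le[of B] unfolding P_def by auto
  finally show ?thesis .
qed

lemma harm_le_ln: "n \<ge> 1 \<Longrightarrow> harm n \<le> 1 + ln (real n)"
  using euler_mascheroni_sequence_decreasing[of 1 n] by (simp add: harm_Suc harm_expand)

text \<open>The left side counts solutions of x^2 + y^2 = z^2 + w^2, that is (x - z)(x + z) = (w -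
  y)(w + y). Passing to these four factors is injective, and their squares are at most 4 X; hence
  the choice of \<open>B\<close> as the integer square root of 4 X.\<close>

lemma sum_r2_square_le:
  assumes X: "X \<ge> 1"
  shows "(\<Sum>n=1..X. (real (r2 n))\<^sup>2) \<le> 832 * real X * (1 + ln (real X))\<^sup>2"
proof -
  obtain B where B: "B\<^sup>2 \<le> 4 * X" "4 * X < (B + 1)\<^sup>2" using nat_sqrt_ex by blast
  have B1: "1 \<le> B" using B X by (cases B) auto
  define T where "T = {((x, y), (z, w)). x \<in> {-int B..int B} \<and> y \<in> {-int B..int B} \<and> z \<in> {-int B..int B}
      \<and> w \<in> {-int B..int B} \<and> x * y = z * w}"
  have "T \<subseteq> ({-int B..int B} \<times> {-int B..int B}) \<times> ({-int B..int B} \<times> {-int B..int B})"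
    unfolding T_def by auto
  then have fT: "finite T" by (rule finite_subset) auto
  define Q where "Q = (\<Union>n\<in>{1..X}. sq_reps n \<times> sq_reps n)"
  define f where "f = (\<lambda>((a::int, b::int), (c, d)). ((a - c, a + c), (d - b, d + b)) :: (int \<times> int) \<times> (int \<times> int))"
  have "(\<Sum>n=1..X. (r2 n)\<^sup>2) = (\<Sum>n\<in>{1..X}. card (sq_reps n \<times> sq_reps n))"
    by (simp add: r2_eq_card power2_eq_square card_cartesian_product)
  also have "\<dots> = card Q" unfolding Q_def
    by (rule card_UN_disjoint[symmetric]) (use sq_reps_disjoint in auto)
  also have "\<dots> = card (f ` Q)"
    by (rule card_image[symmetric]) (auto simp: inj_on_def f_def)
  also have "\<dots> \<le> card T"
  proof (intro card_mono[OF fT] image_subsetI)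
    fix q assume "q \<in> Q"
    moreover obtain x y z w where q: "q = ((x, y), (z, w))" by (metis prod.collapse)
    ultimately obtain n where n: "n \<le> X" "x\<^sup>2 + y\<^sup>2 = int n" "z\<^sup>2 + w\<^sup>2 = int n"
      unfolding Q_def sq_reps_def by auto
    have bd: "p + q \<in> {-int B..int B} \<and> p - q \<in> {-int B..int B}" if "p\<^sup>2 \<le> int n" "q\<^sup>2 \<le> int n" for p q :: int
    proof -
      have "(p + q)\<^sup>2 + (p - q)\<^sup>2 = 2 * (p\<^sup>2 + q\<^sup>2)" by (simp add: power2_eq_square algebra_simps)
      moreover have "u \<le> 4 * int X \<and> v \<le> 4 * int X"
        if "u + v = 2 * (s + t)" "0 \<le> u" "0 \<le> v" "s \<le> int n" "t \<le> int n" for u v s t :: int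
        using that n(1) by simp
      ultimately have "(p + q)\<^sup>2 \<le> 4 * int X" "(p - q)\<^sup>2 \<le> 4 * int X"
        using that zero_le_power2 by blast+
      then have "(p + q)\<^sup>2 \<le> int (4 * X)" "(p - q)\<^sup>2 \<le> int (4 * X)" by simp_all
      then show ?thesis using abs_le_if_square_le[OF _ B(2)] by blast
    qed
    have sq: "x\<^sup>2 \<le> int n" "y\<^sup>2 \<le> int n" "z\<^sup>2 \<le> int n" "w\<^sup>2 \<le> int n"
      using n zero_le_power2[of x] zero_le_power2[of y] zero_le_power2[of z] zero_le_power2[of w]
      by linarith+
    have "(x - z) * (x + z) = (w - y) * (w + y)"
      using n by (simp add: power2_eq_square algebra_simps)
    then show "f q \<in> T"
      unfolding q f_def T_def using bd[OF sq(1,3)] bd[OF sq(4,2)] by simp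
  qed
  finally have "real (\<Sum>n=1..X. (r2 n)\<^sup>2) \<le> real (card T)" by (rule of_nat_mono)
  then have "(\<Sum>n=1..X. (real (r2 n))\<^sup>2) \<le> real (card T)" by simp
  also have "\<dots> \<le> 16 * ((real B)\<^sup>2 * (harm B)\<^sup>2) + 4 * (2 * real B + 1)\<^sup>2"
    unfolding T_def by (rule card_equal_int_products_le)
  \<comment> \<open>Uses B^2 <= 4 X, (2 B + 1)^2 <= 9 B^2 <= 36 X and harm B <= 2 (1 + ln X), so
    that 832 = 16 * 4 * 4 + 4 * 36 * 4.\<close>
  also have "\<dots> \<le> 16 * (4 * real X * (2 * (1 + ln (real X)))\<^sup>2) + 4 * (36 * real X * (2 * (1 + ln (real X)))\<^sup>2)"
  proof -
    have Bx: "(real B)\<^sup>2 \<le> 4 * real X" using of_nat_mono[OF B(1), where 'a = real] by simp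
    have "real X * 1 \<le> real X * real X" using X by (intro mult_left_mono) auto
    then have "(real B)\<^sup>2 \<le> (2 * real X)\<^sup>2" using Bx by (simp add: power2_eq_square)
    then have "real B \<le> 2 * real X" by (rule power2_le_imp_le) simp
    then have "ln (real B) \<le> ln (2 * real X)" using B1 by simp
    also have "\<dots> = ln 2 + ln (real X)" using X by (simp add: ln_mult)
    also have "\<dots> \<le> 1 + ln (real X)" using ln_le_minus_one[of 2] by simp
    finally have "ln (real B) \<le> 1 + ln (real X)" .
    moreover have "0 \<le> ln (real X)" using X by simp
    moreover have "harm B \<le> 1 + ln (real B)" using harm_le_ln[OF B1] .
    moreover have "h \<le> 2 * (1 + x)" if "b \<le> 1 + x" "0 \<le> x" "h \<le> 1 + b" for h x b :: real
      using that by simp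
    ultimately have "harm B \<le> 2 * (1 + ln (real X))" by blast
    then have h: "(harm B)\<^sup>2 \<le> (2 * (1 + ln (real X)))\<^sup>2"
      by (intro power_mono) (auto simp: harm_nonneg)
    have "1 \<le> (2 * (1 + ln (real X)))\<^sup>2" using X by (intro one_le_power) simp
    then have "36 * real X * 1 \<le> 36 * real X * (2 * (1 + ln (real X)))\<^sup>2" by (intro mult_left_mono) auto
    moreover have "(2 * real B + 1)\<^sup>2 \<le> (3 * real B)\<^sup>2" using B1 by (intro power_mono) auto
    then have "(2 * real B + 1)\<^sup>2 \<le> 36 * real X" using Bx by (simp add: power_mult_distrib)
    ultimately have "4 * (2 * real B + 1)\<^sup>2 \<le> 4 * (36 * real X * (2 * (1 + ln (real X)))\<^sup>2)" by simp
    moreover have "16 * ((real B)\<^sup>2 * (harm B)\<^sup>2) \<le> 16 * (4 * real X * (2 * (1 + ln (real X)))\<^sup>2)"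
      using Bx h by (intro mult_left_mono mult_mono) auto
    ultimately show ?thesis by (rule add_mono[rotated])
  qed
  also have "\<dots> = 832 * real X * (1 + ln (real X))\<^sup>2"
    by (simp only: power_mult_distrib) simp
  finally show ?thesis .
qed

section \<open>The exponential sum over two variables\<close>

text \<open>The inner sum is averaged over windows of length L: each m lies in exactly L of the P +
  L windows, Cauchy's inequality over the windows gives the factor P + L, and after squaring a pair
  (m1, m2) is counted at most L times. The sum over n is carried out before absolute values are
  taken, so only correlations over n remain.\<close>

lemma weyl_differencing:
  fixes a :: "'n \<Rightarrow> nat \<Rightarrow> complex"
  assumes fin: "finite NN" and I: "I \<subseteq> {..<P}"
  shows "(real L)\<^sup>2 * (\<Sum>n\<in>NN. (cmod (\<Sum>m\<in>I. a n m))\<^sup>2)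
    \<le> real (P + L) * (real L * (\<Sum>(m1, m2)\<in>{(m1, m2)\<in>I\<times>I. m1 < m2 + L \<and> m2 < m1 + L}.
          cmod (\<Sum>n\<in>NN. a n m1 * cnj (a n m2))))"
proof -
  have finI: "finite I" using I finite_subset by blast
  define W where "W k = {m\<in>I. m \<le> k \<and> k < m + L}" for k
  define T where "T p = cmod (\<Sum>n\<in>NN. a n (fst p) * cnj (a n (snd p)))" for p
  define A where "A n k = (\<Sum>m\<in>W k. a n m)" for n k
  have finW: "finite (W k)" for k unfolding W_def using finI by simp
  have sumA: "(\<Sum>k<P + L. A n k) = of_nat L * (\<Sum>m\<in>I. a n m)" for n
  proof -
    have "(\<Sum>k<P + L. A n k) = (\<Sum>k<P + L. \<Sum>m\<in>I. if m \<le> k \<and> k < m + L then a n m else 0)"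
      unfolding A_def W_def by (intro sum.cong sum.inter_filter finI refl)
    also have "\<dots> = (\<Sum>m\<in>I. \<Sum>k<P + L. if m \<le> k \<and> k < m + L then a n m else 0)" by (rule sum.swap)
    also have "\<dots> = (\<Sum>m\<in>I. of_nat L * a n m)"
    proof (rule sum.cong[OF refl])
      fix m assume "m \<in> I"
      then have "{k\<in>{..<P + L}. m \<le> k \<and> k < m + L} = {m..<m + L}" using I by auto
      then show "(\<Sum>k<P + L. if m \<le> k \<and> k < m + L then a n m else 0) = of_nat L * a n m"
        by (simp add: sum.inter_filter[symmetric])
    qed
    finally show ?thesis by (simp add: sum_distrib_left)
  qed
  have cauchy: "(real L)\<^sup>2 * (cmod (\<Sum>m\<in>I. a n m))\<^sup>2 \<le> real (P + L) * (\<Sum>k<P + L. (cmod (A n k))\<^sup>2)" for n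
  proof -
    have "(real L)\<^sup>2 * (cmod (\<Sum>m\<in>I. a n m))\<^sup>2 = (cmod (\<Sum>k<P + L. A n k))\<^sup>2"
      unfolding sumA by (simp add: norm_mult power_mult_distrib)
    also have "\<dots> \<le> (\<Sum>k<P + L. 1 * cmod (A n k))\<^sup>2"
      using norm_sum[of "A n" "{..<P + L}"] by (intro power_mono) auto
    also have "\<dots> \<le> (\<Sum>k<P + L. 1\<^sup>2) * (\<Sum>k<P + L. (cmod (A n k))\<^sup>2)"
      by (rule Cauchy_Schwarz_ineq_sum)
    finally show ?thesis by simp
  qed
  have sq: "(\<Sum>n\<in>NN. (cmod (A n k))\<^sup>2) \<le> (\<Sum>p\<in>W k \<times> W k. T p)" for k
  proof -
    have "complex_of_real (\<Sum>n\<in>NN. (cmod (A n k))\<^sup>2) = (\<Sum>n\<in>NN. A n k * cnj (A n k))"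
      by (simp only: of_real_sum complex_norm_square)
    also have "\<dots> = (\<Sum>n\<in>NN. \<Sum>p\<in>W k \<times> W k. a n (fst p) * cnj (a n (snd p)))"
      unfolding A_def cnj_sum sum_product sum.cartesian_product by (simp add: case_prod_unfold)
    also have "\<dots> = (\<Sum>p\<in>W k \<times> W k. \<Sum>n\<in>NN. a n (fst p) * cnj (a n (snd p)))" by (rule sum.swap)
    finally have "cmod (complex_of_real (\<Sum>n\<in>NN. (cmod (A n k))\<^sup>2)) \<le> (\<Sum>p\<in>W k \<times> W k. T p)"
      unfolding T_def by (simp only: norm_sum)
    then show ?thesis using norm_of_real by (metis abs_le_D1 real_norm_def)
  qed
  define Z where "Z = {(m1, m2)\<in>I\<times>I. m1 < m2 + L \<and> m2 < m1 + L}"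
  have finZ: "finite Z" unfolding Z_def using finI by (auto intro: finite_subset[of _ "I \<times> I"])
  have "(\<Sum>k<P + L. \<Sum>p\<in>W k \<times> W k. T p) = (\<Sum>k<P + L. \<Sum>p\<in>Z. if p \<in> W k \<times> W k then T p else 0)"
  proof (rule sum.cong[OF refl])
    fix k
    have "W k \<times> W k = {p\<in>Z. p \<in> W k \<times> W k}" unfolding Z_def W_def by auto
    then show "(\<Sum>p\<in>W k \<times> W k. T p) = (\<Sum>p\<in>Z. if p \<in> W k \<times> W k then T p else 0)"
      using sum.inter_filter[OF finZ, of T "\<lambda>p. p \<in> W k \<times> W k"] by simp
  qed
  also have "\<dots> = (\<Sum>p\<in>Z. \<Sum>k<P + L. if p \<in> W k \<times> W k then T p else 0)" by (rule sum.swap)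
  also have "\<dots> \<le> (\<Sum>p\<in>Z. real L * T p)"
  proof (rule sum_mono)
    fix p assume "p \<in> Z"
    have "{k\<in>{..<P + L}. p \<in> W k \<times> W k} \<subseteq> {fst p..<fst p + L}" unfolding W_def by auto
    then have "card {k\<in>{..<P + L}. p \<in> W k \<times> W k} \<le> L"
      using card_mono[of "{fst p..<fst p + L}"] by force
    then have "real (card {k\<in>{..<P + L}. p \<in> W k \<times> W k}) * T p \<le> real L * T p"
      unfolding T_def by (intro mult_right_mono) auto
    then show "(\<Sum>k<P + L. if p \<in> W k \<times> W k then T p else 0) \<le> real L * T p"
      by (simp add: sum.inter_filter[symmetric])
  qed
  finally have main: "(\<Sum>k<P + L. \<Sum>p\<in>W k \<times> W k. T p) \<le> real L * (\<Sum>p\<in>Z. T p)"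
    by (simp add: sum_distrib_left)
  have "(real L)\<^sup>2 * (\<Sum>n\<in>NN. (cmod (\<Sum>m\<in>I. a n m))\<^sup>2)
      = (\<Sum>n\<in>NN. (real L)\<^sup>2 * (cmod (\<Sum>m\<in>I. a n m))\<^sup>2)"
    by (rule sum_distrib_left)
  also have "\<dots> \<le> (\<Sum>n\<in>NN. real (P + L) * (\<Sum>k<P + L. (cmod (A n k))\<^sup>2))"
    by (intro sum_mono cauchy)
  also have "\<dots> = real (P + L) * (\<Sum>k<P + L. \<Sum>n\<in>NN. (cmod (A n k))\<^sup>2)"
    by (simp only: sum_distrib_left[symmetric] sum.swap[of _ NN])
  also have "\<dots> \<le> real (P + L) * (\<Sum>k<P + L. \<Sum>p\<in>W k \<times> W k. T p)"
    using sq by (intro mult_left_mono sum_mono) auto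
  also have "\<dots> \<le> real (P + L) * (real L * (\<Sum>p\<in>Z. T p))"
    using main by (intro mult_left_mono) auto
  finally show ?thesis unfolding Z_def T_def by (simp add: case_prod_unfold)
qed

text \<open>Each m1 meets the diagonal once and has at most 2 L partners, so the diagonal gains the
  factor 1 / L. Conjugation exchanges m1 and m2; bounds for m1 < m2 therefore suffice.\<close>

lemma weyl_differencing_bound:
  fixes a :: "'n \<Rightarrow> nat \<Rightarrow> complex"
  assumes fin: "finite NN" and I: "I \<subseteq> {..<P}" and L: "1 \<le> L"
    and N: "\<And>m. m \<in> I \<Longrightarrow> cmod (\<Sum>n\<in>NN. a n m * cnj (a n m)) \<le> N"
    and E: "\<And>m1 m2. m1 \<in> I \<Longrightarrow> m2 \<in> I \<Longrightarrow> m1 < m2 \<Longrightarrow> m2 < m1 + L \<Longrightarrow>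
      cmod (\<Sum>n\<in>NN. a n m1 * cnj (a n m2)) \<le> E"
    and pos: "0 \<le> N" "0 \<le> E"
  shows "(\<Sum>n\<in>NN. (cmod (\<Sum>m\<in>I. a n m))\<^sup>2) \<le> real (P + L) * real P * (N / real L + 2 * E)"
proof -
  have finI: "finite I" using I finite_subset by blast
  have cI: "card I \<le> P" using card_mono[OF _ I] by simp
  define Z where "Z = {(m1, m2)\<in>I\<times>I. m1 < m2 + L \<and> m2 < m1 + L}"
  define J where "J m = {m2\<in>I. m < m2 + L \<and> m2 < m + L}" for m
  have Zs: "Z = Sigma I J" unfolding Z_def J_def by auto
  have finJ: "finite (J m)" for m unfolding J_def using finI by simp
  have Jc: "card (J m) \<le> 2 * L" for m
  proof -
    \<comment> \<open>Truncated subtraction can only shorten this interval.\<close>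
    have "J m \<subseteq> {m + 1 - L..<m + L}" unfolding J_def by auto
    then have "card (J m) \<le> card {m + 1 - L..<m + L}" by (intro card_mono) auto
    then show ?thesis by simp
  qed
  have sym: "cmod (\<Sum>n\<in>NN. a n m1 * cnj (a n m2)) = cmod (\<Sum>n\<in>NN. a n m2 * cnj (a n m1))" for m1 m2
  proof -
    have "(\<Sum>n\<in>NN. a n m1 * cnj (a n m2)) = cnj (\<Sum>n\<in>NN. a n m2 * cnj (a n m1))"
      by (simp add: cnj_sum mult.commute)
    then show ?thesis by (simp only: complex_mod_cnj)
  qed
  have T: "cmod (\<Sum>n\<in>NN. a n m1 * cnj (a n m2)) \<le> (if m2 = m1 then N else 0) + E"
    if "m1 \<in> I" "m2 \<in> J m1" for m1 m2
  proof -
    consider "m1 = m2" | "m1 < m2" | "m2 < m1" by linarith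
    then show ?thesis
    proof cases
      case 1 then show ?thesis using N[OF that(1)] pos by simp
    next
      case 2 then show ?thesis using E[of m1 m2] that unfolding J_def by simp
    next
      case 3 then show ?thesis using E[of m2 m1] that sym[of m1 m2] unfolding J_def by simp
    qed
  qed
  have "(\<Sum>(m1, m2)\<in>Z. cmod (\<Sum>n\<in>NN. a n m1 * cnj (a n m2)))
      = (\<Sum>m1\<in>I. \<Sum>m2\<in>J m1. cmod (\<Sum>n\<in>NN. a n m1 * cnj (a n m2)))"
    unfolding Zs using finI finJ by (subst sum.Sigma) auto
  also have "\<dots> \<le> (\<Sum>m1\<in>I. \<Sum>m2\<in>J m1. (if m2 = m1 then N else 0) + E)"
    using T by (intro sum_mono) auto
  also have "\<dots> \<le> (\<Sum>m1\<in>I. N + 2 * real L * E)"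
  proof (rule sum_mono)
    fix m1 assume "m1 \<in> I"
    have "(\<Sum>m2\<in>J m1. (if m2 = m1 then N else 0) + E)
      = (if m1 \<in> J m1 then N else 0) + real (card (J m1)) * E"
      using finJ by (simp add: sum.distrib)
    also have "\<dots> \<le> N + real (2 * L) * E"
      using pos of_nat_mono[OF Jc[of m1], where 'a = real] by (intro add_mono mult_right_mono) auto
    finally show "(\<Sum>m2\<in>J m1. (if m2 = m1 then N else 0) + E) \<le> N + 2 * real L * E" by simp
  qed
  also have "\<dots> = real (card I) * (N + 2 * real L * E)" by simp
  also have "\<dots> \<le> real P * (N + 2 * real L * E)" using cI pos by (intro mult_right_mono) auto
  finally have Zb: "(\<Sum>(m1, m2)\<in>Z. cmod (\<Sum>n\<in>NN. a n m1 * cnj (a n m2))) \<le> real P * (N + 2 * real L * E)" .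
  have "(real L)\<^sup>2 * (\<Sum>n\<in>NN. (cmod (\<Sum>m\<in>I. a n m))\<^sup>2) \<le> real (P + L) * (real L * (real P * (N + 2 * real L * E)))"
    using Zb by (intro order_trans[OF weyl_differencing[OF fin I]] mult_left_mono) (auto simp: Z_def)
  also have "\<dots> = (real L)\<^sup>2 * (real (P + L) * real P * (N / real L + 2 * E))"
    using L by (simp add: field_simps power2_eq_square)
  finally show ?thesis using L by simp
qed

text \<open>The exponents are those of a phase \<open>h(x, m) = m G(\<surd>x / m)\<close> with \<open>G'''(s)\<close> of order \<open>s\<^sup>-\<^sup>4\<close>.\<close>

definition phase_condition :: "(real \<Rightarrow> real \<Rightarrow> real) \<Rightarrow> real \<Rightarrow> real \<Rightarrow> real \<Rightarrow> real \<Rightarrow> bool" where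
  "phase_condition h u0 \<sigma> c1 c2 \<longleftrightarrow> (\<forall>U\<ge>u0. \<forall>M>0. \<forall>m1 m2 n :: nat.
     M \<le> real m1 \<longrightarrow> m1 < m2 \<longrightarrow> real m2 < 2 * M \<longrightarrow> U * (real m2)\<^sup>2 \<le> real n \<longrightarrow>
     real (n + 2) < 2 * U * (real m1)\<^sup>2 \<longrightarrow>
     (let d2 = (\<lambda>m :: nat. h (real (n + 2)) (real m) - 2 * h (real (n + 1)) (real m) + h (real n) (real m));
          \<delta> = real (m2 - m1) / (U\<^sup>2 * sqrt U * M ^ 4)
      in c1 * \<delta> \<le> \<sigma> * (d2 m1 - d2 m2) \<and> \<sigma> * (d2 m1 - d2 m2) \<le> c2 * \<delta>))"

text \<open>As m1 < m2, both admit n exactly for U m2^2 <= n < 2 U m1^2. The second differences of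
  the phase have the sign \<sigma>; for \<sigma> = -1 the sum is conjugated to make them positive.
  The ratio c2 / c1 serves as the \<alpha> of the second difference test.\<close>

lemma correlation_bound:
  assumes h: "phase_condition h u0 \<sigma> c1 c2" and u0: "0 < u0" and c: "0 < c1" "c1 \<le> c2"
    and sg: "\<sigma> = 1 \<or> \<sigma> = -1" and U: "u0 \<le> U" and M: "0 < M" and R: "0 < R"
    and m: "M \<le> real m1" "m1 < m2" "real m2 < 2 * M"
    and AB: "\<And>n. n \<in> NN \<longleftrightarrow> U * (real m2)\<^sup>2 \<le> real n \<and> real n < 2 * U * (real m1)\<^sup>2"
  defines "\<delta> \<equiv> c1 * R * real (m2 - m1) / (U\<^sup>2 * sqrt U * M ^ 4)"
  shows "cmod (\<Sum>n\<in>NN. e_fun (R * h (real n) (real m1)) * cnj (e_fun (R * h (real n) (real m2))))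
    \<le> 20 * (c2 / c1 * (8 * U * M\<^sup>2) * sqrt \<delta> + 1 / sqrt \<delta>)"
proof -
  have U0: "0 < U" using u0 U by simp
  have \<delta>: "0 < \<delta>" unfolding \<delta>_def using c R U0 M m by simp
  define A where "A = nat \<lceil>U * (real m2)\<^sup>2\<rceil>"
  define B where "B = nat \<lceil>2 * U * (real m1)\<^sup>2\<rceil>"
  have NN: "NN = {A..<B}"
  proof (rule set_eqI)
    fix n
    have "A \<le> n \<longleftrightarrow> U * (real m2)\<^sup>2 \<le> real n" "B \<le> n \<longleftrightarrow> 2 * U * (real m1)\<^sup>2 \<le> real n"
      unfolding A_def B_def by (rule nat_ceiling_le_eq)+
    then show "n \<in> NN \<longleftrightarrow> n \<in> {A..<B}" unfolding AB atLeastLessThan_iff not_le[symmetric] by blast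
  qed
  show ?thesis
  proof (cases "A \<le> B")
    case False
    then have "NN = {}" unfolding NN by simp
    then show ?thesis using \<delta> c U0 by simp
  next
    case True
    define F where "F n = \<sigma> * (R * (h (real n) (real m1) - h (real n) (real m2)))" for n :: nat
    have "cmod (\<Sum>n\<in>NN. e_fun (R * h (real n) (real m1)) * cnj (e_fun (R * h (real n) (real m2))))
      = cmod (\<Sum>n\<in>NN. e_fun (F n))"
      using sg
    proof
      assume "\<sigma> = 1"
      then show ?thesis unfolding F_def e_fun_minus[symmetric] e_fun_add[symmetric] by (simp add: right_diff_distrib)
    next
      assume "\<sigma> = -1"
      then have "(\<Sum>n\<in>NN. e_fun (F n))
        = cnj (\<Sum>n\<in>NN. e_fun (R * h (real n) (real m1)) * cnj (e_fun (R * h (real n) (real m2))))"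
        unfolding F_def cnj_sum complex_cnj_mult e_fun_minus[symmetric] e_fun_add[symmetric]
        by (simp add: right_diff_distrib algebra_simps)
      then show ?thesis by (simp only: complex_mod_cnj)
    qed
    also have "\<dots> \<le> 20 * (c2 / c1 * real (B - A) * sqrt \<delta> + 1 / sqrt \<delta>)"
      unfolding NN
    proof (rule van_der_corput_second_difference[OF \<delta> _ True])
      show "1 \<le> c2 / c1" using c by simp
      fix n assume n: "A \<le> n" "n + 2 < B"
      define d2 where "d2 m = h (real (n + 2)) m - 2 * h (real (n + 1)) m + h (real n) m" for m
      define D where "D = real (m2 - m1) / (U\<^sup>2 * sqrt U * M ^ 4)"
      have "n \<in> NN" "n + 2 \<in> NN" using n unfolding NN by auto
      then have "c1 * D \<le> \<sigma> * (d2 m1 - d2 m2) \<and> \<sigma> * (d2 m1 - d2 m2) \<le> c2 * D"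
        using h[unfolded phase_condition_def, rule_format, OF U M m, of n] AB
        unfolding D_def d2_def Let_def by blast
      then have "R * (c1 * D) \<le> R * (\<sigma> * (d2 m1 - d2 m2)) \<and> R * (\<sigma> * (d2 m1 - d2 m2)) \<le> R * (c2 * D)"
        using R by (intro conjI mult_left_mono) auto
      moreover have "F (n + 2) - 2 * F (n + 1) + F n = R * (\<sigma> * (d2 m1 - d2 m2))"
        unfolding F_def d2_def by (simp add: algebra_simps)
      moreover have "R * (c1 * D) = \<delta>" "R * (c2 * D) = c2 / c1 * \<delta>"
        unfolding \<delta>_def D_def using c by (simp_all add: field_simps)
      ultimately show "\<delta> \<le> F (n + 2) - 2 * F (n + 1) + F n \<and> F (n + 2) - 2 * F (n + 1) + F n \<le> c2 / c1 * \<delta>"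
        by simp
    qed
    also have "\<dots> \<le> 20 * (c2 / c1 * (8 * U * M\<^sup>2) * sqrt \<delta> + 1 / sqrt \<delta>)"
    proof -
      have m1: "real m1 < 2 * M" using m by simp
      \<comment> \<open>Positivity of the lower end gives A >= 1, which compensates for the rounding
        up in \<open>B\<close>: B - A <= B - 1 <= 2 U m1^2.\<close>
      have "0 < U * (real m2)\<^sup>2" using U0 m by simp
      then have "1 \<le> A" unfolding A_def by linarith
      then have "real (B - A) \<le> real B - 1" using True by (simp add: of_nat_diff)
      also have "\<dots> \<le> 2 * U * (real m1)\<^sup>2" unfolding B_def using U0 by (simp add: of_nat_nat)
      also have "\<dots> \<le> 2 * U * (2 * M)\<^sup>2" using m1 U0 by (intro mult_left_mono power_mono) auto
      also have "\<dots> = 8 * U * M\<^sup>2" by (simp add: power_mult_distrib)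
      finally have "c2 / c1 * real (B - A) * sqrt \<delta> \<le> c2 / c1 * (8 * U * M\<^sup>2) * sqrt \<delta>"
        using c \<delta> by (intro mult_left_mono mult_right_mono) auto
      then show ?thesis by simp
    qed
    finally show ?thesis .
  qed
qed

text \<open>The condition on n / m^2 is moved into the coefficient \<open>a\<close>, so that the sum
  runs over a rectangle and n can be treated separately from m. The end point X comes from n < 2 U
  m^2 < 8 U M^2.\<close>

lemma exp_sum_conv_truncated_sum:
  fixes U M R :: real and K :: "(real^3) set"
  assumes "0 < U" "0 < M"
  defines "I \<equiv> {m::nat. 0 < m \<and> M \<le> real m \<and> real m < 2 * M}"
    and "X \<equiv> nat \<lfloor>8 * U * M\<^sup>2\<rfloor>"
    and "a \<equiv> (\<lambda>(n::nat) (m::nat). if U * (real m)\<^sup>2 \<le> real n \<and> real n < 2 * U * (real m)\<^sup>2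
                then e_fun (R * h_fun K (real n) (real m)) else 0)"
  shows "exp_sum K R U (2 * U) M = (\<Sum>n\<in>{1..X}. of_nat (r2 n) * (\<Sum>m\<in>I. a n m))"
proof -
  have finI: "finite I"
  proof (rule finite_subset)
    show "I \<subseteq> {..nat \<lceil>2 * M\<rceil>}" unfolding I_def by (auto simp: le_nat_iff) linarith
  qed simp
  define D where "D = {(n::nat, m::nat). 0 < n \<and> 0 < m \<and> U \<le> real n / (real m)\<^sup>2 \<and>
    real n / (real m)\<^sup>2 < 2 * U \<and> M \<le> real m \<and> real m < 2 * M}"
  have cond: "U \<le> real n / (real m)\<^sup>2 \<longleftrightarrow> U * (real m)\<^sup>2 \<le> real n"
    "real n / (real m)\<^sup>2 < 2 * U \<longleftrightarrow> real n < 2 * U * (real m)\<^sup>2" if "0 < m" for n m :: nat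
    using that by (simp_all add: field_simps)
  have up: "n \<le> X" if "real n < 2 * U * (real m)\<^sup>2" "m \<in> I" for n m :: nat
  proof -
    have "2 * U * (real m)\<^sup>2 \<le> 2 * U * (2 * M)\<^sup>2"
      using that assms(1) unfolding I_def by (intro mult_left_mono power_mono) auto
    also have "\<dots> = 8 * U * M\<^sup>2" by (simp add: power_mult_distrib)
    finally have "real n \<le> 8 * U * M\<^sup>2" using that(1) by linarith
    then show ?thesis unfolding X_def by (simp add: le_nat_floor)
  qed
  have D: "D = {p\<in>{1..X} \<times> I. U * (real (snd p))\<^sup>2 \<le> real (fst p) \<and> real (fst p) < 2 * U * (real (snd p))\<^sup>2}"
    (is "_ = ?D")
  proof (intro equalityI subsetI)
    fix p assume "p \<in> D"
    then obtain n m where p: "p = (n, m)" "0 < n" "0 < m" "M \<le> real m" "real m < 2 * M"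
      "U * (real m)\<^sup>2 \<le> real n" "real n < 2 * U * (real m)\<^sup>2"
      unfolding D_def using cond by blast
    then have "m \<in> I" unfolding I_def by simp
    then show "p \<in> ?D" using p up by auto
  next
    fix p assume "p \<in> ?D"
    then obtain n m where p: "p = (n, m)" "1 \<le> n" "0 < m" "M \<le> real m" "real m < 2 * M"
      "U * (real m)\<^sup>2 \<le> real n" "real n < 2 * U * (real m)\<^sup>2"
      unfolding I_def by auto
    then show "p \<in> D" unfolding D_def using cond by simp
  qed
  have "exp_sum K R U (2 * U) M = (\<Sum>p\<in>D. of_nat (r2 (fst p)) * e_fun (R * h_fun K (real (fst p)) (real (snd p))))"
    unfolding exp_sum_def D_def by (simp add: case_prod_unfold)
  also have "\<dots> = (\<Sum>p\<in>{1..X} \<times> I. if U * (real (snd p))\<^sup>2 \<le> real (fst p) \<and> real (fst p) < 2 * U * (real (snd p))\<^sup>2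
      then of_nat (r2 (fst p)) * e_fun (R * h_fun K (real (fst p)) (real (snd p))) else 0)"
    unfolding D by (rule sum.inter_filter) (simp add: finI)
  also have "\<dots> = (\<Sum>p\<in>{1..X} \<times> I. of_nat (r2 (fst p)) * a (fst p) (snd p))"
    unfolding a_def by (intro sum.cong) auto
  also have "\<dots> = (\<Sum>n\<in>{1..X}. \<Sum>m\<in>I. of_nat (r2 n) * a n m)"
    by (simp add: sum.cartesian_product case_prod_unfold)
  finally show ?thesis by (simp only: sum_distrib_left)
qed

text \<open>There are at most 2 M values of m, and r_2 is at most 9 on average over n <= 8 U M^2;
  hence 144 = 2 * 9 * 8.\<close>

lemma exp_sum_trivial_bound:
  assumes U: "0 < U" and M: "0 < M"
  shows "cmod (exp_sum K R U (2 * U) M) \<le> 144 * U * M ^ 3"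
proof -
  define I where "I = {m::nat. 0 < m \<and> M \<le> real m \<and> real m < 2 * M}"
  define X where "X = nat \<lfloor>8 * U * M\<^sup>2\<rfloor>"
  define a where "a n m = (if U * (real m)\<^sup>2 \<le> real n \<and> real n < 2 * U * (real m)\<^sup>2
                then e_fun (R * h_fun K (real n) (real m)) else 0)" for n m :: nat
  have eq: "exp_sum K R U (2 * U) M = (\<Sum>n\<in>{1..X}. of_nat (r2 n) * (\<Sum>m\<in>I. a n m))"
    unfolding exp_sum_conv_truncated_sum[OF U M] I_def X_def a_def ..
  have Xle: "real X \<le> 8 * U * M\<^sup>2" unfolding X_def using U by (simp add: of_nat_nat)
  have "I \<subseteq> {1..nat \<lfloor>2 * M\<rfloor>}"
    unfolding I_def by (auto simp: le_nat_floor)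
  then have "card I \<le> nat \<lfloor>2 * M\<rfloor>" using card_mono[of "{1..nat \<lfloor>2 * M\<rfloor>}" I] by simp
  then have cI: "real (card I) \<le> 2 * M" using M by linarith
  have an: "cmod (\<Sum>m\<in>I. a n m) \<le> 2 * M" for n
  proof -
    have "cmod (\<Sum>m\<in>I. a n m) \<le> (\<Sum>m\<in>I. 1)" by (intro sum_norm_le) (simp add: a_def)
    then show ?thesis using cI by simp
  qed
  have "(\<Sum>n\<in>{1..X}. real (r2 n)) \<le> 9 * real X"
  proof (cases "X \<ge> 1")
    case True
    then show ?thesis using of_nat_mono[OF sum_r2_le[OF True], where 'a = real] by simp
  qed simp
  then have r: "(\<Sum>n\<in>{1..X}. real (r2 n)) \<le> 72 * U * M\<^sup>2" using Xle by linarith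
  have "cmod (exp_sum K R U (2 * U) M) \<le> (\<Sum>n\<in>{1..X}. real (r2 n) * (2 * M))"
    unfolding eq by (intro sum_norm_le) (use an in \<open>auto simp: norm_mult intro!: mult_left_mono\<close>)
  also have "\<dots> = (\<Sum>n\<in>{1..X}. real (r2 n)) * (2 * M)" by (rule sum_distrib_right[symmetric])
  also have "\<dots> \<le> (72 * U * M\<^sup>2) * (2 * M)" using r M by (intro mult_right_mono) auto
  also have "\<dots> = 144 * U * M ^ 3" by (simp add: power2_eq_square power3_eq_cube)
  finally show ?thesis .
qed

text \<open>The weight r_2 leaves the problem here, at the price of its mean square; 6656 = 8 *
  832.\<close>

lemma exp_sum_cauchy_bound:
  fixes U M R :: real and K :: "(real^3) set"
  assumes U: "0 < U" and M: "0 < M" and X1: "1 \<le> 8 * U * M\<^sup>2"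
  defines "I \<equiv> {m::nat. 0 < m \<and> M \<le> real m \<and> real m < 2 * M}"
    and "X \<equiv> nat \<lfloor>8 * U * M\<^sup>2\<rfloor>"
    and "a \<equiv> (\<lambda>(n::nat) (m::nat). if U * (real m)\<^sup>2 \<le> real n \<and> real n < 2 * U * (real m)\<^sup>2
                then e_fun (R * h_fun K (real n) (real m)) else 0)"
  shows "(cmod (exp_sum K R U (2 * U) M))\<^sup>2
    \<le> (6656 * U * M\<^sup>2 * (1 + ln (8 * U * M\<^sup>2))\<^sup>2) * (\<Sum>n\<in>{1..X}. (cmod (\<Sum>m\<in>I. a n m))\<^sup>2)"
proof -
  have eq: "exp_sum K R U (2 * U) M = (\<Sum>n\<in>{1..X}. of_nat (r2 n) * (\<Sum>m\<in>I. a n m))"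
    unfolding exp_sum_conv_truncated_sum[OF U M] I_def X_def a_def ..
  have Xle: "real X \<le> 8 * U * M\<^sup>2" unfolding X_def using U by (simp add: of_nat_nat)
  have X: "1 \<le> X" unfolding X_def using X1 by (simp add: le_nat_floor)
  have ln: "0 \<le> ln (real X)" "ln (real X) \<le> ln (8 * U * M\<^sup>2)" using X Xle by auto
  have "(\<Sum>n=1..X. (real (r2 n))\<^sup>2) \<le> 832 * real X * (1 + ln (real X))\<^sup>2"
    by (rule sum_r2_square_le[OF X])
  also have "\<dots> \<le> 832 * (8 * U * M\<^sup>2) * (1 + ln (8 * U * M\<^sup>2))\<^sup>2"
    using Xle ln by (intro mult_mono power_mono) auto
  finally have r: "(\<Sum>n=1..X. (real (r2 n))\<^sup>2) \<le> 6656 * U * M\<^sup>2 * (1 + ln (8 * U * M\<^sup>2))\<^sup>2" by simp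
  have "cmod (exp_sum K R U (2 * U) M) \<le> (\<Sum>n\<in>{1..X}. real (r2 n) * cmod (\<Sum>m\<in>I. a n m))"
    unfolding eq by (intro sum_norm_le) (simp add: norm_mult)
  then have "(cmod (exp_sum K R U (2 * U) M))\<^sup>2 \<le> (\<Sum>n\<in>{1..X}. real (r2 n) * cmod (\<Sum>m\<in>I. a n m))\<^sup>2"
    by (intro power_mono) auto
  also have "\<dots> \<le> (\<Sum>n\<in>{1..X}. (real (r2 n))\<^sup>2) * (\<Sum>n\<in>{1..X}. (cmod (\<Sum>m\<in>I. a n m))\<^sup>2)"
    by (rule Cauchy_Schwarz_ineq_sum)
  also have "\<dots> \<le> (6656 * U * M\<^sup>2 * (1 + ln (8 * U * M\<^sup>2))\<^sup>2) * (\<Sum>n\<in>{1..X}. (cmod (\<Sum>m\<in>I. a n m))\<^sup>2)"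
    using r by (intro mult_right_mono sum_nonneg) auto
  finally show ?thesis .
qed

text \<open>\<open>E\<close> bounds all off-diagonal correlations at once: the shift m2 - m1 is at
  least 1 and less than L, so L is inserted in sqrt \<delta> and 1 in 1 / sqrt \<delta>. The factor
  12 M^2 bounds (P + L) P, with P <= 3 M and L <= M.\<close>

lemma mean_square_bound:
  fixes U M R :: real and K :: "(real^3) set"
  assumes h: "phase_condition (h_fun K) u0 \<sigma> c1 c2" and u0: "0 < u0" and c: "0 < c1" "c1 \<le> c2"
    and sg: "\<sigma> = 1 \<or> \<sigma> = -1" and U: "u0 \<le> U" and M: "1 \<le> M" and R: "0 < R"
    and L: "1 \<le> L" "real L \<le> M"
  defines "I \<equiv> {m::nat. 0 < m \<and> M \<le> real m \<and> real m < 2 * M}"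
    and "X \<equiv> nat \<lfloor>8 * U * M\<^sup>2\<rfloor>"
    and "a \<equiv> (\<lambda>(n::nat) (m::nat). if U * (real m)\<^sup>2 \<le> real n \<and> real n < 2 * U * (real m)\<^sup>2
                then e_fun (R * h_fun K (real n) (real m)) else 0)"
    and "E \<equiv> 20 * (c2 / c1 * (8 * U * M\<^sup>2) * sqrt (c1 * R * real L / (U\<^sup>2 * sqrt U * M ^ 4))
              + sqrt (U\<^sup>2 * sqrt U * M ^ 4 / (c1 * R)))"
  shows "(\<Sum>n\<in>{1..X}. (cmod (\<Sum>m\<in>I. a n m))\<^sup>2) \<le> 12 * M\<^sup>2 * (8 * U * M\<^sup>2 / real L + 2 * E)"
proof -
  have U0: "0 < U" using u0 U by simp
  define D where "D = U\<^sup>2 * sqrt U * M ^ 4"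
  have D: "0 < D" unfolding D_def using U0 M by simp
  define P where "P = nat \<lceil>2 * M\<rceil>"
  have P: "real P \<le> 3 * M" unfolding P_def using M by linarith
  have IP: "I \<subseteq> {..<P}"
  proof
    fix m assume "m \<in> I"
    then have "real m < 2 * M" unfolding I_def by simp
    then have "real m < real P" unfolding P_def by linarith
    then show "m \<in> {..<P}" by simp
  qed
  have Xle: "real X \<le> 8 * U * M\<^sup>2" unfolding X_def using U0 by (simp add: of_nat_nat)
  have E0: "0 \<le> E" unfolding E_def using c U0 R M
    by (intro mult_nonneg_nonneg add_nonneg_nonneg real_sqrt_ge_zero divide_nonneg_nonneg) auto
  have up: "n \<in> {1..X}" if "U * (real m1)\<^sup>2 \<le> real n" "real n < 2 * U * (real m)\<^sup>2" "m1 \<in> I" "m \<in> I" for n m m1 :: nat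
  proof -
    have "2 * U * (real m)\<^sup>2 \<le> 2 * U * (2 * M)\<^sup>2"
      using that U0 unfolding I_def by (intro mult_left_mono power_mono) auto
    also have "\<dots> = 8 * U * M\<^sup>2" by (simp add: power_mult_distrib)
    finally have "real n \<le> 8 * U * M\<^sup>2" using that(2) by linarith
    moreover have "0 < U * (real m1)\<^sup>2" using U0 that unfolding I_def by simp
    then have "1 \<le> n" using that(1) by (cases n) auto
    ultimately show ?thesis unfolding X_def by (simp add: le_nat_floor)
  qed
  have "(\<Sum>n\<in>{1..X}. (cmod (\<Sum>m\<in>I. a n m))\<^sup>2) \<le> real (P + L) * real P * (8 * U * M\<^sup>2 / real L + 2 * E)"
  proof (rule weyl_differencing_bound[OF _ IP L(1)])
    fix m
    have "cmod (\<Sum>n\<in>{1..X}. a n m * cnj (a n m)) \<le> (\<Sum>n\<in>{1..X}. 1)"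
      by (intro sum_norm_le) (simp add: a_def norm_mult)
    then show "cmod (\<Sum>n\<in>{1..X}. a n m * cnj (a n m)) \<le> 8 * U * M\<^sup>2" using Xle by simp
  next
    fix m1 m2 assume m: "m1 \<in> I" "m2 \<in> I" "m1 < m2" "m2 < m1 + L"
    define NN where "NN = {n. U * (real m2)\<^sup>2 \<le> real n \<and> real n < 2 * U * (real m1)\<^sup>2}"
    have sqle: "U * (real m1)\<^sup>2 \<le> U * (real m2)\<^sup>2"
      using m U0 by (intro mult_left_mono power_mono) auto
    have sub: "NN \<subseteq> {1..X}" using up[of m2 _ m1] m unfolding NN_def by blast
    have "(\<Sum>n\<in>{1..X}. a n m1 * cnj (a n m2)) = (\<Sum>n\<in>NN. a n m1 * cnj (a n m2))"
      using sqle by (intro sum.mono_neutral_right sub) (auto simp: NN_def a_def)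
    also have "\<dots> = (\<Sum>n\<in>NN. e_fun (R * h_fun K (real n) (real m1)) * cnj (e_fun (R * h_fun K (real n) (real m2))))"
      using sqle by (intro sum.cong) (auto simp: NN_def a_def)
    finally have eq: "(\<Sum>n\<in>{1..X}. a n m1 * cnj (a n m2)) = \<dots>" .
    define \<delta> where "\<delta> = c1 * R * real (m2 - m1) / D"
    have "cmod (\<Sum>n\<in>{1..X}. a n m1 * cnj (a n m2)) \<le> 20 * (c2 / c1 * (8 * U * M\<^sup>2) * sqrt \<delta> + 1 / sqrt \<delta>)"
      unfolding eq \<delta>_def D_def
      by (rule correlation_bound[OF h u0 c sg U _ R]) (use m M in \<open>auto simp: I_def NN_def\<close>)
    also have "\<dots> \<le> E"
    proof -
      have "\<delta> \<le> c1 * R * real L / D"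
        unfolding \<delta>_def using c R D m by (intro divide_right_mono mult_left_mono) auto
      then have 1: "sqrt \<delta> \<le> sqrt (c1 * R * real L / D)" by simp
      have "c1 * R * 1 / D \<le> \<delta>"
        unfolding \<delta>_def using c R D m by (intro divide_right_mono mult_left_mono) auto
      then have "1 / sqrt \<delta> \<le> 1 / sqrt (c1 * R / D)"
        using c R D by (intro divide_left_mono) (auto intro!: mult_pos_pos order_less_le_trans[of 0 "c1 * R / D" \<delta>])
      also have "\<dots> = sqrt (D / (c1 * R))" by (simp add: real_sqrt_divide)
      finally have 2: "1 / sqrt \<delta> \<le> sqrt (D / (c1 * R))" .
      show ?thesis unfolding E_def D_def[symmetric]
        using 1 2 c U0 by (intro mult_left_mono add_mono) auto
    qed
    finally show "cmod (\<Sum>n\<in>{1..X}. a n m1 * cnj (a n m2)) \<le> E" .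
  qed (use E0 U0 in auto)
  also have "\<dots> \<le> (4 * M) * (3 * M) * (8 * U * M\<^sup>2 / real L + 2 * E)"
    using P L M E0 U0 by (intro mult_right_mono mult_mono) auto
  also have "\<dots> = 12 * M\<^sup>2 * (8 * U * M\<^sup>2 / real L + 2 * E)" by (simp add: power2_eq_square)
  finally show ?thesis .
qed


text \<open>With x = R^(1/8) all exponents are integers: x^6 = R^(3/4) is the target, and x^3, x^5,
  x^10 are the limits R^(3/8), R^(5/8), R^(5/4). The estimates \<open>t1\<close>, \<open>t2\<close>,
  \<open>t3\<close> treat the diagonal and the two terms of the second difference test; 192 = 12 *
  16 and 480 = 12 * 2 * 20.\<close>

lemma mean_square_optimized:
  fixes U M x :: real and K :: "(real^3) set"
  assumes h: "phase_condition (h_fun K) u0 \<sigma> c1 c2" and u0: "0 < u0" and c: "0 < c1" "c1 \<le> c2"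
    and sg: "\<sigma> = 1 \<or> \<sigma> = -1" and U: "u0 \<le> U" and x: "1 < x"
    and M: "x ^ 3 \<le> M" "M \<le> x ^ 5" and UM: "U * M\<^sup>2 \<le> x ^ 10"
  defines "I \<equiv> {m::nat. 0 < m \<and> M \<le> real m \<and> real m < 2 * M}"
    and "X \<equiv> nat \<lfloor>8 * U * M\<^sup>2\<rfloor>"
    and "a \<equiv> (\<lambda>(n::nat) (m::nat). if U * (real m)\<^sup>2 \<le> real n \<and> real n < 2 * U * (real m)\<^sup>2
                then e_fun (x ^ 8 * h_fun K (real n) (real m)) else 0)"
    and "C \<equiv> 192 + 480 * (c2 / c1 * (8 * sqrt c1 / (sqrt (sqrt u0)) ^ 5) + 1 / sqrt c1)"
  shows "(\<Sum>n\<in>{1..X}. (cmod (\<Sum>m\<in>I. a n m))\<^sup>2) \<le> C * (U * M\<^sup>2 * x ^ 6)"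
proof -
  \<comment> \<open>The fourth root of U turns U^2 sqrt U M^4 into the perfect square (v^5 M^2)^2,
    so that the square roots in \<open>E\<close> can be evaluated.\<close>
  define v where "v = sqrt (sqrt U)"
  define v0 where "v0 = sqrt (sqrt u0)"
  define g where "g = sqrt c1"
  have U0: "0 < U" using u0 U by simp
  have g: "0 < g" "c1 = g\<^sup>2" unfolding g_def using c by auto
  have v0: "0 < v0" "v0 \<le> v" unfolding v0_def v_def using u0 U by auto
  have v: "0 < v" using v0 by simp
  have sU: "sqrt U = v\<^sup>2" unfolding v_def using U0 by simp
  have vU: "U = v ^ 4"
  proof -
    have "v ^ 4 = (v\<^sup>2)\<^sup>2" by simp
    also have "\<dots> = U" unfolding sU[symmetric] using U0 by simp
    finally show ?thesis by simp
  qed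
  have x36: "1 \<le> x ^ 3" "x ^ 5 \<le> x ^ 6" using x by (auto intro: power_increasing)
  then have M1: "1 \<le> M" using M by simp
  \<comment> \<open>The ideal shift length. The assumption M >= x^3 gives y >= 1, and M <= x^5 <=
    x^6 gives y <= M; rounding down loses at most a factor 2.\<close>
  define y where "y = M\<^sup>2 / x ^ 6"
  have "(x ^ 3)\<^sup>2 \<le> M\<^sup>2" using M x by (intro power_mono) auto
  then have y1: "1 \<le> y" unfolding y_def using x by (simp add: power_mult[symmetric])
  define L where "L = nat \<lfloor>y\<rfloor>"
  have L1: "1 \<le> L" unfolding L_def using y1 by (simp add: le_nat_floor)
  have Ly: "real L \<le> y" "y \<le> 2 * real L" 
  proof -
    have "1 \<le> \<lfloor>y\<rfloor>" using y1 by simp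
    then have "real L = of_int \<lfloor>y\<rfloor>" "1 \<le> real L" unfolding L_def by simp_all
    then show "real L \<le> y" "y \<le> 2 * real L" by linarith+
  qed
  have "M * M \<le> M * x ^ 6" using M M1 x36 by (intro mult_left_mono) auto
  then have "y \<le> M" unfolding y_def using x by (simp add: field_simps power2_eq_square)
  then have LM: "real L \<le> M" using Ly by simp
  define D where "D = U\<^sup>2 * sqrt U * M ^ 4"
  have D: "D = (v ^ 5 * M\<^sup>2)\<^sup>2" unfolding D_def sU unfolding vU by (simp add: power_mult_distrib power_mult[symmetric] power_add[symmetric])
  have D0: "0 < v ^ 5 * M\<^sup>2" using v M1 by simp
  define E where "E = 20 * (c2 / c1 * (8 * U * M\<^sup>2) * sqrt (c1 * x ^ 8 * real L / D) + sqrt (D / (c1 * x ^ 8)))"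
  have main: "(\<Sum>n\<in>{1..X}. (cmod (\<Sum>m\<in>I. a n m))\<^sup>2) \<le> 12 * M\<^sup>2 * (8 * U * M\<^sup>2 / real L + 2 * E)"
    unfolding I_def X_def a_def E_def D_def
    by (rule mean_square_bound[OF h u0 c sg U M1 _ L1 LM]) (use x in simp)
  have s1: "sqrt (c1 * x ^ 8 * real L / D) \<le> g * x / (v ^ 5 * M)"
  proof -
    have "c1 * x ^ 8 * real L / D \<le> c1 * x ^ 8 * y / D"
      unfolding D using Ly c x by (intro divide_right_mono mult_left_mono) auto
    also have "\<dots> = (g * x / (v ^ 5 * M))\<^sup>2"
      unfolding D g y_def using v M1 x by (simp add: field_simps power_mult_distrib flip: power_add)
    finally have "sqrt (c1 * x ^ 8 * real L / D) \<le> sqrt ((g * x / (v ^ 5 * M))\<^sup>2)"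
      by (rule real_sqrt_le_mono)
    also have "\<dots> = g * x / (v ^ 5 * M)" using g v M1 x by simp
    finally show ?thesis .
  qed
  have s2: "sqrt (D / (c1 * x ^ 8)) = v ^ 5 * M\<^sup>2 / (g * x ^ 4)"
  proof -
    have "D / (c1 * x ^ 8) = (v ^ 5 * M\<^sup>2 / (g * x ^ 4))\<^sup>2"
      unfolding D g by (simp add: power_divide power_mult_distrib flip: power_mult)
    then show ?thesis using g D0 x by simp
  qed
  have t1: "M\<^sup>2 * (8 * U * M\<^sup>2 / real L) \<le> 16 * (U * M\<^sup>2 * x ^ 6)"
  proof -
    have "M\<^sup>2 \<le> 2 * real L * x ^ 6" using Ly(2) x unfolding y_def by (simp add: field_simps)
    then have "M\<^sup>2 / real L \<le> 2 * x ^ 6" using L1 by (simp add: field_simps)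
    then have "8 * (U * M\<^sup>2) * (M\<^sup>2 / real L) \<le> 8 * (U * M\<^sup>2) * (2 * x ^ 6)"
      using U0 by (intro mult_left_mono) auto
    then show ?thesis by (simp add: mult_ac)
  qed
  have t2: "M\<^sup>2 * ((8 * U * M\<^sup>2) * sqrt (c1 * x ^ 8 * real L / D)) \<le> (8 * g / v0 ^ 5) * (U * M\<^sup>2 * x ^ 6)"
  proof -
    have "M\<^sup>2 * ((8 * U * M\<^sup>2) * sqrt (c1 * x ^ 8 * real L / D)) \<le> M\<^sup>2 * ((8 * U * M\<^sup>2) * (g * x / (v ^ 5 * M)))"
      using s1 U0 by (intro mult_left_mono) auto
    also have "\<dots> = (8 * g * U * M\<^sup>2) * ((1 / v ^ 5) * (M * x))"
      using M1 by (simp add: field_simps power2_eq_square)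
    also have "\<dots> \<le> (8 * g * U * M\<^sup>2) * ((1 / v0 ^ 5) * x ^ 6)"
    proof (intro mult_left_mono mult_mono)
      show "1 / v ^ 5 \<le> 1 / v0 ^ 5" using v0 v by (intro divide_left_mono power_mono) auto
      have "M * x \<le> x ^ 5 * x" using M x by (intro mult_right_mono) auto
      then show "M * x \<le> x ^ 6" by (simp add: power_Suc2[symmetric] numeral_eq_Suc)
    qed (use v0 M1 x g U0 in auto)
    also have "\<dots> = (8 * g / v0 ^ 5) * (U * M\<^sup>2 * x ^ 6)" by simp
    finally show ?thesis .
  qed
  have t3: "M\<^sup>2 * sqrt (D / (c1 * x ^ 8)) \<le> (1 / g) * (U * M\<^sup>2 * x ^ 6)"
  proof -
    \<comment> \<open>The inequality v M^2 <= x^10 is checked in fourth powers, where it splits into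
      U M^2 <= x^10 and M^6 <= x^30.\<close>
    have "(v * M\<^sup>2) ^ 4 = (U * M\<^sup>2) * M ^ 6" unfolding vU by (simp add: power_mult_distrib flip: power_mult power_add)
    also have "\<dots> \<le> x ^ 10 * (x ^ 5) ^ 6" using UM M M1 x by (intro mult_mono power_mono) auto
    also have "\<dots> = (x ^ 10) ^ 4" by (simp flip: power_mult power_add)
    finally have le: "v * M\<^sup>2 \<le> x ^ 10"
      using power_le_imp_le_base[of "v * M\<^sup>2" 3 "x ^ 10"] x by (simp add: numeral_eq_Suc)
    have "M\<^sup>2 * sqrt (D / (c1 * x ^ 8)) = (1 / g) * (U * M\<^sup>2) * ((v * M\<^sup>2) / x ^ 4)"
      unfolding s2 vU using g x by (simp add: field_simps flip: power_Suc)
    also have "\<dots> \<le> (1 / g) * (U * M\<^sup>2) * (x ^ 10 / x ^ 4)"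
      using le g U0 x by (intro mult_left_mono divide_right_mono) auto
    also have "x ^ 10 / x ^ 4 = x ^ 6" using x by (simp add: field_simps flip: power_add)
    finally show ?thesis by simp
  qed
  have "12 * M\<^sup>2 * (8 * U * M\<^sup>2 / real L + 2 * E)
      = 12 * (M\<^sup>2 * (8 * U * M\<^sup>2 / real L))
        + 480 * (c2 / c1 * (M\<^sup>2 * ((8 * U * M\<^sup>2) * sqrt (c1 * x ^ 8 * real L / D))) + M\<^sup>2 * sqrt (D / (c1 * x ^ 8)))"
    unfolding E_def by (simp add: algebra_simps)
  also have "\<dots> \<le> 12 * (16 * (U * M\<^sup>2 * x ^ 6))
        + 480 * (c2 / c1 * ((8 * g / v0 ^ 5) * (U * M\<^sup>2 * x ^ 6)) + (1 / g) * (U * M\<^sup>2 * x ^ 6))"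
    using t1 t2 t3 c by (intro add_mono mult_left_mono) auto
  also have "\<dots> = C * (U * M\<^sup>2 * x ^ 6)" unfolding C_def v0_def[symmetric] g_def[symmetric] by (simp add: algebra_simps)
  finally show ?thesis using main by simp
qed

text \<open>After taking square roots only a logarithm exceeds the claim, and R^\<epsilon> absorbs
  it. All constants depend on u0, c1, c2 and \<epsilon> alone, which gives uniformity in R, M,
  U.\<close>

theorem exp_sum_bound_of_phase_condition:
  fixes K :: "(real^3) set"
  assumes h: "phase_condition (h_fun K) u0 \<sigma> c1 c2" and u0: "0 < u0" and c: "0 < c1" "c1 \<le> c2"
    and sg: "\<sigma> = 1 \<or> \<sigma> = -1" and eps: "0 < \<epsilon>"
  shows "\<exists>C>0. \<forall>R M U. R > 1 \<longrightarrow> M > 0 \<longrightarrow> 2 * M \<le> R powr (5/8) \<longrightarrow>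
           u0 \<le> U \<longrightarrow> U \<le> R powr (5/4) / M\<^sup>2 \<longrightarrow>
           cmod (exp_sum K R U (2 * U) M) \<le> C * (U * M\<^sup>2 * R powr (3/8 + \<epsilon>))"
proof -
  define C1 where "C1 = 192 + 480 * (c2 / c1 * (8 * sqrt c1 / (sqrt (sqrt u0)) ^ 5) + 1 / sqrt c1)"
  \<comment> \<open>Chosen such that 1 + ln (8 x^10) <= B x^(8 \<epsilon>), by ln 8 <= 7 and ln x <=
    x^(8 \<epsilon>) / (8 \<epsilon>).\<close>
  define B where "B = 8 + 10 / (8 * \<epsilon>)"
  define C where "C = 144 + sqrt (6656 * C1) * B"
  have C1: "0 < C1" unfolding C1_def using c u0 by (intro add_pos_nonneg mult_nonneg_nonneg) auto
  have B: "0 < B" unfolding B_def using eps by (simp add: add_pos_pos)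
  have C: "144 \<le> C" "sqrt (6656 * C1) * B \<le> C" unfolding C_def using C1 B by auto
  have "cmod (exp_sum K R U (2 * U) M) \<le> C * (U * M\<^sup>2 * R powr (3/8 + \<epsilon>))"
    if R: "R > 1" and M: "M > 0" "2 * M \<le> R powr (5/8)" and U: "u0 \<le> U" "U \<le> R powr (5/4) / M\<^sup>2" for R M U
  proof -
    define x where "x = R powr (1/8)"
    have x: "1 < x" unfolding x_def using R by simp
    have xk: "x ^ k = R powr (real k / 8)" for k
    proof -
      have "x ^ k = x powr real k" using x by (simp add: powr_realpow)
      then show ?thesis unfolding x_def by (simp add: powr_powr)
    qed
    have Rx: "R = x ^ 8" unfolding xk using R by simp
    define Y where "Y = x powr (8 * \<epsilon>)"
    have Y1: "1 \<le> Y" unfolding Y_def using x eps by (intro ge_one_powr_ge_zero) auto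
    have RY: "R powr (3/8 + \<epsilon>) = x ^ 3 * Y"
    proof -
      have "Y = R powr \<epsilon>" unfolding Y_def x_def by (simp add: powr_powr)
      then show ?thesis using xk[of 3] by (simp add: powr_add)
    qed
    have M5: "M \<le> x ^ 5" unfolding xk using M by simp
    have U0: "0 < U" using U u0 by simp
    have UM: "U * M\<^sup>2 \<le> x ^ 10" unfolding xk using U(2) M(1) by (simp add: field_simps)
    have pos: "0 \<le> U * M\<^sup>2 * (x ^ 3 * Y)" using U0 x Y1 by simp
    show ?thesis
    proof (cases "M \<le> x ^ 3")
      case True
      have "cmod (exp_sum K R U (2 * U) M) \<le> 144 * U * M ^ 3" by (rule exp_sum_trivial_bound[OF U0 M(1)])
      also have "\<dots> = 144 * (U * M\<^sup>2 * (M * 1))" by (simp add: power2_eq_square power3_eq_cube)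
      also have "\<dots> \<le> 144 * (U * M\<^sup>2 * (x ^ 3 * Y))"
        using True Y1 M U0 x by (intro mult_left_mono mult_mono) auto
      also have "\<dots> \<le> C * (U * M\<^sup>2 * (x ^ 3 * Y))" using C pos by (intro mult_right_mono) auto
      finally show ?thesis unfolding RY .
    next
      case False
      then have M3: "x ^ 3 \<le> M" by simp
      show ?thesis
      proof (cases "1 \<le> 8 * U * M\<^sup>2")
        \<comment> \<open>No positive integer n satisfies n < 2 U m^2 < 8 U M^2 < 1, so the sum is
          empty.\<close>
        case False
        then have "nat \<lfloor>8 * U * M\<^sup>2\<rfloor> = 0" by linarith
        then have "exp_sum K R U (2 * U) M = 0" using exp_sum_conv_truncated_sum[OF U0 M(1), of K R] by simp
        then show ?thesis unfolding RY using pos C by simp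
      next
        case True
        define l where "l = 1 + ln (8 * U * M\<^sup>2)"
        have l0: "0 \<le> l" unfolding l_def using True by (simp add: ln_ge_zero)
        have "(cmod (exp_sum K R U (2 * U) M))\<^sup>2 \<le> (6656 * U * M\<^sup>2 * l\<^sup>2) * (C1 * (U * M\<^sup>2 * x ^ 6))"
          unfolding l_def C1_def Rx
          by (rule order_trans[OF exp_sum_cauchy_bound[OF U0 M(1) True]
                mult_left_mono[OF mean_square_optimized[OF h u0 c sg U(1) x M3 M5 UM]]])
             (use U0 in simp)
        also have "\<dots> = (sqrt (6656 * C1) * (U * M\<^sup>2 * x ^ 3 * l))\<^sup>2"
          using C1 by (simp add: power_mult_distrib power2_eq_square[of U] power2_eq_square[of "M\<^sup>2"] flip: power_mult)
        finally have "cmod (exp_sum K R U (2 * U) M) \<le> sqrt (6656 * C1) * (U * M\<^sup>2 * x ^ 3 * l)"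
          by (rule power2_le_imp_le) (use C1 U0 x l0 in auto)
        also have "\<dots> \<le> sqrt (6656 * C1) * (U * M\<^sup>2 * x ^ 3 * (B * Y))"
        proof -
          have "ln (8 * U * M\<^sup>2) \<le> ln (8 * x ^ 10)" using True UM U0 M by (subst ln_le_cancel_iff) auto
          also have "\<dots> = ln 8 + 10 * ln x" using x by (simp add: ln_mult ln_realpow)
          also have "\<dots> \<le> 7 + 10 * (Y / (8 * \<epsilon>))"
            unfolding Y_def using ln_le_minus_one[of "8::real"] ln_powr_bound[of x "8 * \<epsilon>"] x eps
            by (intro add_mono mult_left_mono) auto
          finally have "l \<le> 8 * 1 + 10 / (8 * \<epsilon>) * Y" unfolding l_def by simp
          also have "\<dots> \<le> 8 * Y + 10 / (8 * \<epsilon>) * Y" using Y1 by simp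
          also have "\<dots> = B * Y" unfolding B_def by (simp add: distrib_right)
          finally have "l \<le> B * Y" .
          then show ?thesis using C1 U0 x by (intro mult_left_mono) auto
        qed
        also have "\<dots> = (sqrt (6656 * C1) * B) * (U * M\<^sup>2 * (x ^ 3 * Y))" by simp
        also have "\<dots> \<le> C * (U * M\<^sup>2 * (x ^ 3 * Y))" using C pos by (intro mult_right_mono) auto
        finally show ?thesis unfolding RY .
      qed
    qed
  qed
  moreover have "0 < C" using C by simp
  ultimately show ?thesis by blast
qed

section \<open>The phase function\<close>

text \<open>The mean value theorem for g (t + 1) - g t, then for g1; this keeps a single
  intermediate point.\<close>

lemma second_difference_eq_second_derivative:
  fixes g g1 g2 :: "real \<Rightarrow> real"
  assumes g: "\<And>x. n \<le> x \<Longrightarrow> x \<le> n + 2 \<Longrightarrow> (g has_real_derivative g1 x) (at x)"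
    and g1: "\<And>x. n \<le> x \<Longrightarrow> x \<le> n + 2 \<Longrightarrow> (g1 has_real_derivative g2 x) (at x)"
  shows "\<exists>\<xi>. n < \<xi> \<and> \<xi> < n + 2 \<and> g (n + 2) - 2 * g (n + 1) + g n = g2 \<xi>"
proof -
  define \<phi> where "\<phi> t = g (t + 1) - g t" for t
  have shift: "((\<lambda>t. g (t + 1)) has_real_derivative g1 (t + 1)) (at t)" if "n \<le> t" "t \<le> n + 1" for t
  proof -
    have "(g has_real_derivative g1 (t + 1)) (at (t + 1))" using that by (intro g) auto
    then show ?thesis by (simp add: DERIV_shift)
  qed
  have "(\<phi> has_real_derivative (g1 (t + 1) - g1 t)) (at t)" if "n \<le> t" "t \<le> n + 1" for t
    unfolding \<phi>_def using that by (intro DERIV_diff shift g) auto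
  then obtain t where t: "n < t" "t < n + 1" "\<phi> (n + 1) - \<phi> n = g1 (t + 1) - g1 t"
    using MVT2[of n "n + 1" \<phi> "\<lambda>t. g1 (t + 1) - g1 t"] by auto
  have "(g1 has_real_derivative g2 x) (at x)" if "t \<le> x" "x \<le> t + 1" for x
    using that t by (intro g1) auto
  then obtain \<xi> where x: "t < \<xi>" "\<xi> < t + 1" "g1 (t + 1) - g1 t = g2 \<xi>"
    using MVT2[of t "t + 1" g1 g2] by auto
  have "g (n + 2) - 2 * g (n + 1) + g n = \<phi> (n + 1) - \<phi> n"
    unfolding \<phi>_def by (simp add: add.assoc)
  then show ?thesis using t x by (intro exI[of _ \<xi>]) auto
qed

text \<open>
  The Legendre transform \<open>G(s) = sup (f(r) + r s)\<close> has derivative \<open>\<rho> = (-f')\<inverse>\<close> and third derivative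
  \<open>-f'''/f''\<^sup>3\<close> at \<open>\<rho>(s)\<close>; since \<open>s = -f'\<close> there, the hypothesis on \<open>f''' f'\<^sup>4 / f''\<^sup>3\<close> says that
  \<open>G'''\<close> has constant sign and order \<open>s\<^sup>-\<^sup>4\<close>.
\<close>

lemma phase_condition_of_profile:
  fixes f f1 f2 f3 :: "real \<Rightarrow> real" and h :: "real \<Rightarrow> real \<Rightarrow> real"
  assumes ab: "a < r0" "r0 < b"
    and f: "\<And>x. a < x \<Longrightarrow> x < b \<Longrightarrow> (f has_real_derivative f1 x) (at x)"
    and f1: "\<And>x. a < x \<Longrightarrow> x < b \<Longrightarrow> (f1 has_real_derivative f2 x) (at x)"
    and f2: "\<And>x. a < x \<Longrightarrow> x < b \<Longrightarrow> (f2 has_real_derivative f3 x) (at x)"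
    and neg1: "\<And>x. a < x \<Longrightarrow> x < b \<Longrightarrow> f1 x < 0"
    and neg2: "\<And>x. a < x \<Longrightarrow> x < b \<Longrightarrow> f2 x < 0"
    and unbdd: "\<And>s. \<exists>r. a < r \<and> r < b \<and> s < - f1 r"
    and q: "0 < q1" "\<And>x. r0 \<le> x \<Longrightarrow> x < b \<Longrightarrow>
      q1 \<le> \<sigma> * (- (f3 x * f1 x ^ 4 / f2 x ^ 3)) \<and> \<sigma> * (- (f3 x * f1 x ^ 4 / f2 x ^ 3)) \<le> q2"
    and h: "\<And>x m r. 0 < x \<Longrightarrow> 0 < m \<Longrightarrow> a < r \<Longrightarrow> r < b \<Longrightarrow> - f1 r = sqrt x / m \<Longrightarrow>
      h x m = m * f r + sqrt x * r"
  shows "phase_condition h ((f1 r0)\<^sup>2) \<sigma> (q1 / 384) (q2 / 4)"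
proof -
  define F where "F r = - f1 r" for r
  have F: "(F has_real_derivative - f2 r) (at r)" if "a < r" "r < b" for r
    unfolding F_def using f1[OF that] by (rule DERIV_minus)
  have Fc: "isCont F r" if "a < r" "r < b" for r using F[OF that] by (rule DERIV_isCont)
  have Fmono: "F r < F r'" if "a < r" "r < r'" "r' < b" for r r'
  proof (rule DERIV_pos_imp_increasing[OF that(2)])
    fix x assume "r \<le> x" "x \<le> r'"
    then have "(F has_real_derivative - f2 x) (at x)" "0 < - f2 x" using F neg2 that by auto
    then show "\<exists>y. (F has_real_derivative y) (at x) \<and> 0 < y" by blast
  qed
  have Finj: "r = r'" if "a < r" "r < b" "a < r'" "r' < b" "F r = F r'" for r r'
    using Fmono[of r r'] Fmono[of r' r] that by (metis less_irrefl linorder_neqE_linordered_idom)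
  have Fivt: "\<exists>r. r1 \<le> r \<and> r \<le> r2 \<and> F r = y" if "a < r1" "r1 \<le> r2" "r2 < b" "F r1 \<le> y" "y \<le> F r2" for r1 r2 y
  proof (rule IVT'[OF that(4,5,2)])
    show "continuous_on {r1..r2} F" using that Fc by (intro continuous_at_imp_continuous_on ballI) auto
  qed
  define J where "J = F ` {a<..<b}"
  define \<rho> where "\<rho> s = (THE r. a < r \<and> r < b \<and> F r = s)" for s
  have rhoF: "\<rho> (F r) = r" if "a < r" "r < b" for r
    unfolding \<rho>_def using that Finj by (intro the_equality) auto
  have rho: "a < \<rho> s \<and> \<rho> s < b \<and> F (\<rho> s) = s" if "s \<in> J" for s
    using that rhoF unfolding J_def by auto
  have Jpos: "0 < s" if "s \<in> J" for s
    using that neg1 unfolding J_def F_def by auto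
  \<comment> \<open>From r0 on, the slope F runs continuously from F r0 through all larger values,
    so J contains a half-line. This allows arbitrarily large U.\<close>
  have Jup: "s \<in> J" if s: "F r0 \<le> s" for s
  proof -
    obtain r where r: "a < r" "r < b" "s < F r" using unbdd[of s] unfolding F_def by auto
    have "r0 \<le> r" using Fmono[of r r0] r that ab by force
    then obtain r' where "r0 \<le> r'" "r' \<le> r" "F r' = s" using Fivt[of r0 r s] r ab s by auto
    then show ?thesis unfolding J_def using ab r by (intro image_eqI[of _ _ r']) auto
  qed
  have Jnbhd: "\<exists>r1 r2. a < r1 \<and> r1 < \<rho> s \<and> \<rho> s < r2 \<and> r2 < b \<and> F r1 < s \<and> s < F r2 \<and> {F r1<..<F r2} \<subseteq> J"
    if s: "s \<in> J" for s
  proof -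
    obtain r1 where r1: "a < r1" "r1 < \<rho> s" using dense[of a "\<rho> s"] rho[OF s] by blast
    obtain r2 where r2: "\<rho> s < r2" "r2 < b" using dense[of "\<rho> s" b] rho[OF s] by blast
    note r = r1 r2
    have "F r1 < s" "s < F r2" using Fmono[of r1 "\<rho> s"] Fmono[of "\<rho> s" r2] r rho[OF s] by auto
    moreover have "{F r1<..<F r2} \<subseteq> J"
    proof
      fix y assume "y \<in> {F r1<..<F r2}"
      then obtain r' where "r1 \<le> r'" "r' \<le> r2" "F r' = y" using Fivt[of r1 r2 y] r by auto
      then show "y \<in> J" unfolding J_def using r by (intro image_eqI[of _ _ r']) auto
    qed
    ultimately show ?thesis using r by blast
  qed
  have openJ: "open J"
  proof (subst open_subopen, intro ballI)
    fix s assume "s \<in> J"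
    then obtain r1 r2 where "F r1 < s" "s < F r2" "{F r1<..<F r2} \<subseteq> J" using Jnbhd by blast
    then show "\<exists>T. open T \<and> s \<in> T \<and> T \<subseteq> J" by (intro exI[of _ "{F r1<..<F r2}"]) auto
  qed
  define \<rho>1 where "\<rho>1 s = - inverse (f2 (\<rho> s))" for s
  define \<rho>2 where "\<rho>2 s = - (f3 (\<rho> s) / f2 (\<rho> s) ^ 3)" for s
  have d1: "(\<rho> has_real_derivative \<rho>1 s) (at s)" if s: "s \<in> J" for s
  proof -
    obtain r1 r2 where r: "a < r1" "r1 < \<rho> s" "\<rho> s < r2" "r2 < b" "F r1 < s" "s < F r2" "{F r1<..<F r2} \<subseteq> J"
      using Jnbhd[OF s] by blast
    have "isCont \<rho> (F (\<rho> s))"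
      by (rule isCont_inverse_function2[of r1 "\<rho> s" r2]) (use r rhoF Fc in auto)
    then have "isCont \<rho> s" using rho[OF s] by simp
    then have "(\<rho> has_real_derivative inverse (- f2 (\<rho> s))) (at s)"
      using r rho[OF s] neg2[of "\<rho> s"] F[of "\<rho> s"] rho
      by (intro DERIV_inverse_function[where f = F and a = "F r1" and b = "F r2"]) auto
    then show ?thesis unfolding \<rho>1_def by simp
  qed
  have d2: "(\<rho>1 has_real_derivative \<rho>2 s) (at s)" if s: "s \<in> J" for s
  proof -
    have r: "a < \<rho> s" "\<rho> s < b" using rho[OF s] by auto
    have n: "f2 (\<rho> s) \<noteq> 0" using neg2[OF r] by simp
    have "((\<lambda>s. f2 (\<rho> s)) has_real_derivative f3 (\<rho> s) * \<rho>1 s) (at s)"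
      by (rule DERIV_chain2[OF f2[OF r] d1[OF s]])
    from DERIV_minus[OF DERIV_inverse'[OF this n]]
    have "((\<lambda>s. - inverse (f2 (\<rho> s))) has_real_derivative
      - (- (inverse (f2 (\<rho> s)) * (f3 (\<rho> s) * \<rho>1 s) * inverse (f2 (\<rho> s))))) (at s)" .
    moreover have "- (- (inverse (f2 (\<rho> s)) * (f3 (\<rho> s) * \<rho>1 s) * inverse (f2 (\<rho> s)))) = \<rho>2 s"
      unfolding \<rho>1_def \<rho>2_def by (simp add: field_simps power3_eq_cube)
    ultimately show ?thesis unfolding \<rho>1_def by simp
  qed
  \<comment> \<open>For h(x, m) = m G(sqrt x / m) with G' = \<rho>, the second derivative in x is
    \<psi>(sqrt x / m) / (4 x^(3/2)). The factor outside \<psi> does not depend on m, so two values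
    of m leave a difference of values of \<psi>; in \<psi>' = s \<rho>'' the first derivatives of
    \<rho> have cancelled. This is how the third derivative of G enters.\<close>
  define \<psi> where "\<psi> s = s * \<rho>1 s - \<rho> s" for s
  have dpsi: "(\<psi> has_real_derivative s * \<rho>2 s) (at s)" if s: "s \<in> J" for s
    unfolding \<psi>_def by (rule derivative_eq_intros d1[OF s] d2[OF s] refl)+ simp
  define A where "A m = {x. 0 < x \<and> sqrt x / m \<in> J}" for m :: real
  have openA: "open (A m)" for m
  proof -
    have "A m = {0<..} \<inter> (\<lambda>x. sqrt x / m) -` J" unfolding A_def by auto
    moreover have "continuous_on UNIV (\<lambda>x. sqrt x / m)"
      unfolding divide_inverse by (intro continuous_intros)
    ultimately show ?thesis using openJ by (simp add: open_Int open_vimage)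
  qed
  have ds: "((\<lambda>x. sqrt x / m) has_real_derivative 1 / (2 * sqrt x * m)) (at x)" if "0 < x" "0 < m" for x m :: real
    using that by (auto intro!: derivative_eq_intros simp: field_simps)
  have hA: "h x m = m * f (\<rho> (sqrt x / m)) + sqrt x * \<rho> (sqrt x / m)" if "x \<in> A m" "0 < m" for x m
    using that rho[of "sqrt x / m"] unfolding A_def F_def by (intro h) auto
  have drx: "((\<lambda>x. \<rho> (sqrt x / m)) has_real_derivative \<rho>1 (sqrt x / m) * (1 / (2 * sqrt x * m))) (at x)"
    if "x \<in> A m" "0 < m" for x m
    using that unfolding A_def by (intro DERIV_chain2[OF d1 ds]) auto
  have dh: "((\<lambda>x. h x m) has_real_derivative \<rho> (sqrt x / m) / (2 * sqrt x)) (at x)"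
    if x: "x \<in> A m" and m: "0 < m" for x m
  proof -
    have x0: "0 < x" and sJ: "sqrt x / m \<in> J" using x unfolding A_def by auto
    define r where "r = \<rho> (sqrt x / m)"
    have r: "a < r" "r < b" "f1 r = - (sqrt x / m)" using rho[OF sJ] unfolding r_def F_def by auto
    define d where "d = \<rho>1 (sqrt x / m) * (1 / (2 * sqrt x * m))"
    have 1: "((\<lambda>x. f (\<rho> (sqrt x / m))) has_real_derivative f1 r * d) (at x)"
      unfolding d_def r_def by (rule DERIV_chain2[OF f drx[OF x m]]) (use r in \<open>auto simp: r_def\<close>)
    have 2: "((\<lambda>x. sqrt x) has_real_derivative 1 / (2 * sqrt x)) (at x)"
      using x0 by (auto intro!: derivative_eq_intros simp: field_simps)
    have "((\<lambda>x. m * f (\<rho> (sqrt x / m)) + sqrt x * \<rho> (sqrt x / m)) has_real_derivative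
        m * (f1 r * d) + (1 / (2 * sqrt x) * r + d * sqrt x)) (at x)"
      using DERIV_add[OF DERIV_cmult[OF 1, of m] DERIV_mult[OF 2 drx[OF x m]]] unfolding r_def d_def by simp
    \<comment> \<open>Envelope argument: the terms with \<open>d\<close>, the derivative of the
      maximizing point, cancel because f1 r = - sqrt x / m.\<close>
    moreover have "m * (f1 r * d) + (1 / (2 * sqrt x) * r + d * sqrt x) = r / (2 * sqrt x)"
      using m unfolding r(3) by (simp add: field_simps)
    ultimately have "((\<lambda>x. m * f (\<rho> (sqrt x / m)) + sqrt x * \<rho> (sqrt x / m)) has_real_derivative r / (2 * sqrt x)) (at x)"
      by (simp only:)
    then show ?thesis unfolding r_def
      by (rule has_field_derivative_transform_within_open[OF _ openA x]) (use hA m in simp)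
  qed
  have dh2: "((\<lambda>x. \<rho> (sqrt x / m) / (2 * sqrt x)) has_real_derivative \<psi> (sqrt x / m) / (4 * x * sqrt x)) (at x)"
    if x: "x \<in> A m" and m: "0 < m" for x m
  proof -
    have x0: "0 < x" and sx: "sqrt x * sqrt x = x" using x unfolding A_def by auto
    have 2: "((\<lambda>x. 2 * sqrt x) has_real_derivative 1 / sqrt x) (at x)"
      using x0 by (auto intro!: derivative_eq_intros simp: field_simps)
    have "((\<lambda>x. \<rho> (sqrt x / m) / (2 * sqrt x)) has_real_derivative
      (\<rho>1 (sqrt x / m) * (1 / (2 * sqrt x * m)) * (2 * sqrt x) - \<rho> (sqrt x / m) * (1 / sqrt x)) / ((2 * sqrt x) * (2 * sqrt x))) (at x)"
      by (rule DERIV_divide[OF drx[OF x m] 2]) (use x0 in simp)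
    moreover have "(\<rho>1 (sqrt x / m) * (1 / (2 * sqrt x * m)) * (2 * sqrt x) - \<rho> (sqrt x / m) * (1 / sqrt x)) / ((2 * sqrt x) * (2 * sqrt x))
       = \<psi> (sqrt x / m) / (4 * x * sqrt x)"
    proof -
      define w where "w = sqrt x"
      have w: "0 < w" "x = w * w" using x0 sx unfolding w_def by auto
      show ?thesis unfolding w_def[symmetric] \<psi>_def unfolding w(2) using w(1) m
        by (simp add: field_simps)
    qed
    ultimately show ?thesis by simp
  qed
  show ?thesis unfolding phase_condition_def Let_def
  proof (intro allI impI)
    fix U M :: real and m1 m2 n :: nat
    assume U: "(f1 r0)\<^sup>2 \<le> U" and M: "0 < M" and m: "M \<le> real m1" "m1 < m2" "real m2 < 2 * M"
      and n: "U * (real m2)\<^sup>2 \<le> real n" "real (n + 2) < 2 * U * (real m1)\<^sup>2"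
    have s0: "0 < F r0" unfolding F_def using neg1 ab by auto
    have "0 < (f1 r0)\<^sup>2" using s0 unfolding F_def by simp
    then have U0: "0 < U" using U by linarith
    have sU: "F r0 \<le> sqrt U" using U s0 real_le_rsqrt unfolding F_def by (simp add: real_le_rsqrt)
    have mpos: "0 < real m1" "0 < real m2" "real m1 < real m2" using m M by auto
    have sq12: "(real m1)\<^sup>2 \<le> (real m2)\<^sup>2" using mpos by (intro power_mono) auto
    \<comment> \<open>On the common range of n both slopes sqrt x / m lie between sqrt U and sqrt (2
      U), hence in J and at points not to the left of r0.\<close>
    have rng: "sqrt U \<le> sqrt x / real m \<and> sqrt x / real m \<le> sqrt (2 * U)"
      if "real n \<le> x" "x \<le> real (n + 2)" "m = m1 \<or> m = m2" for x and m :: nat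
    proof -
      have m: "0 < real m" "(real m1)\<^sup>2 \<le> (real m)\<^sup>2" "(real m)\<^sup>2 \<le> (real m2)\<^sup>2"
        using that(3) mpos sq12 by auto
      have "U * (real m)\<^sup>2 \<le> U * (real m2)\<^sup>2" "2 * U * (real m1)\<^sup>2 \<le> 2 * U * (real m)\<^sup>2"
        using m U0 by (auto intro!: mult_left_mono)
      then have "U * (real m)\<^sup>2 \<le> x" "x \<le> 2 * U * (real m)\<^sup>2" using that n by linarith+
      then have "sqrt (U * (real m)\<^sup>2) \<le> sqrt x" "sqrt x \<le> sqrt (2 * U * (real m)\<^sup>2)" by simp_all
      then show ?thesis using m(1) by (simp add: real_sqrt_mult field_simps)
    qed
    have npos: "0 < real n" using n(1) U0 mpos by (smt (verit) mult_pos_pos zero_less_power)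
    have inA: "x \<in> A (real m)" if "real n \<le> x" "x \<le> real (n + 2)" "m = m1 \<or> m = m2" for x and m :: nat
    proof -
      have "sqrt x / real m \<in> J" using rng[OF that] sU by (intro Jup) simp
      then show ?thesis unfolding A_def using npos that by simp
    qed
    define g where "g x = h x (real m1) - h x (real m2)" for x
    define g1 where "g1 x = \<rho> (sqrt x / real m1) / (2 * sqrt x) - \<rho> (sqrt x / real m2) / (2 * sqrt x)" for x
    define g2 where "g2 x = \<psi> (sqrt x / real m1) / (4 * x * sqrt x) - \<psi> (sqrt x / real m2) / (4 * x * sqrt x)" for x
    have "\<exists>\<xi>. real n < \<xi> \<and> \<xi> < real n + 2 \<and> g (real n + 2) - 2 * g (real n + 1) + g (real n) = g2 \<xi>"
    proof (rule second_difference_eq_second_derivative)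
      fix x assume "real n \<le> x" "x \<le> real n + 2"
      then have x: "x \<in> A (real m1)" "x \<in> A (real m2)" using inA by auto
      show "(g has_real_derivative g1 x) (at x)"
        unfolding g_def g1_def by (intro DERIV_diff dh x mpos)
      show "(g1 has_real_derivative g2 x) (at x)"
        unfolding g1_def g2_def by (intro DERIV_diff dh2 x mpos)
    qed
    then obtain \<xi> where xi: "real n < \<xi>" "\<xi> < real n + 2"
      "g (real n + 2) - 2 * g (real n + 1) + g (real n) = g2 \<xi>" by blast
    define w where "w = sqrt \<xi>"
    have w: "0 < w" "\<xi> = w * w" using xi npos unfolding w_def by auto
    define s1 s2 where "s1 = w / real m1" and "s2 = w / real m2"
    have s12: "s2 < s1" unfolding s1_def s2_def using w mpos by (intro divide_strict_left_mono) auto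
    have s1r: "s1 \<le> sqrt (2 * U)" and s2r: "sqrt U \<le> s2"
      using rng[of \<xi> m1] rng[of \<xi> m2] xi unfolding s1_def s2_def w_def by auto
    have "(\<psi> has_real_derivative s * \<rho>2 s) (at s)" if "s2 \<le> s" "s \<le> s1" for s
      using that s2r sU by (intro dpsi Jup) auto
    then obtain \<tau> where t: "s2 < \<tau>" "\<tau> < s1" "\<psi> s1 - \<psi> s2 = (s1 - s2) * (\<tau> * \<rho>2 \<tau>)"
      using MVT2[OF s12, of \<psi> "\<lambda>s. s * \<rho>2 s"] by blast
    have tJ: "\<tau> \<in> J" using t s2r sU by (intro Jup) simp
    have tpos: "0 < \<tau>" using Jpos[OF tJ] .
    define r where "r = \<rho> \<tau>"
    have r: "a < r" "r < b" "F r = \<tau>" using rho[OF tJ] unfolding r_def by auto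
    have "r0 \<le> r" using Fmono[of r r0] r ab t s2r sU by force
    \<comment> \<open>Since f1 r = - \<tau>, the factor f1^4 equals \<tau>^4 and turns \<tau>
      \<rho>''(\<tau>) into Q / \<tau>^3.\<close>
    define Q where "Q = - (f3 r * f1 r ^ 4 / f2 r ^ 3)"
    have Q: "q1 \<le> \<sigma> * Q" "\<sigma> * Q \<le> q2" using q(2)[OF \<open>r0 \<le> r\<close> r(2)] unfolding Q_def by auto
    have "f1 r = - \<tau>" using r(3) unfolding F_def by simp
    then have rho2: "\<tau> * \<rho>2 \<tau> = Q / \<tau> ^ 3"
      unfolding Q_def \<rho>2_def r_def[symmetric] using tpos by (simp add: field_simps power_numeral_reduce)
    have sd: "s1 - s2 = w * real (m2 - m1) / (real m1 * real m2)"
      unfolding s1_def s2_def using mpos by (simp add: field_simps of_nat_diff)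
    have g2s: "g2 \<xi> = (\<psi> s1 - \<psi> s2) / (4 * \<xi> * w)"
      unfolding g2_def s1_def s2_def w_def by (simp add: diff_divide_distrib)
    have g2: "g2 \<xi> = real (m2 - m1) * Q / (4 * \<xi> * (real m1 * real m2) * \<tau> ^ 3)"
      unfolding g2s t(3) rho2 sd using w(1) by simp
    define D where "D = 4 * \<xi> * (real m1 * real m2) * \<tau> ^ 3"
    \<comment> \<open>The size of \<open>D\<close> up to constants: \<xi> lies between U M^2 and 8 U
      M^2, m1 m2 between M^2 and 4 M^2, \<tau>^3 between U^(3/2) and 3 U^(3/2). With the factor 4 in
      \<open>D\<close> this yields 4 V <= D <= 384 V, the origin of the constants in the
      conclusion.\<close>
    define V where "V = U\<^sup>2 * sqrt U * M ^ 4"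
    have V: "V = (U * M\<^sup>2) * (M * M) * (sqrt U) ^ 3"
      unfolding V_def using U0 by (simp add: power2_eq_square power_numeral_reduce)
    have V0: "0 < V" unfolding V_def using U0 M by simp
    have lo: "4 * V \<le> D"
    proof -
      have "U * M\<^sup>2 \<le> \<xi>"
      proof -
        have "U * M\<^sup>2 \<le> U * (real m2)\<^sup>2" using m M U0 by (intro mult_left_mono power_mono) auto
        then show ?thesis using n xi by linarith
      qed
      moreover have "M * M \<le> real m1 * real m2" using m M by (intro mult_mono) auto
      moreover have "(sqrt U) ^ 3 \<le> \<tau> ^ 3" using t s2r U0 by (intro power_mono) auto
      ultimately have "(U * M\<^sup>2) * (M * M) * (sqrt U) ^ 3 \<le> \<xi> * (real m1 * real m2) * \<tau> ^ 3"
        using U0 M xi npos m by (intro mult_mono) auto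
      then show ?thesis unfolding V D_def by simp
    qed
    have hi: "D \<le> 384 * V"
    proof -
      have "\<xi> \<le> 8 * (U * M\<^sup>2)"
      proof -
        have "2 * U * (real m1)\<^sup>2 \<le> 2 * U * (2 * M)\<^sup>2" using m M U0 by (intro mult_left_mono power_mono) auto
        then show ?thesis using n xi by (simp add: power_mult_distrib)
      qed
      moreover have "real m1 * real m2 \<le> (2 * M) * (2 * M)" using m M by (intro mult_mono) auto
      moreover have "\<tau> ^ 3 \<le> 3 * (sqrt U) ^ 3"
      proof -
        have "\<tau> ^ 3 \<le> (sqrt 2 * sqrt U) ^ 3"
          using t s1r tpos by (intro power_mono) (auto simp: real_sqrt_mult)
        also have "\<dots> = (sqrt 2) ^ 3 * (sqrt U) ^ 3" by (rule power_mult_distrib)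
        also have "\<dots> \<le> 3 * (sqrt U) ^ 3"
        proof (intro mult_right_mono)
          have "sqrt 2 \<le> 3 / 2" by (rule real_le_lsqrt) (auto simp: power2_eq_square)
          then show "(sqrt 2) ^ 3 \<le> (3::real)" by (simp add: power3_eq_cube)
        qed (use U0 in simp)
        finally show ?thesis .
      qed
      ultimately have "\<xi> * (real m1 * real m2) * \<tau> ^ 3 \<le> (8 * (U * M\<^sup>2)) * ((2 * M) * (2 * M)) * (3 * (sqrt U) ^ 3)"
        using U0 M xi npos mpos tpos m by (intro mult_mono) auto
      then show ?thesis unfolding V D_def by (simp add: power2_eq_square mult_ac)
    qed
    have D0: "0 < D" using lo V0 by linarith
    define k where "k = real (m2 - m1)"
    have k0: "0 \<le> k" unfolding k_def by simp
    have Q0: "0 \<le> \<sigma> * Q" using Q(1) q(1) by linarith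
    have val: "\<sigma> * g2 \<xi> = k * (\<sigma> * Q) / D" unfolding g2 D_def k_def by simp
    have "q1 / 384 * (k / V) = k * q1 / (384 * V)" by simp
    also have "\<dots> \<le> k * (\<sigma> * Q) / D" 
      by (rule frac_le[OF mult_nonneg_nonneg[OF k0 Q0] mult_left_mono[OF Q(1) k0] D0 hi])
    finally have 1: "q1 / 384 * (k / V) \<le> \<sigma> * g2 \<xi>" unfolding val .
    have "k * (\<sigma> * Q) / D \<le> k * q2 / (4 * V)" 
    proof (rule frac_le[OF _ mult_left_mono[OF Q(2) k0] _ lo])
      show "0 \<le> k * q2" using k0 Q q(1) by (intro mult_nonneg_nonneg) linarith+
    qed (use V0 in simp)
    also have "\<dots> = q2 / 4 * (k / V)" by simp
    finally have 2: "\<sigma> * g2 \<xi> \<le> q2 / 4 * (k / V)" unfolding val .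
    have "h (real (n + 2)) (real m1) - 2 * h (real (n + 1)) (real m1) + h (real n) (real m1)
        - (h (real (n + 2)) (real m2) - 2 * h (real (n + 1)) (real m2) + h (real n) (real m2)) = g2 \<xi>"
      unfolding xi(3)[symmetric] g_def by (simp add: add.commute)
    then show "q1 / 384 * (real (m2 - m1) / (U\<^sup>2 * sqrt U * M ^ 4))
        \<le> \<sigma> * (h (real (n + 2)) (real m1) - 2 * h (real (n + 1)) (real m1) + h (real n) (real m1)
        - (h (real (n + 2)) (real m2) - 2 * h (real (n + 1)) (real m2) + h (real n) (real m2))) \<and>
      \<sigma> * (h (real (n + 2)) (real m1) - 2 * h (real (n + 1)) (real m1) + h (real n) (real m1)
        - (h (real (n + 2)) (real m2) - 2 * h (real (n + 1)) (real m2) + h (real n) (real m2)))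
        \<le> q2 / 4 * (real (m2 - m1) / (U\<^sup>2 * sqrt U * M ^ 4))"
      using 1 2 unfolding k_def V_def by simp
  qed
qed

section \<open>The generatrix near the equator\<close>

lemma real_analytic_on_subset: "real_analytic_on S F \<Longrightarrow> T \<subseteq> S \<Longrightarrow> real_analytic_on T F"
  unfolding real_analytic_on_def by (meson subsetD)

text \<open>Term by term differentiation of the local series. Relative analyticity yields
  convergence only at points of S; openness supplies a full interval around the centre.\<close>

lemma real_analytic_on_deriv:
  assumes F: "real_analytic_on S F" and S: "open S"
  shows "\<And>x. x \<in> S \<Longrightarrow> (F has_real_derivative deriv F x) (at x)" and "real_analytic_on S (deriv F)"
proof -
  have key: "\<exists>\<delta>>0. \<exists>c. \<forall>x\<in>S. \<bar>x - a\<bar> < \<delta> \<longrightarrow>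
    (F has_real_derivative (\<Sum>k. diffs c k * (x - a) ^ k)) (at x) \<and> summable (\<lambda>k. diffs c k * (x - a) ^ k)"
    if a: "a \<in> S" for a
  proof -
    obtain \<delta> c where d: "\<delta> > 0" "\<And>x. x \<in> S \<Longrightarrow> \<bar>x - a\<bar> < \<delta> \<Longrightarrow> (\<lambda>k. c k * (x - a) ^ k) sums F x"
      using F a unfolding real_analytic_on_def by blast
    obtain e where e: "e > 0" "ball a e \<subseteq> S" using S a open_contains_ball by blast
    define K where "K = min \<delta> e"
    have K: "0 < K" "K \<le> \<delta>" "K \<le> e" unfolding K_def using d e by auto
    have sums: "(\<lambda>k. c k * y ^ k) sums F (a + y)" if "norm y < K" for y
    proof -
      have "a + y \<in> S" using that K e by (intro subsetD[OF e(2)]) (auto simp: dist_norm)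
      then show ?thesis using d(2)[of "a + y"] that K by simp
    qed
    have sm: "summable (\<lambda>k. c k * y ^ k)" if "norm y < K" for y
      using sums[OF that] by (rule sums_summable)
    have "(F has_real_derivative (\<Sum>k. diffs c k * (x - a) ^ k)) (at x)
        \<and> summable (\<lambda>k. diffs c k * (x - a) ^ k)" if x: "\<bar>x - a\<bar> < K" for x
    proof
      have n: "norm (x - a) < K" using x by simp
      have "((\<lambda>y. \<Sum>k. c k * y ^ k) has_real_derivative (\<Sum>k. diffs c k * (x - a) ^ k)) (at (x - a))"
        by (rule termdiffs_strong'[OF sm n])
      then have "((\<lambda>x. \<Sum>k. c k * (x - a) ^ k) has_real_derivative (\<Sum>k. diffs c k * (x - a) ^ k)) (at x)"
        using DERIV_shift[of "\<lambda>y. \<Sum>k. c k * y ^ k" _ x "- a"] by simp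
      then show "(F has_real_derivative (\<Sum>k. diffs c k * (x - a) ^ k)) (at x)"
      proof (rule has_field_derivative_transform_within_open[of _ _ _ "ball a K"])
        show "x \<in> ball a K" using x by (simp add: dist_real_def abs_minus_commute)
        fix y assume "y \<in> ball a K"
        then have "norm (y - a) < K" by (simp add: dist_real_def abs_minus_commute)
        then show "(\<Sum>k. c k * (y - a) ^ k) = F y" using sums[of "y - a"] by (simp add: sums_iff)
      qed simp
      show "summable (\<lambda>k. diffs c k * (x - a) ^ k)" by (rule termdiff_converges[OF n sm])
    qed
    then show ?thesis using K by blast
  qed
  show d: "(F has_real_derivative deriv F x) (at x)" if x: "x \<in> S" for x
  proof -
    obtain \<delta> c where "0 < \<delta>" "\<forall>y\<in>S. \<bar>y - x\<bar> < \<delta> \<longrightarrow>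
      (F has_real_derivative (\<Sum>k. diffs c k * (y - x) ^ k)) (at y) \<and> summable (\<lambda>k. diffs c k * (y - x) ^ k)"
      using key[OF x] by blast
    then have "(F has_real_derivative (\<Sum>k. diffs c k * (x - x) ^ k)) (at x)" using x by auto
    then show ?thesis by (metis DERIV_imp_deriv)
  qed
  show "real_analytic_on S (deriv F)"
    unfolding real_analytic_on_def
  proof
    fix a assume a: "a \<in> S"
    obtain \<delta> c where c: "0 < \<delta>" "\<forall>x\<in>S. \<bar>x - a\<bar> < \<delta> \<longrightarrow>
      (F has_real_derivative (\<Sum>k. diffs c k * (x - a) ^ k)) (at x) \<and> summable (\<lambda>k. diffs c k * (x - a) ^ k)"
      using key[OF a] by blast
    have "(\<lambda>k. diffs c k * (x - a) ^ k) sums deriv F x" if "x \<in> S" "\<bar>x - a\<bar> < \<delta>" for x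
      using c(2)[rule_format, OF that] DERIV_imp_deriv by (metis summable_sums)
    then show "\<exists>\<delta>>0. \<exists>c. \<forall>x\<in>S. \<bar>x - a\<bar> < \<delta> \<longrightarrow> (\<lambda>k. c k * (x - a) ^ k) sums deriv F x"
      using c(1) by blast
  qed
qed

text \<open>Covers the end point 0 as well: convergence at a single y > a already makes the series
  continuous at a. Continuity up to the axis is needed for showing that points strictly below the
  upper graph are interior.\<close>

lemma real_analytic_on_imp_continuous_on:
  assumes F: "real_analytic_on {0..<b} F"
  shows "continuous_on {0..<b} F"
  unfolding continuous_on_eq_continuous_within
proof
  fix a assume a: "a \<in> {0..<b}"
  obtain \<delta> c where d: "\<delta> > 0" "\<And>x. x \<in> {0..<b} \<Longrightarrow> \<bar>x - a\<bar> < \<delta> \<Longrightarrow> (\<lambda>k. c k * (x - a) ^ k) sums F x"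
    using F a unfolding real_analytic_on_def by blast
  define y where "y = min (a + \<delta> / 2) ((a + b) / 2)"
  have y: "y \<in> {0..<b}" "\<bar>y - a\<bar> < \<delta>" "a < y" unfolding y_def using a d by (auto simp: min_def)
  have sm: "summable (\<lambda>k. c k * (y - a) ^ k)" using d(2)[OF y(1,2)] by (rule sums_summable)
  have "isCont (\<lambda>x. \<Sum>k. c k * x ^ k) (a - a)"
    using y by (intro isCont_powser[OF sm]) simp
  then have "isCont (\<lambda>x. \<Sum>k. c k * (x - a) ^ k) a"
    by (rule isCont_o2[where f = "\<lambda>x. x - a", rotated]) simp
  then have "continuous (at a within {0..<b}) (\<lambda>x. \<Sum>k. c k * (x - a) ^ k)"
    by (rule continuous_at_imp_continuous_at_within)
  then show "continuous (at a within {0..<b}) F"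
  proof (rule continuous_transform_within[OF _ d(1) a])
    fix x assume "x \<in> {0..<b}" "dist x a < \<delta>"
    then show "(\<Sum>k. c k * (x - a) ^ k) = F x" using d(2)[of x] by (simp add: sums_iff dist_real_def)
  qed
qed

text \<open>Agreement of g and h is required on the open interval only, so the lemma can be iterated
  without information on the derivatives at 0.\<close>

lemma deriv_within_eq:
  assumes "x \<in> {0<..<b}" "\<And>y. y \<in> {0<..<b} \<Longrightarrow> g y = h y" "(h has_real_derivative d) (at x)"
  shows "deriv_within {0..<b} g x = d"
proof -
  have "(g has_real_derivative d) (at x)"
    by (rule has_field_derivative_transform_within_open[OF assms(3), of "{0<..<b}"]) (use assms in auto)
  then have "(g has_vector_derivative d) (at x)" by (simp add: has_real_derivative_iff_has_vector_derivative)
  moreover have "at x within {0..<b} = at x"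
    using assms(1) by (intro at_within_interior) (simp add: interior_atLeastLessThan)
  ultimately show ?thesis unfolding deriv_within_def by (simp add: vector_derivative_at)
qed

lemma isCont_zero_eps:
  fixes g :: "real \<Rightarrow> real"
  assumes "isCont g 0" "0 < e"
  shows "\<exists>d>0. \<forall>t. \<bar>t\<bar> < d \<longrightarrow> \<bar>g t - g 0\<bar> < e"
  using assms unfolding continuous_at_eps_delta dist_real_def by simp

text \<open>
  Differentiating \<open>f \<circ> \<alpha> = \<beta>\<close> three times expresses \<open>f''' f'\<^sup>4 / f''\<^sup>3\<close> at \<open>\<alpha>(t)\<close> through the derivatives of
  \<open>\<alpha>\<close> and \<open>\<beta>\<close>; the powers of the vanishing quantity \<open>\<alpha>'(t)\<close> cancel, and the limit is
  \<open>-3 \<beta>'(0)\<^sup>2 / \<alpha>''(0)\<close>.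
\<close>

lemma profile_near_equator:
  fixes f f1 f2 f3 \<alpha> \<alpha>1 \<alpha>2 \<alpha>3 \<beta> \<beta>1 \<beta>2 \<beta>3 :: "real \<Rightarrow> real"
  assumes b: "0 < b"
    and f: "\<And>x. 0 < x \<Longrightarrow> x < b \<Longrightarrow> (f has_real_derivative f1 x) (at x)"
    and f1: "\<And>x. 0 < x \<Longrightarrow> x < b \<Longrightarrow> (f1 has_real_derivative f2 x) (at x)"
    and f2: "\<And>x. 0 < x \<Longrightarrow> x < b \<Longrightarrow> (f2 has_real_derivative f3 x) (at x)"
    and T: "0 < T"
    and a: "\<And>t. \<bar>t\<bar> < T \<Longrightarrow> (\<alpha> has_real_derivative \<alpha>1 t) (at t)"
    and a1: "\<And>t. \<bar>t\<bar> < T \<Longrightarrow> (\<alpha>1 has_real_derivative \<alpha>2 t) (at t)"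
    and a2: "\<And>t. \<bar>t\<bar> < T \<Longrightarrow> (\<alpha>2 has_real_derivative \<alpha>3 t) (at t)"
    and a3: "isCont \<alpha>3 0"
    and be: "\<And>t. \<bar>t\<bar> < T \<Longrightarrow> (\<beta> has_real_derivative \<beta>1 t) (at t)"
    and be1: "\<And>t. \<bar>t\<bar> < T \<Longrightarrow> (\<beta>1 has_real_derivative \<beta>2 t) (at t)"
    and be2: "\<And>t. \<bar>t\<bar> < T \<Longrightarrow> (\<beta>2 has_real_derivative \<beta>3 t) (at t)"
    and be3: "isCont \<beta>3 0"
    and zero: "\<alpha> 0 = b" "\<alpha>1 0 = 0" "\<alpha>2 0 \<noteq> 0" "0 < \<beta>1 0"
    and comp: "\<And>t. 0 < t \<Longrightarrow> t < T \<Longrightarrow> 0 < \<alpha> t \<and> \<alpha> t < b \<and> \<beta> t = f (\<alpha> t)"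
  shows "\<exists>\<eta> q1 q2. 0 < \<eta> \<and> \<eta> \<le> b \<and> 0 < q1 \<and>
      (\<forall>x. b - \<eta> < x \<and> x < b \<longrightarrow> q1 \<le> \<bar>f3 x * f1 x ^ 4 / f2 x ^ 3\<bar> \<and> \<bar>f3 x * f1 x ^ 4 / f2 x ^ 3\<bar> \<le> q2)"
    and "\<And>\<eta> s. 0 < \<eta> \<Longrightarrow> \<exists>x. 0 < x \<and> b - \<eta> < x \<and> x < b \<and> s < \<bar>f1 x\<bar>"
proof -
  have comp1: "\<beta>1 t = f1 (\<alpha> t) * \<alpha>1 t" if t: "0 < t" "t < T" for t
  proof -
    have "((\<lambda>t. f (\<alpha> t)) has_real_derivative f1 (\<alpha> t) * \<alpha>1 t) (at t)"
      by (rule DERIV_chain2[OF f a]) (use comp[OF t] t in auto)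
    then have "(\<beta> has_real_derivative f1 (\<alpha> t) * \<alpha>1 t) (at t)"
      by (rule has_field_derivative_transform_within_open[of _ _ _ "{0<..<T}"]) (use comp t in auto)
    then show ?thesis using be[of t] t by (intro DERIV_unique[of \<beta>]) auto
  qed
  have d1: "((\<lambda>t. f1 (\<alpha> t)) has_real_derivative f2 (\<alpha> t) * \<alpha>1 t) (at t)" if t: "0 < t" "t < T" for t
    by (rule DERIV_chain2[OF f1 a]) (use comp[OF t] t in auto)
  have d2: "((\<lambda>t. f2 (\<alpha> t)) has_real_derivative f3 (\<alpha> t) * \<alpha>1 t) (at t)" if t: "0 < t" "t < T" for t
    by (rule DERIV_chain2[OF f2 a]) (use comp[OF t] t in auto)
  have comp2: "\<beta>2 t = f2 (\<alpha> t) * (\<alpha>1 t)\<^sup>2 + f1 (\<alpha> t) * \<alpha>2 t" if t: "0 < t" "t < T" for t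
  proof -
    have "((\<lambda>t. f1 (\<alpha> t) * \<alpha>1 t) has_real_derivative f2 (\<alpha> t) * (\<alpha>1 t)\<^sup>2 + f1 (\<alpha> t) * \<alpha>2 t) (at t)"
      by (rule derivative_eq_intros d1[OF t] a1 refl)+ (use t in \<open>auto simp: power2_eq_square\<close>)
    then have "(\<beta>1 has_real_derivative f2 (\<alpha> t) * (\<alpha>1 t)\<^sup>2 + f1 (\<alpha> t) * \<alpha>2 t) (at t)"
      by (rule has_field_derivative_transform_within_open[of _ _ _ "{0<..<T}"]) (use comp1 t in auto)
    then show ?thesis using be1[of t] t by (intro DERIV_unique[of \<beta>1]) auto
  qed
  have comp3: "\<beta>3 t = f3 (\<alpha> t) * \<alpha>1 t ^ 3 + 3 * f2 (\<alpha> t) * \<alpha>1 t * \<alpha>2 t + f1 (\<alpha> t) * \<alpha>3 t"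
    if t: "0 < t" "t < T" for t
  proof -
    have "((\<lambda>t. f2 (\<alpha> t) * (\<alpha>1 t)\<^sup>2 + f1 (\<alpha> t) * \<alpha>2 t) has_real_derivative
      f3 (\<alpha> t) * \<alpha>1 t ^ 3 + 3 * f2 (\<alpha> t) * \<alpha>1 t * \<alpha>2 t + f1 (\<alpha> t) * \<alpha>3 t) (at t)"
    proof -
      have A: "(\<alpha>1 has_real_derivative \<alpha>2 t) (at t)" "(\<alpha>2 has_real_derivative \<alpha>3 t) (at t)"
        using a1[of t] a2[of t] t by auto
      show ?thesis unfolding power2_eq_square
        using DERIV_add[OF DERIV_mult[OF d2[OF t] DERIV_mult[OF A(1) A(1)]] DERIV_mult[OF d1[OF t] A(2)]]
        by (rule DERIV_cong) (simp add: power3_eq_cube algebra_simps)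
    qed
    then have "(\<beta>2 has_real_derivative
      f3 (\<alpha> t) * \<alpha>1 t ^ 3 + 3 * f2 (\<alpha> t) * \<alpha>1 t * \<alpha>2 t + f1 (\<alpha> t) * \<alpha>3 t) (at t)"
      by (rule has_field_derivative_transform_within_open[of _ _ _ "{0<..<T}"]) (use comp2 t in auto)
    then show ?thesis using be2[of t] t by (intro DERIV_unique[of \<beta>2]) auto
  qed
  have c: "isCont \<alpha> 0" "isCont \<alpha>1 0" "isCont \<alpha>2 0" "isCont \<beta>1 0" "isCont \<beta>2 0"
    using a[of 0] a1[of 0] a2[of 0] be1[of 0] be2[of 0] T by (auto intro: DERIV_isCont)
  \<comment> \<open>The differentiated relations solved for the derivatives of f: for t > 0,
    \<open>N3\<close> equals f''(\<alpha>) \<alpha>1^3 and \<open>N5\<close> equals f'''(\<alpha>)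
    \<alpha>1^5. Unlike f'' and f''', both are continuous at t = 0, with the nonzero values -
    \<beta>1 \<alpha>2 and 3 \<beta>1 \<alpha>2^2.\<close>
  define N3 where "N3 t = \<beta>2 t * \<alpha>1 t - \<beta>1 t * \<alpha>2 t" for t
  define N5 where "N5 t = \<beta>3 t * (\<alpha>1 t)\<^sup>2 - 3 * N3 t * \<alpha>2 t - \<beta>1 t * \<alpha>1 t * \<alpha>3 t" for t
  define Q where "Q t = N5 t * \<beta>1 t ^ 4 / N3 t ^ 3" for t
  have N30: "N3 0 = - (\<beta>1 0 * \<alpha>2 0)" unfolding N3_def using zero by simp
  then have N3n: "N3 0 \<noteq> 0" using zero by simp
  have N50: "N5 0 \<noteq> 0" unfolding N5_def N30 using zero by simp
  have Q0: "Q 0 \<noteq> 0" unfolding Q_def using N3n N50 zero by simp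
  have cN3: "isCont N3 0" unfolding N3_def by (intro continuous_intros c)
  have cN5: "isCont N5 0" unfolding N5_def by (intro continuous_intros c cN3 a3 be3)
  have cQ: "isCont Q 0" unfolding Q_def by (intro continuous_intros c cN3 cN5) (use N3n in simp)
  have "\<exists>e>0. \<forall>t. \<bar>t\<bar> < e \<longrightarrow> \<bar>Q t - Q 0\<bar> < \<bar>Q 0\<bar> / 2"
    using Q0 by (intro isCont_zero_eps cQ) simp
  then obtain e1 where e1: "0 < e1" "\<And>t. \<bar>t\<bar> < e1 \<Longrightarrow> \<bar>Q t - Q 0\<bar> < \<bar>Q 0\<bar> / 2" by blast
  have "\<exists>e>0. \<forall>t. \<bar>t\<bar> < e \<longrightarrow> \<bar>\<beta>1 t - \<beta>1 0\<bar> < \<beta>1 0 / 2"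
    using zero by (intro isCont_zero_eps c) simp
  then obtain e2 where e2: "0 < e2" "\<And>t. \<bar>t\<bar> < e2 \<Longrightarrow> \<bar>\<beta>1 t - \<beta>1 0\<bar> < \<beta>1 0 / 2" by blast
  have bpos: "\<beta>1 0 / 2 < \<beta>1 t" if "\<bar>t\<bar> < e2" for t using e2(2)[OF that] by (simp add: abs_if split: if_splits)
  define e where "e = min e1 (min e2 T)"
  have e: "0 < e" "e \<le> e1" "e \<le> e2" "e \<le> T" unfolding e_def using e1 e2 T by auto
  have Qeq: "f3 (\<alpha> t) * f1 (\<alpha> t) ^ 4 / f2 (\<alpha> t) ^ 3 = Q t" if t: "0 < t" "t < e" for t
  proof -
    have tT: "0 < t" "t < T" using t e by auto
    have b1: "\<beta>1 t \<noteq> 0" using bpos[of t] zero t e by auto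
    then have p: "\<alpha>1 t \<noteq> 0" using comp1[OF tT] by auto
    define p where "p = \<alpha>1 t"
    have p0: "p \<noteq> 0" using p unfolding p_def .
    have N3: "N3 t = f2 (\<alpha> t) * p ^ 3"
      unfolding N3_def comp1[OF tT] comp2[OF tT] p_def by (simp add: power2_eq_square power3_eq_cube algebra_simps)
    have N5: "N5 t = f3 (\<alpha> t) * p ^ 5"
      unfolding N5_def N3 comp1[OF tT] comp3[OF tT] p_def[symmetric]
      by (simp add: power_numeral_reduce algebra_simps)
    \<comment> \<open>Numerator and denominator both carry \<alpha>1^9: the exponent is 5 + 4 from
      f''' f'^4 and 3 times 3 from f''^3.\<close>
    show ?thesis unfolding Q_def N3 N5 comp1[OF tT] p_def[symmetric] using p0
      by (simp add: power_mult_distrib field_simps flip: power_add power_mult)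
  qed
  have near: "\<alpha> (e / 2) < b" "0 < \<alpha> (e / 2)" using comp[of "e / 2"] e by auto
  \<comment> \<open>Every radius just below b is attained at some t > 0, because \<alpha> takes the
    values b at 0 and \<alpha>(e/2) < b at e/2.\<close>
  have ivt: "\<exists>t. 0 < t \<and> t < e \<and> \<alpha> t = x" if x: "\<alpha> (e / 2) < x" "x < b" for x
  proof -
    have "\<exists>t. 0 \<le> t \<and> t \<le> e / 2 \<and> \<alpha> t = x"
    proof (rule IVT2')
      show "continuous_on {0..e / 2} \<alpha>"
        using a e by (intro continuous_at_imp_continuous_on ballI DERIV_isCont[OF a]) auto
    qed (use x zero e in auto)
    then obtain t where t: "0 \<le> t" "t \<le> e / 2" "\<alpha> t = x" by blast
    moreover have "t \<noteq> 0" using t x zero by auto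
    ultimately show ?thesis using e by (intro exI[of _ t]) auto
  qed
  show "\<exists>\<eta> q1 q2. 0 < \<eta> \<and> \<eta> \<le> b \<and> 0 < q1 \<and>
      (\<forall>x. b - \<eta> < x \<and> x < b \<longrightarrow> q1 \<le> \<bar>f3 x * f1 x ^ 4 / f2 x ^ 3\<bar> \<and> \<bar>f3 x * f1 x ^ 4 / f2 x ^ 3\<bar> \<le> q2)"
  proof (intro exI conjI allI impI)
    show "0 < b - \<alpha> (e / 2)" "b - \<alpha> (e / 2) \<le> b" "0 < \<bar>Q 0\<bar> / 2" using near Q0 by auto
    fix x assume "b - (b - \<alpha> (e / 2)) < x \<and> x < b"
    then obtain t where t: "0 < t" "t < e" "\<alpha> t = x" using ivt[of x] by auto
    have "\<bar>Q t - Q 0\<bar> < \<bar>Q 0\<bar> / 2" using t e by (intro e1) auto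
    then have "\<bar>Q 0\<bar> / 2 \<le> \<bar>Q t\<bar> \<and> \<bar>Q t\<bar> \<le> 2 * \<bar>Q 0\<bar>" by linarith
    then show "\<bar>Q 0\<bar> / 2 \<le> \<bar>f3 x * f1 x ^ 4 / f2 x ^ 3\<bar>" "\<bar>f3 x * f1 x ^ 4 / f2 x ^ 3\<bar> \<le> 2 * \<bar>Q 0\<bar>"
      using Qeq[OF t(1,2)] t(3) by auto
  qed
  show "\<exists>x. 0 < x \<and> b - \<eta> < x \<and> x < b \<and> s < \<bar>f1 x\<bar>" if eta: "0 < \<eta>" for \<eta> s
  proof -
    \<comment> \<open>The product f1(\<alpha>) \<alpha>1 = \<beta>1 stays above \<beta>1(0) / 2
      while \<alpha>1 tends to 0, so f1 is unbounded; once \<alpha>1 is below this \<epsilon> in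
      absolute value, |f1| exceeds |s| + 1.\<close>
    define \<epsilon> where "\<epsilon> = \<beta>1 0 / (2 * (\<bar>s\<bar> + 1))"
    have eps: "0 < \<epsilon>" unfolding \<epsilon>_def using zero by simp
    obtain e3 where e3: "0 < e3" "\<And>t. \<bar>t\<bar> < e3 \<Longrightarrow> \<bar>\<alpha>1 t\<bar> < \<epsilon>"
      using isCont_zero_eps[OF c(2) eps] zero by auto
    obtain e4 where e4: "0 < e4" "\<And>t. \<bar>t\<bar> < e4 \<Longrightarrow> \<bar>\<alpha> t - b\<bar> < \<eta>"
      using isCont_zero_eps[OF c(1) eta] zero by auto
    define t where "t = min (min e3 e4) (min e2 T) / 2"
    have t: "0 < t" "t < T" "\<bar>t\<bar> < e3" "\<bar>t\<bar> < e4" "\<bar>t\<bar> < e2" unfolding t_def using e3 e4 e2 T by auto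
    have "\<beta>1 0 / 2 < \<bar>f1 (\<alpha> t)\<bar> * \<bar>\<alpha>1 t\<bar>"
      using bpos[OF t(5)] zero comp1[OF t(1,2)] by (simp flip: abs_mult)
    also have "\<dots> \<le> \<bar>f1 (\<alpha> t)\<bar> * \<epsilon>" using e3(2)[OF t(3)] by (intro mult_left_mono) auto
    finally have "\<beta>1 0 / 2 < \<bar>f1 (\<alpha> t)\<bar> * \<epsilon>" .
    moreover have "\<beta>1 0 / 2 = (\<bar>s\<bar> + 1) * \<epsilon>"
    proof -
      have "x / 2 = k * (x / (2 * k))" if "0 < k" for x k :: real using that by simp
      then show ?thesis unfolding \<epsilon>_def by (simp only: abs_add_one_gt_zero add.commute[of "\<bar>s\<bar>"])
    qed
    ultimately have "(\<bar>s\<bar> + 1) * \<epsilon> < \<bar>f1 (\<alpha> t)\<bar> * \<epsilon>" by simp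
    then have "\<bar>s\<bar> + 1 < \<bar>f1 (\<alpha> t)\<bar>" using eps by simp
    then show ?thesis using comp[OF t(1,2)] e4(2)[OF t(4)] by (intro exI[of _ "\<alpha> t"]) auto
  qed
qed

section \<open>Bodies of revolution\<close>

lemma mem_rotational_body:
  "p \<in> rotational_body f1 f2 b \<longleftrightarrow> (let r = sqrt ((p$1)\<^sup>2 + (p$2)\<^sup>2) in f2 r \<le> p$3 \<and> p$3 \<le> f1 r \<and> r \<le> b)"
  unfolding rotational_body_def by (simp add: Let_def)

lemma vector_mem_rotational_body:
  "vector [x, 0, z] \<in> rotational_body f1 f2 b \<longleftrightarrow> f2 \<bar>x\<bar> \<le> z \<and> z \<le> f1 \<bar>x\<bar> \<and> \<bar>x\<bar> \<le> b"
  unfolding mem_rotational_body by (simp add: Let_def)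

lemma convex_comb_vector:
  "(1 - t) *\<^sub>R vector [x, 0, z] + t *\<^sub>R vector [x', 0, z'] =
    (vector [(1 - t) * x + t * x', 0, (1 - t) * z + t * z'] :: real^3)"
  by (simp add: vec_eq_iff forall_3)

text \<open>All is read off in the meridian plane. Concavity comes from chords between points of the
  upper graph, monotonicity from the mirror images (-y, z) and (y, z), whose segment contains (x,
  z).\<close>

lemma rotational_body_profile:
  assumes le: "\<forall>t\<in>{0..b}. f2 t \<le> f1 t" and K: "convex (rotational_body f1 f2 b)"
  shows "convex_on {0..b} (\<lambda>x. - f1 x)"
    and "\<And>x y. 0 \<le> x \<Longrightarrow> x \<le> y \<Longrightarrow> y \<le> b \<Longrightarrow> f1 y \<le> f1 x"
    and "\<And>x y. 0 \<le> x \<Longrightarrow> x \<le> y \<Longrightarrow> y \<le> b \<Longrightarrow> f2 x \<le> f2 y"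
proof -
  let ?K = "rotational_body f1 f2 b"
  have comb: "vector [(1 - t) * x + t * x', 0, (1 - t) * z + t * z'] \<in> ?K"
    if "vector [x, 0, z] \<in> ?K" "vector [x', 0, z'] \<in> ?K" "0 \<le> t" "t \<le> 1" for x x' z z' t
    unfolding convex_comb_vector[symmetric] using convexD[OF K that(1,2), of "1 - t" t] that by simp
  show "convex_on {0..b} (\<lambda>x. - f1 x)"
  proof (rule convex_onI)
    fix t x y :: real assume t: "0 < t" "t < 1" and xy: "x \<in> {0..b}" "y \<in> {0..b}"
    have "vector [(1 - t) * x + t * y, 0, (1 - t) * f1 x + t * f1 y] \<in> ?K"
      using t xy le by (intro comb) (auto simp: vector_mem_rotational_body)
    moreover have "0 \<le> (1 - t) * x + t * y" using t xy by simp
    ultimately have "(1 - t) * f1 x + t * f1 y \<le> f1 ((1 - t) * x + t * y)"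
      unfolding vector_mem_rotational_body by simp
    then show "- f1 ((1 - t) *\<^sub>R x + t *\<^sub>R y) \<le> (1 - t) * - f1 x + t * - f1 y" by simp
  qed simp
  have refl: "vector [x, 0, z] \<in> ?K" if "0 \<le> x" "x \<le> y" "y \<le> b" "f2 y \<le> z" "z \<le> f1 y" for x y z
  proof (cases "y = 0")
    case True then show ?thesis using that by (simp add: vector_mem_rotational_body)
  next
    case False
    then have y: "0 < y" using that by simp
    \<comment> \<open>The weight for which the convex combination of -y and y is x.\<close>
    define t where "t = (x + y) / (2 * y)"
    have "vector [(1 - t) * (- y) + t * y, 0, (1 - t) * z + t * z] \<in> ?K"
      using that y by (intro comb) (auto simp: vector_mem_rotational_body t_def)
    moreover have "(1 - t) * (- y) + t * y = x" unfolding t_def using y by (simp add: field_simps)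
    moreover have "(1 - t) * z + t * z = z" by (simp add: algebra_simps)
    ultimately show ?thesis by simp
  qed
  show "f1 y \<le> f1 x" if "0 \<le> x" "x \<le> y" "y \<le> b" for x y
    using refl[OF that, of "f1 y"] le that by (auto simp: vector_mem_rotational_body)
  show "f2 x \<le> f2 y" if "0 \<le> x" "x \<le> y" "y \<le> b" for x y
    using refl[OF that, of "f2 y"] le that by (auto simp: vector_mem_rotational_body)
qed

text \<open>By \<open>tangent\<close>, the line of slope - sqrt x / m through (r, f1 r) stays above
  the profile, so the functional is maximal there within the meridian; a point outside the meridian
  has a first coordinate at most its radius.\<close>

lemma h_fun_rotational_body:
  assumes tangent: "\<And>y. 0 \<le> y \<Longrightarrow> y \<le> b \<Longrightarrow> f1 y \<le> f1 r - sqrt x / m * (y - r)"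
    and r: "0 \<le> r" "r \<le> b" and le: "f2 r \<le> f1 r" and xm: "0 < x" "0 < m"
  shows "h_fun (rotational_body f1 f2 b) x m = m * f1 r + sqrt x * r"
proof -
  let ?K = "rotational_body f1 f2 b"
  have inn: "p \<bullet> vector [sqrt x, 0, m] = p$1 * sqrt x + p$3 * m" for p :: "real^3"
    by (simp add: inner_vec_def sum_3)
  have "(SUP p\<in>?K. p \<bullet> vector [sqrt x, 0, m]) = m * f1 r + sqrt x * r"
  proof (rule cSup_eq_maximum)
    have "vector [r, 0, f1 r] \<in> ?K" using r le by (simp add: vector_mem_rotational_body)
    then show "m * f1 r + sqrt x * r \<in> (\<lambda>p. p \<bullet> vector [sqrt x, 0, m]) ` ?K"
      by (rule rev_image_eqI) (simp add: inn)
  next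
    fix v assume "v \<in> (\<lambda>p. p \<bullet> vector [sqrt x, 0, m]) ` ?K"
    then obtain p where p: "p \<in> ?K" "v = p$1 * sqrt x + p$3 * m" using inn by auto
    define y where "y = sqrt ((p$1)\<^sup>2 + (p$2)\<^sup>2)"
    have y: "0 \<le> y" "y \<le> b" "p$3 \<le> f1 y" using p(1) unfolding mem_rotational_body Let_def y_def by auto
    have "p$1 \<le> y" unfolding y_def by (rule real_le_rsqrt) simp
    then have "p$1 * sqrt x \<le> y * sqrt x" using xm by (intro mult_right_mono) auto
    moreover have "p$3 * m \<le> (f1 r - sqrt x / m * (y - r)) * m"
      using y tangent[OF y(1,2)] xm by (intro mult_right_mono) auto
    moreover have "(f1 r - sqrt x / m * (y - r)) * m = m * f1 r - sqrt x * (y - r)"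
      using xm by (simp add: field_simps)
    ultimately show "v \<le> m * f1 r + sqrt x * r" unfolding p(2) by (simp add: algebra_simps)
  qed
  then show ?thesis unfolding h_fun_def support_function_def .
qed

text \<open>A point higher than f1 b cannot lie on the rim r = b, and f2 r <= f2 b <= f1 b keeps it
  away from the lower boundary. If it were also strictly below the upper graph, a neighbourhood of
  it would lie in the body.\<close>

lemma frontier_rotational_body_above:
  assumes le: "\<forall>t\<in>{0..b}. f2 t \<le> f1 t" and K: "convex (rotational_body f1 f2 b)"
    and cl: "closed (rotational_body f1 f2 b)" and b: "0 < b" and cont: "continuous_on {0..<b} f1"
    and p: "p \<in> frontier (rotational_body f1 f2 b)" "f1 b < p$3"
  shows "sqrt ((p$1)\<^sup>2 + (p$2)\<^sup>2) < b \<and> p$3 = f1 (sqrt ((p$1)\<^sup>2 + (p$2)\<^sup>2))"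
proof -
  let ?K = "rotational_body f1 f2 b"
  define r where "r = (\<lambda>p :: real^3. sqrt ((p$1)\<^sup>2 + (p$2)\<^sup>2))"
  have pK: "p \<in> ?K" and pni: "p \<notin> interior ?K" using p(1) cl unfolding frontier_def by auto
  have pk: "p$3 \<le> f1 (r p)" "r p \<le> b" using pK unfolding mem_rotational_body Let_def r_def by auto
  have rb: "r p < b" using pk p(2) by (cases "r p = b") auto
  have "p$3 = f1 (r p)"
  proof (rule ccontr)
    assume "p$3 \<noteq> f1 (r p)"
    then have lt: "p$3 < f1 (r p)" using pk by simp
    define A where "A = {q. r q < b}"
    define G where "G = (\<lambda>q :: real^3. (q$3 - f1 b, f1 (r q) - q$3))"
    have rc: "continuous_on S r" for S unfolding r_def by (intro continuous_intros)
    have openA: "open A" unfolding A_def by (intro open_Collect_less rc continuous_intros)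
    have r0: "0 \<le> r q" for q unfolding r_def by simp
    have "continuous_on A (\<lambda>q. f1 (r q))"
      by (rule continuous_on_compose2[OF cont rc]) (use r0 in \<open>auto simp: A_def\<close>)
    then have "continuous_on A G" unfolding G_def by (intro continuous_intros)
    then have op: "open (A \<inter> G -` ({0<..} \<times> {0<..}))"
      using openA by (rule continuous_open_preimage) (intro open_Times open_greaterThan)
    have sub: "A \<inter> G -` ({0<..} \<times> {0<..}) \<subseteq> ?K"
    proof
      fix q assume "q \<in> A \<inter> G -` ({0<..} \<times> {0<..})"
      then have q: "r q < b" "f1 b < q$3" "q$3 < f1 (r q)" unfolding A_def G_def by auto
      have "f2 (r q) \<le> f2 b" using rotational_body_profile(3)[OF le K r0, of q b] q by simp
      also have "\<dots> \<le> f1 b" using le b by simp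
      finally show "q \<in> ?K" using q unfolding mem_rotational_body Let_def r_def by simp
    qed
    have "p \<in> A \<inter> G -` ({0<..} \<times> {0<..})" using rb lt p(2) unfolding A_def G_def by simp
    then have "p \<in> interior ?K" using op sub by (meson interiorI)
    then show False using pni by simp
  qed
  then show ?thesis using rb unfolding r_def by simp
qed

text \<open>Any step outwards from this point makes the radius exceed b.\<close>

lemma equator_mem_frontier:
  assumes "0 < b" "f2 b \<le> f1 b" "closed (rotational_body f1 f2 b)"
  shows "vector [b, 0, f1 b] \<in> frontier (rotational_body f1 f2 b)"
proof -
  let ?K = "rotational_body f1 f2 b"
  let ?p = "vector [b, 0, f1 b] :: real^3"
  have "?p \<in> ?K" using assms by (simp add: vector_mem_rotational_body)
  moreover have "?p \<notin> interior ?K"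
  proof
    assume "?p \<in> interior ?K"
    then obtain e where e: "0 < e" "ball ?p e \<subseteq> ?K" using mem_interior by blast
    let ?q = "vector [b + e / 2, 0, f1 b] :: real^3"
    have "?q - ?p = (e / 2) *\<^sub>R axis 1 1"
      by (simp add: vec_eq_iff forall_3 axis_def)
    then have "norm (?q - ?p) = e / 2" using e by (simp add: norm_axis_1)
    then have "?q \<in> ball ?p e" using e by (simp add: dist_norm norm_minus_commute)
    then have "?q \<in> ?K" using e by blast
    then show False using e assms(1) by (simp add: vector_mem_rotational_body)
  qed
  ultimately show ?thesis using assms(3) unfolding frontier_def by simp
qed

text \<open>The mean value theorem in direction u for the difference of two parallel segments, then
  in direction v. The left side of the equation is symmetric in u and v.\<close>

lemma parallelogram_difference_eq:
  fixes \<phi> \<phi>u \<phi>uv :: "'a::real_normed_vector \<Rightarrow> real"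
  assumes du: "\<And>x. x \<in> V \<Longrightarrow> ((\<lambda>t. \<phi> (x + t *\<^sub>R u)) has_real_derivative \<phi>u x) (at 0)"
    and dv: "\<And>x. x \<in> V \<Longrightarrow> ((\<lambda>t. \<phi>u (x + t *\<^sub>R v)) has_real_derivative \<phi>uv x) (at 0)"
    and h: "0 < h" and V: "\<And>s t. 0 \<le> s \<Longrightarrow> s \<le> h \<Longrightarrow> 0 \<le> t \<Longrightarrow> t \<le> h \<Longrightarrow> q + s *\<^sub>R u + t *\<^sub>R v \<in> V"
  shows "\<exists>s t. 0 \<le> s \<and> s \<le> h \<and> 0 \<le> t \<and> t \<le> h \<and>
    \<phi> (q + h *\<^sub>R u + h *\<^sub>R v) - \<phi> (q + h *\<^sub>R u) - \<phi> (q + h *\<^sub>R v) + \<phi> q = h * h * \<phi>uv (q + s *\<^sub>R u + t *\<^sub>R v)"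
proof -
  have shift: "((\<lambda>t. g (x + t *\<^sub>R w)) has_real_derivative d) (at s)"
    if "((\<lambda>t. g ((x + s *\<^sub>R w) + t *\<^sub>R w)) has_real_derivative d) (at 0)" for g :: "'a \<Rightarrow> real" and x w s d
  proof -
    have "((\<lambda>t. g (x + (t + s) *\<^sub>R w)) has_real_derivative d) (at 0)"
      using that by (simp add: algebra_simps)
    then show ?thesis using DERIV_shift[of "\<lambda>t. g (x + t *\<^sub>R w)" d 0 s] by simp
  qed
  define g where "g s = \<phi> ((q + h *\<^sub>R v) + s *\<^sub>R u) - \<phi> (q + s *\<^sub>R u)" for s
  have dg: "(g has_real_derivative \<phi>u ((q + h *\<^sub>R v) + s *\<^sub>R u) - \<phi>u (q + s *\<^sub>R u)) (at s)" if "0 \<le> s" "s \<le> h" for s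
  proof -
    have "(q + h *\<^sub>R v) + s *\<^sub>R u \<in> V" "q + s *\<^sub>R u \<in> V"
      using V[OF that, of h] V[OF that, of 0] h by (auto simp: algebra_simps)
    from DERIV_diff[OF shift[where g = \<phi>, OF du[OF this(1)]] shift[where g = \<phi>, OF du[OF this(2)]]]
    show ?thesis unfolding g_def .
  qed
  obtain s where s: "0 < s" "s < h" "g h - g 0 = h * (\<phi>u ((q + h *\<^sub>R v) + s *\<^sub>R u) - \<phi>u (q + s *\<^sub>R u))"
    using MVT2[OF h dg] by auto
  have "((\<lambda>t. \<phi>u ((q + s *\<^sub>R u) + t *\<^sub>R v)) has_real_derivative \<phi>uv ((q + s *\<^sub>R u) + t *\<^sub>R v)) (at t)"
    if "0 \<le> t" "t \<le> h" for t
    using shift[where g = \<phi>u, OF dv[OF V[of s t]]] s that by simp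
  from MVT2[OF h this] obtain t where t: "0 < t" "t < h"
    "\<phi>u ((q + s *\<^sub>R u) + h *\<^sub>R v) - \<phi>u ((q + s *\<^sub>R u) + 0 *\<^sub>R v) = (h - 0) * \<phi>uv ((q + s *\<^sub>R u) + t *\<^sub>R v)"
    by blast
  have e: "(q + h *\<^sub>R v) + s *\<^sub>R u = (q + s *\<^sub>R u) + h *\<^sub>R v" by simp
  have "g h - g 0 = h * h * \<phi>uv (q + s *\<^sub>R u + t *\<^sub>R v)" using s(3) t(3) unfolding e by simp
  moreover have "g h - g 0 = \<phi> (q + h *\<^sub>R u + h *\<^sub>R v) - \<phi> (q + h *\<^sub>R u) - \<phi> (q + h *\<^sub>R v) + \<phi> q"
    unfolding g_def by (simp add: algebra_simps)
  ultimately show ?thesis using s t by (intro exI[of _ s] exI[of _ t]) auto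
qed

text \<open>Both mixed derivatives, taken at points close to q, represent the same parallelogram
  difference, so continuity forces equality. The curvature contains only one of the two orders,
  whereas the second derivative along a line contains both.\<close>

lemma mixed_directional_derivatives_commute:
  fixes \<phi> \<phi>u \<phi>v \<phi>uv \<phi>vu :: "'a::real_normed_vector \<Rightarrow> real"
  assumes V: "open V" "q \<in> V"
    and du: "\<And>x. x \<in> V \<Longrightarrow> ((\<lambda>t. \<phi> (x + t *\<^sub>R u)) has_real_derivative \<phi>u x) (at 0)"
    and dv: "\<And>x. x \<in> V \<Longrightarrow> ((\<lambda>t. \<phi> (x + t *\<^sub>R v)) has_real_derivative \<phi>v x) (at 0)"
    and duv: "\<And>x. x \<in> V \<Longrightarrow> ((\<lambda>t. \<phi>u (x + t *\<^sub>R v)) has_real_derivative \<phi>uv x) (at 0)"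
    and dvu: "\<And>x. x \<in> V \<Longrightarrow> ((\<lambda>t. \<phi>v (x + t *\<^sub>R u)) has_real_derivative \<phi>vu x) (at 0)"
    and cont: "continuous_on V \<phi>uv" "continuous_on V \<phi>vu"
  shows "\<phi>uv q = \<phi>vu q"
proof (rule ccontr)
  assume ne: "\<phi>uv q \<noteq> \<phi>vu q"
  define e where "e = \<bar>\<phi>uv q - \<phi>vu q\<bar> / 2"
  have e: "0 < e" unfolding e_def using ne by simp
  obtain d1 where d1: "0 < d1" "\<And>x. x \<in> V \<Longrightarrow> dist x q < d1 \<Longrightarrow> \<bar>\<phi>uv x - \<phi>uv q\<bar> < e"
    using cont(1) V(2) e unfolding continuous_on_iff dist_real_def by blast
  obtain d2 where d2: "0 < d2" "\<And>x. x \<in> V \<Longrightarrow> dist x q < d2 \<Longrightarrow> \<bar>\<phi>vu x - \<phi>vu q\<bar> < e"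
    using cont(2) V(2) e unfolding continuous_on_iff dist_real_def by blast
  obtain d3 where d3: "0 < d3" "ball q d3 \<subseteq> V" using V open_contains_ball by blast
  define d where "d = min d1 (min d2 d3)"
  have d: "0 < d" "d \<le> d1" "d \<le> d2" "d \<le> d3" unfolding d_def using d1 d2 d3 by auto
  define n where "n = norm u + norm v + 1"
  have n: "0 < n" unfolding n_def by (simp add: add_nonneg_pos)
  define h where "h = d / n"
  have h: "0 < h" "h * n = d" unfolding h_def using d n by auto
  have near: "dist (q + s *\<^sub>R u + t *\<^sub>R v) q < d" if "0 \<le> s" "s \<le> h" "0 \<le> t" "t \<le> h" for s t
  proof -
    have "dist (q + s *\<^sub>R u + t *\<^sub>R v) q = norm (s *\<^sub>R u + t *\<^sub>R v)" by (simp add: dist_norm add.assoc)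
    also have "\<dots> \<le> s * norm u + t * norm v" using that by (intro order_trans[OF norm_triangle_ineq]) simp
    also have "\<dots> \<le> h * norm u + h * norm v" using that by (intro add_mono mult_right_mono) auto
    also have "\<dots> < h * n" unfolding n_def using h by (simp add: algebra_simps)
    finally show ?thesis using h by simp
  qed
  have inV: "q + s *\<^sub>R u + t *\<^sub>R v \<in> V" if "0 \<le> s" "s \<le> h" "0 \<le> t" "t \<le> h" for s t
    using near[OF that] d d3(2) by (auto simp: dist_commute)
  obtain s t where st: "0 \<le> s" "s \<le> h" "0 \<le> t" "t \<le> h"
    "\<phi> (q + h *\<^sub>R u + h *\<^sub>R v) - \<phi> (q + h *\<^sub>R u) - \<phi> (q + h *\<^sub>R v) + \<phi> q = h * h * \<phi>uv (q + s *\<^sub>R u + t *\<^sub>R v)"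
    using parallelogram_difference_eq[of V \<phi> u \<phi>u v \<phi>uv h q, OF du duv h(1) inV] by blast
  have inV': "q + t *\<^sub>R v + s *\<^sub>R u \<in> V" if "0 \<le> t" "t \<le> h" "0 \<le> s" "s \<le> h" for s t
    using inV[OF that(3,4,1,2)] by (simp add: algebra_simps)
  obtain t' s' where st': "0 \<le> t'" "t' \<le> h" "0 \<le> s'" "s' \<le> h"
    "\<phi> (q + h *\<^sub>R v + h *\<^sub>R u) - \<phi> (q + h *\<^sub>R v) - \<phi> (q + h *\<^sub>R u) + \<phi> q = h * h * \<phi>vu (q + t' *\<^sub>R v + s' *\<^sub>R u)"
    using parallelogram_difference_eq[of V \<phi> v \<phi>v u \<phi>vu h q, OF dv dvu h(1) inV'] by blast
  have swap: "q + h *\<^sub>R v + h *\<^sub>R u = q + h *\<^sub>R u + h *\<^sub>R v" "q + t' *\<^sub>R v + s' *\<^sub>R u = q + s' *\<^sub>R u + t' *\<^sub>R v" by simp_all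
  have "h * h * \<phi>uv (q + s *\<^sub>R u + t *\<^sub>R v) = h * h * \<phi>vu (q + s' *\<^sub>R u + t' *\<^sub>R v)"
    using st(5) st'(5) unfolding swap by linarith
  then have "\<phi>uv (q + s *\<^sub>R u + t *\<^sub>R v) = \<phi>vu (q + s' *\<^sub>R u + t' *\<^sub>R v)" using h(1) by simp
  moreover have "\<bar>\<phi>uv (q + s *\<^sub>R u + t *\<^sub>R v) - \<phi>uv q\<bar> < e"
    using near[OF st(1-4)] d by (intro d1(2) inV st) auto
  moreover have "\<bar>\<phi>vu (q + s' *\<^sub>R u + t' *\<^sub>R v) - \<phi>vu q\<bar> < e"
    using near[OF st'(3,4,1,2)] d by (intro d2(2) inV st') auto
  moreover have False if "x = y" "\<bar>x - a\<bar> < \<bar>a - c\<bar> / 2" "\<bar>y - c\<bar> < \<bar>a - c\<bar> / 2" for x y a c :: real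
    using that by (simp add: abs_if split: if_splits)
  ultimately show False unfolding e_def by blast
qed

text \<open>The formulas result from differentiating \<alpha>^2 = W: \<alpha> \<alpha>1 = W1 / 2,
  \<alpha> \<alpha>2 + \<alpha>1^2 = W2 / 2, \<alpha> \<alpha>3 + 3 \<alpha>1 \<alpha>2 = W3 /
  2.\<close>

lemma sqrt_curve_derivatives:
  fixes W W1 W2 W3 :: "real \<Rightarrow> real"
  assumes pos: "\<And>t. \<bar>t\<bar> < T \<Longrightarrow> 0 < W t"
    and W: "\<And>t. \<bar>t\<bar> < T \<Longrightarrow> (W has_real_derivative W1 t) (at t)"
    and W1: "\<And>t. \<bar>t\<bar> < T \<Longrightarrow> (W1 has_real_derivative W2 t) (at t)"
    and W2: "\<And>t. \<bar>t\<bar> < T \<Longrightarrow> (W2 has_real_derivative W3 t) (at t)"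
  defines "\<alpha> \<equiv> \<lambda>t. sqrt (W t)"
  defines "\<alpha>1 \<equiv> \<lambda>t. W1 t / (2 * \<alpha> t)"
  defines "\<alpha>2 \<equiv> \<lambda>t. (W2 t / 2 - (\<alpha>1 t)\<^sup>2) / \<alpha> t"
  defines "\<alpha>3 \<equiv> \<lambda>t. (W3 t / 2 - 3 * \<alpha>1 t * \<alpha>2 t) / \<alpha> t"
  assumes t: "\<bar>t\<bar> < T"
  shows "(\<alpha> has_real_derivative \<alpha>1 t) (at t)" "(\<alpha>1 has_real_derivative \<alpha>2 t) (at t)"
    "(\<alpha>2 has_real_derivative \<alpha>3 t) (at t)"
proof -
  have ap: "0 < \<alpha> t" unfolding \<alpha>_def using pos[OF t] by simp
  show a: "(\<alpha> has_real_derivative \<alpha>1 t) (at t)"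
    using DERIV_chain2[OF DERIV_real_sqrt[OF pos[OF t]] W[OF t]]
    unfolding \<alpha>1_def \<alpha>_def by (rule DERIV_cong) (simp add: field_simps)
  show a1: "(\<alpha>1 has_real_derivative \<alpha>2 t) (at t)"
    unfolding \<alpha>1_def
  proof (rule DERIV_cong[OF DERIV_divide[OF W1[OF t] DERIV_cmult[OF a, of 2]]])
    show "(W2 t * (2 * \<alpha> t) - W1 t * (2 * \<alpha>1 t)) / (2 * \<alpha> t * (2 * \<alpha> t)) = \<alpha>2 t"
      unfolding \<alpha>2_def \<alpha>1_def using ap by (simp add: field_simps power2_eq_square)
  qed (use ap in simp)
  have num: "((\<lambda>t. W2 t / 2 - (\<alpha>1 t)\<^sup>2) has_real_derivative W3 t / 2 - 2 * \<alpha>1 t * \<alpha>2 t) (at t)"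
    unfolding power2_eq_square
    by (rule DERIV_cong[OF DERIV_diff[OF DERIV_cdivide[OF W2[OF t], of 2] DERIV_mult[OF a1 a1]]]) simp
  show "(\<alpha>2 has_real_derivative \<alpha>3 t) (at t)"
    unfolding \<alpha>2_def
  proof (rule DERIV_cong[OF DERIV_divide[OF num a]])
    have e: "W2 t / 2 - (\<alpha>1 t)\<^sup>2 = \<alpha>2 t * \<alpha> t" unfolding \<alpha>2_def using ap by simp
    show "((W3 t / 2 - 2 * \<alpha>1 t * \<alpha>2 t) * \<alpha> t - (W2 t / 2 - (\<alpha>1 t)\<^sup>2) * \<alpha>1 t) / (\<alpha> t * \<alpha> t) = \<alpha>3 t"
      unfolding e \<alpha>3_def using ap by (simp add: field_simps)
  qed (use ap in simp)
qed

section \<open>The surface along a line in a chart at the equator\<close>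

lemma frechet_derivative_along_line:
  fixes F :: "real \<times> real \<Rightarrow> real^3"
  assumes "F differentiable (at (q + t *\<^sub>R w))"
  shows "((\<lambda>t. F (q + t *\<^sub>R w) $ i) has_real_derivative frechet_derivative F (at (q + t *\<^sub>R w)) w $ i) (at t)"
proof -
  let ?D = "frechet_derivative F (at (q + t *\<^sub>R w))"
  have D: "(F has_derivative ?D) (at (q + t *\<^sub>R w))" using assms frechet_derivative_works by blast
  have L: "((\<lambda>t. q + t *\<^sub>R w) has_derivative (\<lambda>h. h *\<^sub>R w)) (at t)"
    by (auto intro!: derivative_eq_intros)
  have "((\<lambda>t. F (q + t *\<^sub>R w)) has_derivative (\<lambda>h. ?D (h *\<^sub>R w))) (at t)"
    by (rule has_derivative_compose[OF L D])
  moreover have "?D (h *\<^sub>R w) = h *\<^sub>R ?D w" for h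
    using has_derivative_linear[OF D] by (simp add: linear_cmul)
  ultimately have "((\<lambda>t. F (q + t *\<^sub>R w)) has_vector_derivative ?D w) (at t)"
    unfolding has_vector_derivative_def by simp
  from bounded_linear.has_vector_derivative[OF bounded_linear_vec_nth this, of i]
  show ?thesis by (simp add: has_real_derivative_iff_has_vector_derivative)
qed

lemma frechet_derivative_pair:
  fixes F :: "real \<times> real \<Rightarrow> real^3"
  assumes "F differentiable (at x)"
  shows "frechet_derivative F (at x) (w1, w2) = w1 *\<^sub>R du F x + w2 *\<^sub>R dv F x"
proof -
  have "linear (frechet_derivative F (at x))" using assms linear_frechet_derivative by blast
  moreover have "(w1, w2) = w1 *\<^sub>R (1, 0) + w2 *\<^sub>R (0, 1 :: real)" by simp
  ultimately show ?thesis unfolding du_def dv_def by (simp only: linear_add linear_cmul)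
qed

text \<open>
  At the equatorial point the first coordinate of the surface is maximal, so its first derivatives
  vanish and the determinant of its Hessian is a positive multiple of the Gaussian curvature. The
  line is chosen such that the second coordinate is critical, too.
\<close>

lemma equator_curve:
  assumes b: "0 < b" and le: "\<forall>t\<in>{0..b}. f2 t \<le> f1 t"
    and body: "smooth_convex_body (rotational_body f1 f2 b)" and cont: "continuous_on {0..<b} f1"
  shows "\<exists>T \<alpha> \<alpha>1 \<alpha>2 \<alpha>3 \<beta> \<beta>1 \<beta>2 \<beta>3. 0 < T \<and>
    (\<forall>t. \<bar>t\<bar> < T \<longrightarrow> (\<alpha> has_real_derivative \<alpha>1 t) (at t) \<and> (\<alpha>1 has_real_derivative \<alpha>2 t) (at t)
      \<and> (\<alpha>2 has_real_derivative \<alpha>3 t) (at t) \<and> (\<beta> has_real_derivative \<beta>1 t) (at t)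
      \<and> (\<beta>1 has_real_derivative \<beta>2 t) (at t) \<and> (\<beta>2 has_real_derivative \<beta>3 t) (at t)) \<and>
    isCont \<alpha>3 0 \<and> isCont \<beta>3 0 \<and> \<alpha> 0 = b \<and> \<alpha>1 0 = 0 \<and> \<alpha>2 0 \<noteq> 0 \<and> 0 < \<beta>1 0 \<and>
    (\<forall>t. 0 < t \<longrightarrow> t < T \<longrightarrow> 0 < \<alpha> t \<and> \<alpha> t < b \<and> \<beta> t = f1 (\<alpha> t :: real))"
proof -
  define K where "K = rotational_body f1 f2 b"
  have K: "compact K" "convex K" "\<And>p. p \<in> frontier K \<Longrightarrow> \<exists>\<kappa>>0. has_gaussian_curvature (frontier K) p \<kappa>"
    using body unfolding smooth_convex_body_def K_def by auto
  have cl: "closed K" using K(1) by (rule compact_imp_closed)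
  have "vector [b, 0, f1 b] \<in> frontier K"
    unfolding K_def by (rule equator_mem_frontier) (use b le cl in \<open>auto simp: K_def\<close>)
  then obtain \<kappa> V X q where kap: "0 < \<kappa>" "param_curvature X q = \<kappa>" and par: "regular_parametrization (frontier K) V X"
    and q: "q \<in> V" "X q = vector [b, 0, f1 b]"
    using K(3) unfolding has_gaussian_curvature_def by blast
  have V: "open V" and sm: "smooth_on V X" and cr: "cross3 (du X q) (dv X q) \<noteq> 0"
    using par q unfolding regular_parametrization_def by auto
  have XV: "X x \<in> frontier K" if "x \<in> V" for x
    using par that unfolding regular_parametrization_def homeomorphism_def by blast
  define Df where "Df w F = (\<lambda>x. frechet_derivative F (at x) w)" for w :: "real \<times> real" and F :: "real \<times> real \<Rightarrow> real^3"
  have duD: "du F = Df (1, 0) F" "dv F = Df (0, 1) F" for F unfolding Df_def du_def dv_def by auto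
  have ck: "Ck_on (Suc (Suc (Suc 0))) V X" using sm unfolding smooth_on_def by blast
  have ckD: "(\<forall>x\<in>V. F differentiable (at x)) \<and> Ck_on k V (Df w F)" if "Ck_on (Suc k) V F" for k F w
    using that unfolding Ck_on.simps(2) Df_def by blast
  note ck1 = ckD[OF ck, THEN conjunct2]
  note ck2 = ckD[OF ck1, THEN conjunct2]
  have diff0: "X differentiable (at x)" if "x \<in> V" for x using ckD[OF ck] that by blast
  have diff1: "Df w X differentiable (at x)" if "x \<in> V" for x w using ckD[OF ck1] that by blast
  have diff2: "Df w' (Df w X) differentiable (at x)" if "x \<in> V" for x w w' using ckD[OF ck2] that by blast
  have cont3: "continuous_on V (Df w'' (Df w' (Df w X)))" for w w' w''
    using ckD[OF ck2, THEN conjunct2] unfolding Ck_on.simps(1) .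
  have cont2: "continuous_on V (Df w' (Df w X))" for w w'
    using diff2 by (intro continuous_at_imp_continuous_on ballI differentiable_imp_continuous_within) auto
  have line: "((\<lambda>t. F (x + t *\<^sub>R w) $ i) has_real_derivative Df w F (x + t *\<^sub>R w) $ i) (at t)"
    if "F differentiable (at (x + t *\<^sub>R w))" for F x t w i
    unfolding Df_def using that by (rule frechet_derivative_along_line)
  have line0: "((\<lambda>t. F (x + t *\<^sub>R w) $ i) has_real_derivative Df w F x $ i) (at 0)"
    if "F differentiable (at x)" for F x w i
    using line[of F x 0 w i] that by simp
  have pair: "Df (w1, w2) F x = w1 *\<^sub>R Df (1, 0) F x + w2 *\<^sub>R Df (0, 1) F x" if "F differentiable (at x)" for F x w1 w2
    using frechet_derivative_pair[OF that, of w1 w2] unfolding duD[symmetric] unfolding Df_def .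
  have X1le: "X x $ 1 \<le> b" if "x \<in> V" for x
  proof -
    have "X x \<in> K" using XV[OF that] cl unfolding frontier_def by auto
    then have "sqrt ((X x $ 1)\<^sup>2 + (X x $ 2)\<^sup>2) \<le> b" unfolding K_def mem_rotational_body Let_def by simp
    moreover have "X x $ 1 \<le> sqrt ((X x $ 1)\<^sup>2 + (X x $ 2)\<^sup>2)" by (rule real_le_rsqrt) simp
    ultimately show ?thesis by linarith
  qed
  have Tex: "\<exists>e>0. \<forall>t. \<bar>t\<bar> < e \<longrightarrow> q + t *\<^sub>R w \<in> V" for w :: "real \<times> real"
  proof -
    obtain e where e: "0 < e" "ball q e \<subseteq> V" using V q open_contains_ball by blast
    have "q + t *\<^sub>R w \<in> V" if "\<bar>t\<bar> < e / (norm w + 1)" for t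
    proof -
      have "\<bar>t\<bar> * norm w \<le> \<bar>t\<bar> * (norm w + 1)" by (intro mult_left_mono) auto
      also have "\<dots> < e" using that by (simp add: pos_less_divide_eq add_nonneg_pos)
      finally have "norm (t *\<^sub>R w) < e" by simp
      then show ?thesis using e(2) by (auto simp: dist_norm)
    qed
    moreover have "0 < e / (norm w + 1)" using e by (simp add: add_nonneg_pos)
    ultimately show ?thesis by blast
  qed
  have X1crit: "Df w X q $ 1 = 0" for w
  proof -
    obtain e where e: "0 < e" "\<And>t. \<bar>t\<bar> < e \<Longrightarrow> q + t *\<^sub>R w \<in> V" using Tex by blast
    have "((\<lambda>t. X (q + t *\<^sub>R w) $ 1) has_real_derivative Df w X (q + 0 *\<^sub>R w) $ 1) (at 0)"
      by (rule line) (use diff0 q in simp)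
    from DERIV_local_max[OF this e(1)] show ?thesis using X1le e(2) q by simp
  qed
  define A B where "A = du X q" and "B = dv X q"
  define \<Delta> where "\<Delta> = A$2 * B$3 - A$3 * B$2"
  \<comment> \<open>The tangent plane is vertical, so the unit normal is the first basis vector up
    to the sign of \<Delta>, and the second fundamental form is sgn \<Delta> times the Hessian of
    the first coordinate.\<close>
  have AB1: "A$1 = 0" "B$1 = 0" unfolding A_def B_def duD using X1crit by auto
  have cross: "cross3 A B = vector [\<Delta>, 0, 0]"
    unfolding cross3_def \<Delta>_def using AB1 by (simp add: vec_eq_iff forall_3)
  have D0: "\<Delta> \<noteq> 0" using cr cross unfolding A_def B_def by (auto simp: vec_eq_iff forall_3)
  have normc: "norm (vector [\<Delta>, 0, 0] :: real^3) = \<bar>\<Delta>\<bar>"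
    by (simp add: norm_vec_def L2_set_def sum_3)
  have un: "y \<bullet> unit_normal X q = y$1 * sgn \<Delta>" for y :: "real^3"
    unfolding unit_normal_def A_def[symmetric] B_def[symmetric] cross normc
    using D0 by (simp add: inner_vec_def sum_3 sgn_if)
  define a c m where "a = Df (1,0) (Df (1,0) X) q $ 1" and "c = Df (0,1) (Df (0,1) X) q $ 1"
    and "m = Df (0,1) (Df (1,0) X) q $ 1"
  have m': "m = Df (1,0) (Df (0,1) X) q $ 1"
    unfolding m_def
  proof (rule mixed_directional_derivatives_commute[OF V q(1), where \<phi> = "\<lambda>x. X x $ 1" and u = "(1,0)" and v = "(0,1)"
        and \<phi>u = "\<lambda>x. Df (1,0) X x $ 1" and \<phi>v = "\<lambda>x. Df (0,1) X x $ 1"])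
    fix x assume x: "x \<in> V"
    show "((\<lambda>t. X (x + t *\<^sub>R (1,0)) $ 1) has_real_derivative Df (1,0) X x $ 1) (at 0)"
      by (rule line0[OF diff0[OF x]])
    show "((\<lambda>t. X (x + t *\<^sub>R (0,1)) $ 1) has_real_derivative Df (0,1) X x $ 1) (at 0)"
      by (rule line0[OF diff0[OF x]])
    show "((\<lambda>t. Df (1,0) X (x + t *\<^sub>R (0,1)) $ 1) has_real_derivative Df (0,1) (Df (1,0) X) x $ 1) (at 0)"
      by (rule line0[OF diff1[OF x]])
    show "((\<lambda>t. Df (0,1) X (x + t *\<^sub>R (1,0)) $ 1) has_real_derivative Df (1,0) (Df (0,1) X) x $ 1) (at 0)"
      by (rule line0[OF diff1[OF x]])
  qed (intro continuous_intros cont2)+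
  \<comment> \<open>The sign of \<Delta> enters the numerator of the curvature squared, and the
    determinant of the first fundamental form is the squared length \<Delta>^2 of A x B. Positive
    curvature therefore means a positive Hessian determinant.\<close>
  have posdet: "m\<^sup>2 < a * c"
  proof -
    have sg: "sgn \<Delta> * sgn \<Delta> = 1" using D0 by (simp add: sgn_if)
    have num: "(du (du X) q \<bullet> unit_normal X q) * (dv (dv X) q \<bullet> unit_normal X q) - (dv (du X) q \<bullet> unit_normal X q)\<^sup>2
      = (a * c - m\<^sup>2) * (sgn \<Delta> * sgn \<Delta>)"
      unfolding un duD a_def c_def m_def by (simp add: power2_eq_square algebra_simps)
    have den: "(A \<bullet> A) * (B \<bullet> B) - (A \<bullet> B)\<^sup>2 = \<Delta>\<^sup>2"
      unfolding \<Delta>_def using AB1 by (simp add: inner_vec_def sum_3 power2_eq_square algebra_simps)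
    have "\<kappa> = (a * c - m\<^sup>2) / \<Delta>\<^sup>2"
      using kap(2) unfolding param_curvature_def num A_def[symmetric] B_def[symmetric] den sg by simp
    then have "0 < (a * c - m\<^sup>2) / \<Delta>\<^sup>2" using kap(1) by simp
    then show ?thesis using D0 by (simp add: zero_less_divide_iff)
  qed
  \<comment> \<open>A solution of w1 A$2 + w2 B$2 = 0, so that the curve starts parallel to the
    axis; the factor sgn \<Delta> makes it start upwards, with speed |\<Delta>|.\<close>
  define w1 w2 where "w1 = - sgn \<Delta> * B$2" and "w2 = sgn \<Delta> * A$2"
  define w where "w = (w1, w2)"
  have wX: "Df w X q = w1 *\<^sub>R A + w2 *\<^sub>R B"
    unfolding w_def A_def B_def duD by (rule pair[OF diff0[OF q(1)]])
  have wX': "Df w X x = w1 *\<^sub>R Df (1,0) X x + w2 *\<^sub>R Df (0,1) X x" if "x \<in> V" for x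
    unfolding w_def by (rule pair[OF diff0[OF that]])
  have wX2: "Df w X q $ 2 = 0" unfolding wX w1_def w2_def by (simp add: algebra_simps)
  have wX3: "Df w X q $ 3 = \<bar>\<Delta>\<bar>"
  proof -
    have "Df w X q $ 3 = sgn \<Delta> * \<Delta>" unfolding wX w1_def w2_def \<Delta>_def by (simp add: algebra_simps)
    then show ?thesis by (simp add: abs_sgn mult.commute)
  qed
  have w0: "w1 \<noteq> 0 \<or> w2 \<noteq> 0" using wX3 D0 unfolding wX by auto
  have wD: "Df v (Df w X) q = w1 *\<^sub>R Df v (Df (1,0) X) q + w2 *\<^sub>R Df v (Df (0,1) X) q" for v
  proof -
    have "((\<lambda>x. w1 *\<^sub>R Df (1,0) X x + w2 *\<^sub>R Df (0,1) X x) has_derivative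
        (\<lambda>h. w1 *\<^sub>R frechet_derivative (Df (1,0) X) (at q) h + w2 *\<^sub>R frechet_derivative (Df (0,1) X) (at q) h)) (at q)"
      using diff1[OF q(1)] frechet_derivative_works
      by (intro has_derivative_add has_derivative_scaleR_right) blast+
    then have "(Df w X has_derivative
        (\<lambda>h. w1 *\<^sub>R frechet_derivative (Df (1,0) X) (at q) h + w2 *\<^sub>R frechet_derivative (Df (0,1) X) (at q) h)) (at q)"
      by (rule has_derivative_transform_within_open[OF _ V q(1)]) (simp only: wX')
    then have "frechet_derivative (Df w X) (at q) =
        (\<lambda>h. w1 *\<^sub>R frechet_derivative (Df (1,0) X) (at q) h + w2 *\<^sub>R frechet_derivative (Df (0,1) X) (at q) h)"
      by (rule frechet_derivative_at[symmetric])
    then show ?thesis unfolding Df_def by simp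
  qed
  have x1'': "Df w (Df w X) q $ 1 = a * w1\<^sup>2 + 2 * m * w1 * w2 + c * w2\<^sup>2"
  proof -
    have "Df w (Df w X) q = w1 *\<^sub>R Df (1,0) (Df w X) q + w2 *\<^sub>R Df (0,1) (Df w X) q"
      using pair[OF diff1[OF q(1)], of w1 w2] unfolding w_def .
    then show ?thesis unfolding wD using m' by (simp add: a_def c_def m_def power2_eq_square algebra_simps)
  qed
  have x1n: "Df w (Df w X) q $ 1 \<noteq> 0"
  proof
    assume z: "Df w (Df w X) q $ 1 = 0"
    \<comment> \<open>Completing the square: a quadratic form with positive determinant vanishes
      only at the origin.\<close>
    have "a * (a * w1\<^sup>2 + 2 * m * w1 * w2 + c * w2\<^sup>2) = (a * w1 + m * w2)\<^sup>2 + (a * c - m\<^sup>2) * w2\<^sup>2"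
      by (simp add: power2_eq_square algebra_simps)
    then have s: "(a * w1 + m * w2)\<^sup>2 + (a * c - m\<^sup>2) * w2\<^sup>2 = 0" using z x1'' by simp
    have n: "0 \<le> (a * w1 + m * w2)\<^sup>2" "0 \<le> (a * c - m\<^sup>2) * w2\<^sup>2" using posdet by auto
    then have "(a * c - m\<^sup>2) * w2\<^sup>2 = 0" "(a * w1 + m * w2)\<^sup>2 = 0" using s by linarith+
    then have "w2 = 0" "a * w1 + m * w2 = 0" using posdet by auto
    moreover have "a \<noteq> 0" using posdet zero_le_power2[of m] by auto
    ultimately show False using w0 by auto
  qed
  define x0 x1 x2 x3 where "x0 i t = X (q + t *\<^sub>R w) $ i" and "x1 i t = Df w X (q + t *\<^sub>R w) $ i"
    and "x2 i t = Df w (Df w X) (q + t *\<^sub>R w) $ i" and "x3 i t = Df w (Df w (Df w X)) (q + t *\<^sub>R w) $ i" for i :: 3 and t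
  obtain e where e: "0 < e" "\<And>t. \<bar>t\<bar> < e \<Longrightarrow> q + t *\<^sub>R w \<in> V" using Tex by blast
  have dx: "(x0 i has_real_derivative x1 i t) (at t)" "(x1 i has_real_derivative x2 i t) (at t)"
    "(x2 i has_real_derivative x3 i t) (at t)" if "\<bar>t\<bar> < e" for i t
    unfolding x0_def x1_def x2_def x3_def
    using e(2)[OF that] by (auto intro!: line diff0 diff1 diff2)
  have cx: "isCont (x0 i) 0" "isCont (x1 i) 0" "isCont (x2 i) 0" for i
    using dx[of 0 i] e(1) by (auto intro: DERIV_isCont)
  have cx3: "isCont (x3 i) 0" for i
  proof -
    have "isCont (Df w (Df w (Df w X))) (q + 0 *\<^sub>R w)"
      using cont3 V q by (simp add: continuous_on_eq_continuous_at)
    moreover have "isCont (\<lambda>t. q + t *\<^sub>R w) 0" by (intro continuous_intros)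
    ultimately have "isCont (\<lambda>t. Df w (Df w (Df w X)) (q + t *\<^sub>R w)) 0"
      by (rule isCont_o2[rotated])
    then show ?thesis unfolding x3_def by (intro continuous_intros)
  qed
  have at0: "x0 1 0 = b" "x0 2 0 = 0" "x0 3 0 = f1 b" "x1 1 0 = 0" "x1 2 0 = 0" "0 < x1 3 0" "x2 1 0 \<noteq> 0"
    unfolding x0_def x1_def x2_def using q(2) X1crit wX2 wX3 x1n D0 by simp_all
  obtain d1 where d1: "0 < d1" "\<And>t. \<bar>t\<bar> < d1 \<Longrightarrow> \<bar>x0 1 t - b\<bar> < b"
    using isCont_zero_eps[OF cx(1)[of 1] b] at0 by auto
  \<comment> \<open>For small t > 0 the curve is above the height f1 b, hence on the upper
    graph.\<close>
  obtain d2 where d2: "0 < d2" "\<And>t. 0 < t \<Longrightarrow> t < d2 \<Longrightarrow> f1 b < x0 3 t"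
    using DERIV_pos_inc_right[OF dx(1)[of 0 3] at0(6)] e(1) at0 by auto
  define T where "T = min e (min d1 d2)"
  have T: "0 < T" "T \<le> e" "T \<le> d1" "T \<le> d2" unfolding T_def using e d1 d2 by auto
  \<comment> \<open>Squared distance from the axis, as the curve need not stay in the meridian
    plane. The second coordinate and its derivative vanish at 0, so \<alpha>2(0) is the second
    derivative of the first coordinate, which is nonzero by \<open>x1n\<close>.\<close>
  define W where "W t = x0 1 t * x0 1 t + x0 2 t * x0 2 t" for t
  define W1 where "W1 t = 2 * (x0 1 t * x1 1 t + x0 2 t * x1 2 t)" for t
  define W2 where "W2 t = 2 * (x0 1 t * x2 1 t + x1 1 t * x1 1 t + (x0 2 t * x2 2 t + x1 2 t * x1 2 t))" for t
  define W3 where "W3 t = 2 * (x0 1 t * x3 1 t + 3 * (x1 1 t * x2 1 t) + (x0 2 t * x3 2 t + 3 * (x1 2 t * x2 2 t)))" for t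
  have Wpos: "0 < W t" if "\<bar>t\<bar> < T" for t
  proof -
    have "0 < x0 1 t" using d1(2)[of t] that T by auto
    then show ?thesis unfolding W_def by (intro add_pos_nonneg) auto
  qed
  have dW: "(W has_real_derivative W1 t) (at t)" if "\<bar>t\<bar> < T" for t
  proof -
    have t: "\<bar>t\<bar> < e" using that T by simp
    show ?thesis unfolding W_def W1_def
      by (rule DERIV_cong[OF DERIV_add[OF DERIV_mult[OF dx(1)[OF t] dx(1)[OF t]] DERIV_mult[OF dx(1)[OF t] dx(1)[OF t]]]])
        (simp add: algebra_simps)
  qed
  have dW1: "(W1 has_real_derivative W2 t) (at t)" if "\<bar>t\<bar> < T" for t
  proof -
    have t: "\<bar>t\<bar> < e" using that T by simp
    show ?thesis unfolding W1_def W2_def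
      by (rule DERIV_cong[OF DERIV_cmult[OF DERIV_add[OF DERIV_mult[OF dx(1)[OF t] dx(2)[OF t]] DERIV_mult[OF dx(1)[OF t] dx(2)[OF t]]]]])
        (simp add: algebra_simps)
  qed
  have dW2: "(W2 has_real_derivative W3 t) (at t)" if "\<bar>t\<bar> < T" for t
  proof -
    have t: "\<bar>t\<bar> < e" using that T by simp
    show ?thesis unfolding W2_def W3_def
      by (rule DERIV_cong[OF DERIV_cmult[OF DERIV_add[
            OF DERIV_add[OF DERIV_mult[OF dx(1)[OF t] dx(3)[OF t]] DERIV_mult[OF dx(2)[OF t] dx(2)[OF t]]]
               DERIV_add[OF DERIV_mult[OF dx(1)[OF t] dx(3)[OF t]] DERIV_mult[OF dx(2)[OF t] dx(2)[OF t]]]]]])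
        (simp add: algebra_simps)
  qed
  define \<alpha> where "\<alpha> t = sqrt (W t)" for t
  define \<alpha>1 where "\<alpha>1 t = W1 t / (2 * \<alpha> t)" for t
  define \<alpha>2 where "\<alpha>2 t = (W2 t / 2 - (\<alpha>1 t)\<^sup>2) / \<alpha> t" for t
  define \<alpha>3 where "\<alpha>3 t = (W3 t / 2 - 3 * \<alpha>1 t * \<alpha>2 t) / \<alpha> t" for t
  have da: "(\<alpha> has_real_derivative \<alpha>1 t) (at t)" "(\<alpha>1 has_real_derivative \<alpha>2 t) (at t)"
    "(\<alpha>2 has_real_derivative \<alpha>3 t) (at t)" if "\<bar>t\<bar> < T" for t
    using sqrt_curve_derivatives[of T W W1 W2 W3 t, OF Wpos dW dW1 dW2 that]
    unfolding \<alpha>_def[abs_def] \<alpha>1_def[abs_def] \<alpha>2_def[abs_def] \<alpha>3_def[abs_def] by blast+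
  have al0: "\<alpha> 0 = b" unfolding \<alpha>_def W_def using at0 b by simp
  have al1: "\<alpha>1 0 = 0" unfolding \<alpha>1_def W1_def using at0 by simp
  have al2: "\<alpha>2 0 \<noteq> 0" unfolding \<alpha>2_def al1 al0 W2_def using at0 b by simp
  have "isCont \<alpha> 0" "isCont \<alpha>1 0" "isCont \<alpha>2 0" using da[of 0] T by (auto intro: DERIV_isCont)
  moreover have "isCont W3 0" unfolding W3_def by (intro continuous_intros cx cx3)
  ultimately have ca3: "isCont \<alpha>3 0" unfolding \<alpha>3_def by (intro continuous_intros) (use al0 b in auto)
  have comp: "0 < \<alpha> t \<and> \<alpha> t < b \<and> x0 3 t = f1 (\<alpha> t)" if t: "0 < t" "t < T" for t
  proof -
    have inV: "q + t *\<^sub>R w \<in> V" using e(2) t T by simp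
    have "f1 b < X (q + t *\<^sub>R w) $ 3" using d2(2)[of t] t T unfolding x0_def by simp
    from frontier_rotational_body_above[OF le K(2)[unfolded K_def] cl[unfolded K_def] b cont
        XV[OF inV, unfolded K_def] this]
    have "\<alpha> t < b \<and> x0 3 t = f1 (\<alpha> t)"
      unfolding \<alpha>_def W_def x0_def by (simp add: power2_eq_square)
    moreover have "0 < \<alpha> t" unfolding \<alpha>_def using Wpos[of t] t by simp
    ultimately show ?thesis by simp
  qed
  have dx': "(x0 3 has_real_derivative x1 3 t) (at t)" "(x1 3 has_real_derivative x2 3 t) (at t)"
    "(x2 3 has_real_derivative x3 3 t) (at t)" if "\<bar>t\<bar> < T" for t
    using dx[of t 3] that T by auto
  show ?thesis
    by (rule exI[of _ T], rule exI[of _ \<alpha>], rule exI[of _ \<alpha>1], rule exI[of _ \<alpha>2], rule exI[of _ \<alpha>3],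
        rule exI[of _ "x0 3"], rule exI[of _ "x1 3"], rule exI[of _ "x2 3"], rule exI[of _ "x3 3"])
      (use T(1) da dx' ca3 cx3 al0 al1 al2 at0(6) comp in blast)
qed

section \<open>Sign and size of the profile quantity up to the equator, and the conclusion\<close>

lemma continuous_bounded_away_from_zero:
  fixes Q :: "real \<Rightarrow> real"
  assumes "continuous_on {a..b} Q" "\<And>x. a \<le> x \<Longrightarrow> x \<le> b \<Longrightarrow> Q x \<noteq> 0"
  shows "\<exists>q1 q2. 0 < q1 \<and> (\<forall>x\<in>{a..b}. q1 \<le> \<bar>Q x\<bar> \<and> \<bar>Q x\<bar> \<le> q2)"
proof (cases "a \<le> b")
  case True
  have c: "continuous_on {a..b} (\<lambda>x. \<bar>Q x\<bar>)" by (intro continuous_intros assms)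
  obtain x where x: "x \<in> {a..b}" "\<forall>y\<in>{a..b}. \<bar>Q x\<bar> \<le> \<bar>Q y\<bar>"
    using continuous_attains_inf[OF _ _ c] True by auto
  obtain x' where x': "x' \<in> {a..b}" "\<forall>y\<in>{a..b}. \<bar>Q y\<bar> \<le> \<bar>Q x'\<bar>"
    using continuous_attains_sup[OF _ _ c] True by auto
  show ?thesis using x x' assms(2)[of x] by (intro exI[of _ "\<bar>Q x\<bar>"] exI[of _ "\<bar>Q x'\<bar>"]) auto
next
  case False
  then show ?thesis by (intro exI[of _ 1]) auto
qed

lemma nonvanishing_same_sign:
  fixes g :: "real \<Rightarrow> real"
  assumes "continuous_on {a<..<b} g" "\<And>x. a < x \<Longrightarrow> x < b \<Longrightarrow> g x \<noteq> 0"
    and "x \<in> {a<..<b}" "y \<in> {a<..<b}"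
  shows "sgn (g x) = sgn (g y)"
proof (rule ccontr)
  assume ne: "sgn (g x) \<noteq> sgn (g y)"
  have "connected (g ` {a<..<b})" by (rule connected_continuous_image[OF assms(1)]) simp
  moreover have "g x \<in> g ` {a<..<b}" "g y \<in> g ` {a<..<b}" using assms by auto
  moreover have "(g x \<le> 0 \<and> 0 \<le> g y) \<or> (g y \<le> 0 \<and> 0 \<le> g x)"
    using ne by (auto simp: sgn_if split: if_splits)
  ultimately have "0 \<in> g ` {a<..<b}" using connectedD_interval by blast
  then show False using assms(2) by auto
qed

theorem theorem3:
  fixes r_inf :: real and f1 f2 :: "real \<Rightarrow> real"
    and r :: "nat \<Rightarrow> real" and j0 :: nat and u_j0 \<epsilon> :: real
    and K :: "(real^3) set"
  defines "K \<equiv> rotational_body f1 f2 r_inf"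
    and "u_j0 \<equiv> (deriv_within {0..<r_inf} f1 (r j0))\<^sup>2"
  assumes "r_inf > 0"
    and "\<forall>t\<in>{0..r_inf}. f2 t \<le> f1 t"
    and "smooth_convex_body K"
    and "real_analytic_on {0..<r_inf} f1"
    and "real_analytic_on {0..<r_inf} f2"
    and "0 < j0" and "r 0 = 0" and "strict_mono_on {..j0} r"
    and "r ` {..<j0} = {t \<in> {0..<r_inf}. (deriv_within {0..<r_inf} ^^ 3) f1 t = 0}"
    and "r j0 < r_inf"
    and "\<epsilon> > 0"
  shows "\<exists>C>0. \<forall>R M U. R > 1 \<longrightarrow> M > 0 \<longrightarrow> 2 * M \<le> R powr (5/8) \<longrightarrow>
           u_j0 \<le> U \<longrightarrow> U \<le> R powr (5/4) / M\<^sup>2 \<longrightarrow>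
           cmod (exp_sum K R U (2 * U) M) \<le> C * (U * M\<^sup>2 * R powr (3/8 + \<epsilon>))"
proof -
  define b where "b = r_inf"
  define f where "f = f1"
  note b = \<open>r_inf > 0\<close>[folded b_def] and le = \<open>\<forall>t\<in>{0..r_inf}. f2 t \<le> f1 t\<close>[folded b_def f_def]
  have K: "K = rotational_body f f2 b" unfolding K_def b_def f_def ..
  have body: "smooth_convex_body (rotational_body f f2 b)" using \<open>smooth_convex_body K\<close> unfolding K .
  then have cvx: "convex (rotational_body f f2 b)" unfolding smooth_convex_body_def by simp
  have an: "real_analytic_on {0..<b} f" using \<open>real_analytic_on {0..<r_inf} f1\<close> unfolding b_def f_def .
  have cont: "continuous_on {0..<b} f" by (rule real_analytic_on_imp_continuous_on[OF an])
  have anI: "real_analytic_on {0<..<b} f" by (rule real_analytic_on_subset[OF an]) auto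
  define g1 where "g1 = deriv f"
  define g2 where "g2 = deriv g1"
  define g3 where "g3 = deriv g2"
  note A0 = real_analytic_on_deriv[OF anI open_greaterThanLessThan, folded g1_def]
  note A1 = real_analytic_on_deriv[OF A0(2) open_greaterThanLessThan, folded g2_def]
  note A2 = real_analytic_on_deriv[OF A1(2) open_greaterThanLessThan, folded g3_def]
  note A3 = real_analytic_on_deriv[OF A2(2) open_greaterThanLessThan]
  have d0: "(f has_real_derivative g1 x) (at x)" if "0 < x" "x < b" for x using A0(1) that by simp
  have d1: "(g1 has_real_derivative g2 x) (at x)" if "0 < x" "x < b" for x using A1(1) that by simp
  have d2: "(g2 has_real_derivative g3 x) (at x)" if "0 < x" "x < b" for x using A2(1) that by simp
  have c3: "isCont g3 x" if "0 < x" "x < b" for x using A3(1)[of x] that by (auto intro: DERIV_isCont)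
  have dw1: "deriv_within {0..<b} f x = g1 x" if "x \<in> {0<..<b}" for x
    by (rule deriv_within_eq[OF that]) (use d0 that in auto)
  have dw2: "deriv_within {0..<b} (deriv_within {0..<b} f) x = g2 x" if "x \<in> {0<..<b}" for x
    by (rule deriv_within_eq[OF that dw1]) (use d1 that in auto)
  have dw3: "(deriv_within {0..<b} ^^ 3) f x = g3 x" if "x \<in> {0<..<b}" for x
  proof -
    have "deriv_within {0..<b} (deriv_within {0..<b} (deriv_within {0..<b} f)) x = g3 x"
      by (rule deriv_within_eq[OF that dw2]) (use d2 that in auto)
    then show ?thesis by (simp add: numeral_3_eq_3)
  qed
  \<comment> \<open>The last zero of f''': between it and the equator \<open>g3\<close> keeps its
    sign.\<close>
  define a where "a = r (j0 - 1)"
  define r0 where "r0 = r j0"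
  have zeros: "r ` {..<j0} = {t \<in> {0..<b}. (deriv_within {0..<b} ^^ 3) f t = 0}"
    using \<open>r ` {..<j0} = _\<close> unfolding b_def f_def .
  have a0: "0 \<le> a" using zeros \<open>0 < j0\<close> 
  proof -
    have "a \<in> r ` {..<j0}" unfolding a_def using \<open>0 < j0\<close> by (intro imageI) auto
    then show ?thesis unfolding zeros by simp
  qed
  have ar0: "a < r0" unfolding a_def r0_def
    using \<open>0 < j0\<close> by (intro strict_mono_onD[OF \<open>strict_mono_on {..j0} r\<close>]) auto
  have r0b: "r0 < b" using \<open>r j0 < r_inf\<close> unfolding r0_def b_def .
  have g3n: "g3 x \<noteq> 0" if x: "a < x" "x < b" for x
  proof
    assume "g3 x = 0"
    then have "x \<in> r ` {..<j0}" unfolding zeros using dw3[of x] x a0 by auto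
    then obtain i where i: "i < j0" "x = r i" by auto
    have "r i \<le> r (j0 - 1)"
    proof (cases "i = j0 - 1")
      case False
      then have "i < j0 - 1" using i by simp
      then show ?thesis
        by (intro less_imp_le strict_mono_onD[OF \<open>strict_mono_on {..j0} r\<close>]) auto
    qed simp
    then show False using x i unfolding a_def by simp
  qed
  note prof = rotational_body_profile[OF le cvx]
  have tangent: "f y \<le> f x + g1 x * (y - x)" if "0 < x" "x < b" "0 \<le> y" "y \<le> b" for x y
  proof -
    have "- f y - - f x \<ge> - g1 x * (y - x)"
    proof (rule convex_on_imp_above_tangent[OF prof(1)])
      show "((\<lambda>x. - f x) has_real_derivative - g1 x) (at x within {0..b})"
        using d0[OF that(1,2)] by (intro DERIV_subset[OF DERIV_minus]) auto
    qed (use that in auto)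
    then show ?thesis by simp
  qed
  have g1anti: "g1 y \<le> g1 x" if "0 < x" "x < y" "y < b" for x y
  proof -
    have "f y \<le> f x + g1 x * (y - x)" "f x \<le> f y + g1 y * (x - y)" using that by (auto intro!: tangent)
    then have "(g1 y - g1 x) * (y - x) \<le> 0" by (simp add: algebra_simps)
    then show ?thesis using that by (simp add: mult_le_0_iff)
  qed
  have g1np: "g1 x \<le> 0" if "0 < x" "x < b" for x
  proof -
    have "f 0 \<le> f x + g1 x * (0 - x)" using that by (intro tangent) auto
    moreover have "f x \<le> f 0" using prof(2)[of 0 x] that by simp
    ultimately have "g1 x * x \<le> f x - f 0" "f x - f 0 \<le> 0" by auto
    then have "g1 x * x \<le> 0" by linarith
    then show ?thesis using that by (simp add: mult_le_0_iff)
  qed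
  have g2np: "g2 x \<le> 0" if x: "0 < x" "x < b" for x
  proof (rule ccontr)
    assume "\<not> g2 x \<le> 0"
    then obtain d where d: "0 < d" "\<And>h. 0 < h \<Longrightarrow> h < d \<Longrightarrow> g1 x < g1 (x + h)"
      using DERIV_pos_inc_right[OF d1[OF x]] by auto
    define h where "h = min d (b - x) / 2"
    have "0 < h" "h < d" "h < b - x" unfolding h_def using d x by (auto simp: min_def)
    then show False using d(2)[of h] g1anti[of x "x + h"] x by auto
  qed
  have cg3: "continuous_on {a<..<b} g3"
    using c3 a0 by (intro continuous_at_imp_continuous_on ballI) auto
  have sg: "sgn (g3 x) = sgn (g3 r0)" if "a < x" "x < b" for x
    by (rule nonvanishing_same_sign[OF cg3 g3n]) (use that ar0 r0b in auto)
  define \<sigma> where "\<sigma> = sgn (g3 r0)"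
  have sig: "\<sigma> = 1 \<or> \<sigma> = -1" unfolding \<sigma>_def using g3n[OF ar0 r0b] by (auto simp: sgn_if)
  \<comment> \<open>Concavity yields only g2 <= 0. Strictness comes from the constant sign of
    \<open>g3\<close>: as g2 is strictly monotone, g2 x lies below a value g2 y <= 0 with y to the
    right or to the left of x.\<close>
  have g2neg: "g2 x < 0" if x: "a < x" "x < b" for x
  proof (cases "\<sigma> = 1")
    case True
    obtain y where y: "x < y" "y < b" using dense x by blast
    have "g2 x < g2 y"
    proof (rule DERIV_pos_imp_increasing[OF y(1)])
      fix z assume z: "x \<le> z" "z \<le> y"
      have "0 < g3 z" using sg[of z] True z x y unfolding \<sigma>_def by (auto simp: sgn_if split: if_splits)
      then show "\<exists>d. (g2 has_real_derivative d) (at z) \<and> 0 < d" using d2[of z] z x y a0 by auto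
    qed
    then show ?thesis using g2np[of y] x y a0 by auto
  next
    case False
    obtain y where y: "a < y" "y < x" using dense x by blast
    have "g2 x < g2 y"
    proof (rule DERIV_neg_imp_decreasing[OF y(2)])
      fix z assume z: "y \<le> z" "z \<le> x"
      have "g3 z < 0" using sg[of z] False g3n[of z] z x y unfolding \<sigma>_def by (auto simp: sgn_if split: if_splits)
      then show "\<exists>d. (g2 has_real_derivative d) (at z) \<and> d < 0" using d2[of z] z x y a0 by auto
    qed
    then show ?thesis using g2np[of y] x y a0 by auto
  qed
  \<comment> \<open>The same device one order lower: g1 is strictly decreasing on (a, b) and
    nonpositive to the left of x.\<close>
  have g1neg: "g1 x < 0" if x: "a < x" "x < b" for x
  proof -
    obtain y where y: "a < y" "y < x" using dense x by blast
    have "g1 x < g1 y"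
    proof (rule DERIV_neg_imp_decreasing[OF y(2)])
      fix z assume z: "y \<le> z" "z \<le> x"
      then show "\<exists>d. (g1 has_real_derivative d) (at z) \<and> d < 0" using d1[of z] g2neg[of z] x y a0 by auto
    qed
    then show ?thesis using g1np[of y] x y a0 by auto
  qed
  define Q where "Q x = g3 x * g1 x ^ 4 / g2 x ^ 3" for x
  obtain T \<alpha> \<alpha>1 \<alpha>2 \<alpha>3 \<beta> \<beta>1 \<beta>2 \<beta>3 where T: "0 < (T::real)" and
    dd: "\<forall>t. \<bar>t\<bar> < T \<longrightarrow> (\<alpha> has_real_derivative \<alpha>1 t) (at t) \<and> (\<alpha>1 has_real_derivative \<alpha>2 t) (at t)
      \<and> (\<alpha>2 has_real_derivative \<alpha>3 t) (at t) \<and> (\<beta> has_real_derivative \<beta>1 t) (at t)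
      \<and> (\<beta>1 has_real_derivative \<beta>2 t) (at t) \<and> (\<beta>2 has_real_derivative \<beta>3 t) (at t)" and
    cc: "isCont \<alpha>3 0" "isCont \<beta>3 0" and z: "\<alpha> 0 = b" "\<alpha>1 0 = 0" "\<alpha>2 0 \<noteq> 0" "0 < \<beta>1 0" and
    comp: "\<forall>t. 0 < t \<longrightarrow> t < T \<longrightarrow> 0 < \<alpha> t \<and> \<alpha> t < b \<and> \<beta> t = f (\<alpha> t)"
    using equator_curve[OF b le body cont] by blast
  have near: "\<exists>\<eta> q1 q2. 0 < \<eta> \<and> \<eta> \<le> b \<and> 0 < q1 \<and>
      (\<forall>x. b - \<eta> < x \<and> x < b \<longrightarrow> q1 \<le> \<bar>g3 x * g1 x ^ 4 / g2 x ^ 3\<bar> \<and> \<bar>g3 x * g1 x ^ 4 / g2 x ^ 3\<bar> \<le> q2)"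
    by (rule profile_near_equator(1)[OF b d0 d1 d2 T, of \<alpha> \<alpha>1 \<alpha>2 \<alpha>3 \<beta> \<beta>1 \<beta>2 \<beta>3])
      (use dd cc z comp in auto)
  have unb: "\<exists>x. 0 < x \<and> b - \<eta> < x \<and> x < b \<and> s < \<bar>g1 x\<bar>" if "0 < \<eta>" for \<eta> s
    by (rule profile_near_equator(2)[OF b d0 d1 d2 T, of \<alpha> \<alpha>1 \<alpha>2 \<alpha>3 \<beta> \<beta>1 \<beta>2 \<beta>3])
      (use dd cc z comp that in auto)
  obtain \<eta> p1 p2 where p: "0 < \<eta>" "0 < p1"
    "\<And>x. b - \<eta> < x \<Longrightarrow> x < b \<Longrightarrow> p1 \<le> \<bar>Q x\<bar> \<and> \<bar>Q x\<bar> \<le> p2"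
    using near unfolding Q_def by blast
  have Qn: "Q x \<noteq> 0" if "a < x" "x < b" for x
    unfolding Q_def using g1neg[OF that] g2neg[OF that] g3n[OF that] by simp
  \<comment> \<open>Away from the equator compactness gives the bounds. Stopping at b - \<eta> / 2
    lets this interval overlap the range x > b - \<eta> already treated.\<close>
  have cQ: "continuous_on {r0..b - \<eta> / 2} Q"
    unfolding Q_def
  proof (intro continuous_intros continuous_at_imp_continuous_on ballI)
    fix x assume x: "x \<in> {r0..b - \<eta> / 2}"
    then have xx: "0 < x" "x < b" "a < x" using ar0 a0 p(1) by auto
    show "isCont g1 x" "isCont g2 x" "isCont g3 x"
      using d1[OF xx(1,2)] d2[OF xx(1,2)] c3[OF xx(1,2)] by (auto intro: DERIV_isCont)
    show "g2 x ^ 3 \<noteq> 0" using g2neg[OF xx(3,2)] by simp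
  qed
  have "\<exists>q1 q2. 0 < q1 \<and> (\<forall>x\<in>{r0..b - \<eta> / 2}. q1 \<le> \<bar>Q x\<bar> \<and> \<bar>Q x\<bar> \<le> q2)"
    by (rule continuous_bounded_away_from_zero[OF cQ]) (use Qn ar0 p(1) in auto)
  then obtain s1 s2 where s: "0 < s1" "\<And>x. x \<in> {r0..b - \<eta> / 2} \<Longrightarrow> s1 \<le> \<bar>Q x\<bar> \<and> \<bar>Q x\<bar> \<le> s2"
    by blast
  define q1 q2 where "q1 = min p1 s1" and "q2 = max p2 s2"
  have q1: "0 < q1" unfolding q1_def using p s by simp
  have Qb: "q1 \<le> \<bar>Q x\<bar> \<and> \<bar>Q x\<bar> \<le> q2" if "r0 \<le> x" "x < b" for x
  proof (cases "x \<le> b - \<eta> / 2")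
    case True then show ?thesis using s(2)[of x] that unfolding q1_def q2_def by auto
  next
    case False then show ?thesis using p(1) p(3)[of x] that unfolding q1_def q2_def by auto
  qed
  \<comment> \<open>The factor g1^4 / g2^3 is negative, so - Q has the sign \<sigma> of
    \<open>g3\<close>.\<close>
  have sQ: "\<sigma> * - Q x = \<bar>Q x\<bar>" if x: "a < x" "x < b" for x
  proof -
    have "0 < - (g1 x ^ 4 / g2 x ^ 3)"
      using g1neg[OF x] g2neg[OF x] by (simp add: divide_pos_neg power_less_zero_eq)
    moreover have "- Q x = g3 x * - (g1 x ^ 4 / g2 x ^ 3)" unfolding Q_def by simp
    ultimately have "sgn (- Q x) = \<sigma>" using sg[OF x] unfolding \<sigma>_def by (simp only: sgn_mult sgn_pos mult_1_right)
    then have "\<sigma> * - Q x = \<bar>- Q x\<bar>" using abs_sgn[of "- Q x"] by (simp add: mult.commute)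
    then show ?thesis by simp
  qed
  have "phase_condition (h_fun K) ((g1 r0)\<^sup>2) \<sigma> (q1 / 384) (q2 / 4)"
  proof (rule phase_condition_of_profile[OF ar0 r0b, of f g1 g2 g3])
    fix s
    obtain x where "0 < x" "b - (b - a) < x" "x < b" "s < \<bar>g1 x\<bar>" using unb[of "b - a" s] ar0 r0b by auto
    then show "\<exists>r>a. r < b \<and> s < - g1 r" using g1neg[of x] by (intro exI[of _ x]) auto
  next
    fix x assume x: "r0 \<le> x" "x < b"
    then show "q1 \<le> \<sigma> * - (g3 x * g1 x ^ 4 / g2 x ^ 3) \<and> \<sigma> * - (g3 x * g1 x ^ 4 / g2 x ^ 3) \<le> q2"
      using Qb[OF x] sQ[of x] ar0 unfolding Q_def by auto
  next
    fix x m s :: real assume xm: "0 < x" "0 < m" and s: "a < s" "s < b" "- g1 s = sqrt x / m"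
    have g: "g1 s = - (sqrt x / m)" using s(3) by linarith
    show "h_fun K x m = m * f s + sqrt x * s" unfolding K
    proof (rule h_fun_rotational_body)
      fix y assume "0 \<le> y" "y \<le> b"
      then show "f y \<le> f s - sqrt x / m * (y - s)"
        using tangent[of s y] s(1,2) a0 unfolding g by simp
    qed (use s a0 le xm in auto)
  qed (use d0 d1 d2 a0 g1neg g2neg q1 in auto)
  moreover have "u_j0 = (g1 r0)\<^sup>2"
    unfolding u_j0_def using dw1[of r0] ar0 a0 r0b unfolding b_def f_def r0_def by simp
  moreover have "0 < (g1 r0)\<^sup>2" using g1neg[OF ar0 r0b] by simp
  moreover have "q1 / 384 \<le> q2 / 4" using Qb[of r0] q1 r0b by auto
  ultimately show ?thesis
    using exp_sum_bound_of_phase_condition[of K u_j0 \<sigma> "q1 / 384" "q2 / 4" \<epsilon>] sig q1 \<open>\<epsilon> > 0\<close> by auto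
qed

end
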